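(* Let $R$ be a commutative noetherian local ring and let $M$ and $N$ be finitely generated nonzero $R$-modules. Then $$\operatorname{Supp}(M\otimes_R N)=\bigcup_{i=0}^{\infty}\operatorname{Supp}(\operatorname{Ext}^i_R(M,N))=\bigcup_{i=0}^{\dim N}\operatorname{Supp}(\operatorname{Ext}^i_R(M,N)).$$ In particular, $\bigcup_{i\geq 0}\operatorname{Supp}(\operatorname{Ext}^i_R(M,R))=\operatorname{Supp}(M)$.
   Context: $\dim N$ is the Krull dimension of the support of $N$. (The set $\bigcup_{i\ge 0}\operatorname{Supp}(\operatorname{Ext}^i_R(M,R))$ is called the homological support of $M$.) *)

theory Defs
  imports "HOL-Algebra.Module" "HOL-Algebra.Ring_Divisibility" "HOL-Library.Extended_Nat"
begin

text \<open>
  Rings are HOL-Algebra structures \<open>R\<close>, and an \<open>R\<close>-module is a structure \<open>M\<close> with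
  \<^term>\<open>module R M\<close>.  The fields \<open>mult\<close> and \<open>one\<close> that the module record inherits from the ring
  record play no role and are left \<^term>\<open>undefined\<close> in the constructions below.
\<close>

section \<open>Local rings, finitely generated modules\<close>

definition local_ring :: "('a, 'r) ring_scheme \<Rightarrow> bool" where
  "local_ring R \<longleftrightarrow> cring R \<and> (\<exists>!I. maximalideal I R)"

definition submodule_span ::
    "('a, 'r) ring_scheme \<Rightarrow> ('a, 'm, 'x) module_scheme \<Rightarrow> 'm set \<Rightarrow> 'm set" where
  "submodule_span R M S = \<Inter>{H. submodule H R M \<and> S \<subseteq> H}"

definition finitely_generated ::
    "('a, 'r) ring_scheme \<Rightarrow> ('a, 'm, 'x) module_scheme \<Rightarrow> bool" where
  "finitely_generated R M \<longleftrightarrow>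
     (\<exists>S. finite S \<and> S \<subseteq> carrier M \<and> submodule_span R M S = carrier M)"

definition ring_as_module :: "('a, 'r) ring_scheme \<Rightarrow> ('a, 'a) module" where
  "ring_as_module R =
     \<lparr>carrier = carrier R, monoid.mult = undefined, one = undefined,
      ring.zero = \<zero>\<^bsub>R\<^esub>, add = (\<lambda>x y. x \<oplus>\<^bsub>R\<^esub> y), smult = (\<lambda>a x. a \<otimes>\<^bsub>R\<^esub> x)\<rparr>"

section \<open>Quotient modules, free modules, tensor products\<close>

definition quotient_module ::
    "('a, 'm, 'x) module_scheme \<Rightarrow> 'm set \<Rightarrow> ('a, 'm set) module" where
  "quotient_module M H =
     \<lparr>carrier = a_rcosets\<^bsub>M\<^esub> H, monoid.mult = undefined, one = undefined,
      ring.zero = H, add = (\<lambda>X Y. X <+>\<^bsub>M\<^esub> Y),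
      smult = (\<lambda>a X. \<Union>x\<in>X. H +>\<^bsub>M\<^esub> (a \<odot>\<^bsub>M\<^esub> x))\<rparr>"

text \<open>The free module on a set \<open>B\<close>: the finitely supported functions from \<open>B\<close> to \<open>R\<close>, extended
  by zero outside \<open>B\<close>.\<close>

definition free_module :: "('a, 'r) ring_scheme \<Rightarrow> 'b set \<Rightarrow> ('a, 'b \<Rightarrow> 'a) module" where
  "free_module R B =
     \<lparr>carrier = {f. range f \<subseteq> carrier R \<and> finite {x. f x \<noteq> \<zero>\<^bsub>R\<^esub>} \<and> {x. f x \<noteq> \<zero>\<^bsub>R\<^esub>} \<subseteq> B},
      monoid.mult = undefined, one = undefined,
      ring.zero = (\<lambda>_. \<zero>\<^bsub>R\<^esub>), add = (\<lambda>f g x. f x \<oplus>\<^bsub>R\<^esub> g x), smult = (\<lambda>a f x. a \<otimes>\<^bsub>R\<^esub> f x)\<rparr>"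

definition unit_vector :: "('a, 'r) ring_scheme \<Rightarrow> 'b \<Rightarrow> 'b \<Rightarrow> 'a" where
  "unit_vector R x = (\<lambda>y. if y = x then \<one>\<^bsub>R\<^esub> else \<zero>\<^bsub>R\<^esub>)"

definition linear_extension ::
    "('a, 'r) ring_scheme \<Rightarrow> ('a, 'm, 'x) module_scheme \<Rightarrow> ('b \<Rightarrow> 'm) \<Rightarrow> ('b \<Rightarrow> 'a) \<Rightarrow> 'm" where
  "linear_extension R M g f = (\<Oplus>\<^bsub>M\<^esub>x\<in>{x. f x \<noteq> \<zero>\<^bsub>R\<^esub>}. f x \<odot>\<^bsub>M\<^esub> g x)"

definition tensor_relations ::
    "('a, 'r) ring_scheme \<Rightarrow> ('a, 'm, 'x) module_scheme \<Rightarrow> ('a, 'n, 'y) module_scheme \<Rightarrow>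
     ('m \<times> 'n \<Rightarrow> 'a) set" where
  "tensor_relations R M N =
     (let F = free_module R (carrier M \<times> carrier N); e = unit_vector R in
      {e (x \<oplus>\<^bsub>M\<^esub> x', y) \<ominus>\<^bsub>F\<^esub> (e (x, y) \<oplus>\<^bsub>F\<^esub> e (x', y)) | x x' y.
         x \<in> carrier M \<and> x' \<in> carrier M \<and> y \<in> carrier N} \<union>
      {e (x, y \<oplus>\<^bsub>N\<^esub> y') \<ominus>\<^bsub>F\<^esub> (e (x, y) \<oplus>\<^bsub>F\<^esub> e (x, y')) | x y y'.
         x \<in> carrier M \<and> y \<in> carrier N \<and> y' \<in> carrier N} \<union>
      {e (a \<odot>\<^bsub>M\<^esub> x, y) \<ominus>\<^bsub>F\<^esub> a \<odot>\<^bsub>F\<^esub> e (x, y) | a x y.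
         a \<in> carrier R \<and> x \<in> carrier M \<and> y \<in> carrier N} \<union>
      {e (x, a \<odot>\<^bsub>N\<^esub> y) \<ominus>\<^bsub>F\<^esub> a \<odot>\<^bsub>F\<^esub> e (x, y) | a x y.
         a \<in> carrier R \<and> x \<in> carrier M \<and> y \<in> carrier N})"

definition tensor_product ::
    "('a, 'r) ring_scheme \<Rightarrow> ('a, 'm, 'x) module_scheme \<Rightarrow> ('a, 'n, 'y) module_scheme \<Rightarrow>
     ('a, ('m \<times> 'n \<Rightarrow> 'a) set) module" where
  "tensor_product R M N =
     (let F = free_module R (carrier M \<times> carrier N)
      in quotient_module F (submodule_span R F (tensor_relations R M N)))"

section \<open>Localization, support and dimension\<close>

definition fraction_rel ::
    "('a, 'r) ring_scheme \<Rightarrow> ('a, 'm, 'x) module_scheme \<Rightarrow> 'a set \<Rightarrow> (('m \<times> 'a) \<times> ('m \<times> 'a)) set" where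
  "fraction_rel R M S =
     {((x, s), (x', s')). x \<in> carrier M \<and> x' \<in> carrier M \<and> s \<in> S \<and> s' \<in> S \<and>
        (\<exists>t\<in>S. t \<odot>\<^bsub>M\<^esub> (s' \<odot>\<^bsub>M\<^esub> x) = t \<odot>\<^bsub>M\<^esub> (s \<odot>\<^bsub>M\<^esub> x'))}"

text \<open>The localization \<open>M\<^sub>p\<close> at a prime \<open>p\<close>, regarded as an \<open>R\<close>-module; the \<open>R\<^sub>p\<close>-action is not
  needed to say whether it is zero.\<close>

definition localization ::
    "('a, 'r) ring_scheme \<Rightarrow> ('a, 'm, 'x) module_scheme \<Rightarrow> 'a set \<Rightarrow> ('a, ('m \<times> 'a) set) module" where
  "localization R M p =
     (let S = carrier R - p; frac = (\<lambda>x s. fraction_rel R M S `` {(x, s)}) in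
      \<lparr>carrier = (carrier M \<times> S) // fraction_rel R M S, monoid.mult = undefined, one = undefined,
       ring.zero = frac \<zero>\<^bsub>M\<^esub> \<one>\<^bsub>R\<^esub>,
       add = (\<lambda>X Y. \<Union>(x, s)\<in>X. \<Union>(y, t)\<in>Y.
                frac (t \<odot>\<^bsub>M\<^esub> x \<oplus>\<^bsub>M\<^esub> s \<odot>\<^bsub>M\<^esub> y) (s \<otimes>\<^bsub>R\<^esub> t)),
       smult = (\<lambda>a X. \<Union>(x, s)\<in>X. frac (a \<odot>\<^bsub>M\<^esub> x) s)\<rparr>)"

definition Supp :: "('a, 'r) ring_scheme \<Rightarrow> ('a, 'm, 'x) module_scheme \<Rightarrow> 'a set set" where
  "Supp R M =
     {p. primeideal p R \<and> carrier (localization R M p) \<noteq> {\<zero>\<^bsub>localization R M p\<^esub>}}"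

text \<open>The Krull dimension of the support, as the supremum of the lengths \<open>n\<close> of chains
  \<open>p\<^sub>0 \<subset> \<dots> \<subset> p\<^sub>n\<close> of primes in it.  For the zero module, whose support is empty, the
  supremum in \<^typ>\<open>enat\<close> is \<open>0\<close>; the value is only meant for nonzero modules.\<close>

definition module_dim :: "('a, 'r) ring_scheme \<Rightarrow> ('a, 'm, 'x) module_scheme \<Rightarrow> enat" where
  "module_dim R M =
     Sup {enat n | n. \<exists>p. (\<forall>i\<le>n. p i \<in> Supp R M) \<and> (\<forall>i<n. p i \<subset> p (Suc i))}"

section \<open>Modules of homomorphisms\<close>

text \<open>Homomorphisms are required to be \<^term>\<open>undefined\<close> off the carrier, so that equality of
  functions is equality of homomorphisms.\<close>

definition hom_module ::
    "('a, 'r) ring_scheme \<Rightarrow> ('a, 'm, 'x) module_scheme \<Rightarrow> ('a, 'n, 'y) module_scheme \<Rightarrow>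
     ('a, 'm \<Rightarrow> 'n) module" where
  "hom_module R M N =
     \<lparr>carrier = {f \<in> carrier M \<rightarrow>\<^sub>E carrier N.
        (\<forall>x\<in>carrier M. \<forall>y\<in>carrier M. f (x \<oplus>\<^bsub>M\<^esub> y) = f x \<oplus>\<^bsub>N\<^esub> f y) \<and>
        (\<forall>a\<in>carrier R. \<forall>x\<in>carrier M. f (a \<odot>\<^bsub>M\<^esub> x) = a \<odot>\<^bsub>N\<^esub> f x)},
      monoid.mult = undefined, one = undefined,
      ring.zero = (\<lambda>x\<in>carrier M. \<zero>\<^bsub>N\<^esub>),
      add = (\<lambda>f g. \<lambda>x\<in>carrier M. f x \<oplus>\<^bsub>N\<^esub> g x),
      smult = (\<lambda>a f. \<lambda>x\<in>carrier M. a \<odot>\<^bsub>N\<^esub> f x)\<rparr>"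

section \<open>The standard free resolution\<close>

text \<open>
  Ext is computed from the resolution \<open>\<dots> \<rightarrow> F\<^sub>1 \<rightarrow> F\<^sub>0 \<rightarrow> M \<rightarrow> 0\<close> in which \<open>F\<^sub>0\<close> is free on the
  elements of \<open>M\<close> and \<open>F\<^sub>n\<^sub>+\<^sub>1\<close> is free on (formal expressions for) the elements of the kernel of
  the map out of \<open>F\<^sub>n\<close>.  To have all \<open>F\<^sub>n\<close> in one type, their bases are taken from the
  following datatype: \<open>Gen x\<close> is the basis element of \<open>F\<^sub>0\<close> over \<open>x\<close>, and
  \<open>Syz [(a\<^sub>1, b\<^sub>1), \<dots>, (a\<^sub>k, b\<^sub>k)]\<close> is a basis element of \<open>F\<^sub>n\<^sub>+\<^sub>1\<close> sent to
  \<open>a\<^sub>1 b\<^sub>1 + \<dots> + a\<^sub>k b\<^sub>k\<close> in \<open>F\<^sub>n\<close>.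
\<close>

datatype ('a, 'm) res_index = Gen (gen_elem: 'm) | Syz (syz_comb: "('a \<times> ('a, 'm) res_index) list")

definition formal_comb :: "('a, 'r) ring_scheme \<Rightarrow> ('a \<times> 'b) list \<Rightarrow> 'b \<Rightarrow> 'a" where
  "formal_comb R xs =
     foldr (\<lambda>(a, x) f y. a \<otimes>\<^bsub>R\<^esub> unit_vector R x y \<oplus>\<^bsub>R\<^esub> f y) xs (\<lambda>_. \<zero>\<^bsub>R\<^esub>)"

definition std_augmentation ::
    "('a, 'r) ring_scheme \<Rightarrow> ('a, 'm, 'x) module_scheme \<Rightarrow> (('a, 'm) res_index \<Rightarrow> 'a) \<Rightarrow> 'm" where
  "std_augmentation R M = linear_extension R M gen_elem"

definition syzygy_map ::
    "('a, 'r) ring_scheme \<Rightarrow> ('a, 'm) res_index set \<Rightarrow>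
     (('a, 'm) res_index \<Rightarrow> 'a) \<Rightarrow> (('a, 'm) res_index \<Rightarrow> 'a)" where
  "syzygy_map R B = linear_extension R (free_module R B) (\<lambda>b. formal_comb R (syz_comb b))"

fun std_basis ::
    "('a, 'r) ring_scheme \<Rightarrow> ('a, 'm, 'x) module_scheme \<Rightarrow> nat \<Rightarrow> ('a, 'm) res_index set" where
  "std_basis R M 0 = Gen ` carrier M"
| "std_basis R M (Suc 0) =
     {Syz xs | xs. xs \<in> lists (carrier R \<times> std_basis R M 0) \<and>
        std_augmentation R M (formal_comb R xs) = \<zero>\<^bsub>M\<^esub>}"
| "std_basis R M (Suc (Suc n)) =
     {Syz xs | xs. xs \<in> lists (carrier R \<times> std_basis R M (Suc n)) \<and>
        syzygy_map R (std_basis R M n) (formal_comb R xs) = (\<lambda>_. \<zero>\<^bsub>R\<^esub>)}"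

definition std_free ::
    "('a, 'r) ring_scheme \<Rightarrow> ('a, 'm, 'x) module_scheme \<Rightarrow> nat \<Rightarrow>
     ('a, ('a, 'm) res_index \<Rightarrow> 'a) module" where
  "std_free R M n = free_module R (std_basis R M n)"

text \<open>The differential \<open>F\<^sub>n\<^sub>+\<^sub>1 \<rightarrow> F\<^sub>n\<close>.\<close>

definition std_diff ::
    "('a, 'r) ring_scheme \<Rightarrow> ('a, 'm, 'x) module_scheme \<Rightarrow> nat \<Rightarrow>
     (('a, 'm) res_index \<Rightarrow> 'a) \<Rightarrow> (('a, 'm) res_index \<Rightarrow> 'a)" where
  "std_diff R M n = syzygy_map R (std_basis R M n)"

section \<open>Ext\<close>

definition ext_coboundary_map ::
    "('a, 'r) ring_scheme \<Rightarrow> ('a, 'm, 'x) module_scheme \<Rightarrow> nat \<Rightarrow>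
     ((('a, 'm) res_index \<Rightarrow> 'a) \<Rightarrow> 'n) \<Rightarrow> ((('a, 'm) res_index \<Rightarrow> 'a) \<Rightarrow> 'n)" where
  "ext_coboundary_map R M i \<phi> = compose (carrier (std_free R M (Suc i))) \<phi> (std_diff R M i)"

definition ext_cocycles ::
    "('a, 'r) ring_scheme \<Rightarrow> ('a, 'm, 'x) module_scheme \<Rightarrow> ('a, 'n, 'y) module_scheme \<Rightarrow> nat \<Rightarrow>
     ((('a, 'm) res_index \<Rightarrow> 'a) \<Rightarrow> 'n) set" where
  "ext_cocycles R M N i =
     {\<phi> \<in> carrier (hom_module R (std_free R M i) N).
        ext_coboundary_map R M i \<phi> = \<zero>\<^bsub>hom_module R (std_free R M (Suc i)) N\<^esub>}"

fun ext_coboundaries ::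
    "('a, 'r) ring_scheme \<Rightarrow> ('a, 'm, 'x) module_scheme \<Rightarrow> ('a, 'n, 'y) module_scheme \<Rightarrow> nat \<Rightarrow>
     ((('a, 'm) res_index \<Rightarrow> 'a) \<Rightarrow> 'n) set" where
  "ext_coboundaries R M N 0 = {\<zero>\<^bsub>hom_module R (std_free R M 0) N\<^esub>}"
| "ext_coboundaries R M N (Suc i) =
     ext_coboundary_map R M i ` carrier (hom_module R (std_free R M i) N)"

definition Ext ::
    "('a, 'r) ring_scheme \<Rightarrow> ('a, 'm, 'x) module_scheme \<Rightarrow> ('a, 'n, 'y) module_scheme \<Rightarrow> nat \<Rightarrow>
     ('a, ((('a, 'm) res_index \<Rightarrow> 'a) \<Rightarrow> 'n) set) module" where
  "Ext R M N i =
     quotient_module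
       ((hom_module R (std_free R M i) N)\<lparr>carrier := ext_cocycles R M N i\<rparr>)
       (ext_coboundaries R M N i)"

section \<open>Exactness of the standard resolution\<close>

lemma free_module_simps:
  "carrier (free_module R B) =
     {f. range f \<subseteq> carrier R \<and> finite {x. f x \<noteq> \<zero>\<^bsub>R\<^esub>} \<and> {x. f x \<noteq> \<zero>\<^bsub>R\<^esub>} \<subseteq> B}"
  "\<zero>\<^bsub>free_module R B\<^esub> = (\<lambda>_. \<zero>\<^bsub>R\<^esub>)"
  "f \<oplus>\<^bsub>free_module R B\<^esub> g = (\<lambda>x. f x \<oplus>\<^bsub>R\<^esub> g x)"
  "a \<odot>\<^bsub>free_module R B\<^esub> f = (\<lambda>x. a \<otimes>\<^bsub>R\<^esub> f x)"
  by (simp_all add: free_module_def)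

lemma free_module_is_module:
  assumes "cring R" shows "Module.module R (free_module R B)"
proof -
  interpret R: cring R by fact
  have fin: "finite {x. f x \<oplus>\<^bsub>R\<^esub> g x \<noteq> \<zero>\<^bsub>R\<^esub>}"
    if "finite {x. f x \<noteq> \<zero>\<^bsub>R\<^esub>}" "finite {x. g x \<noteq> \<zero>\<^bsub>R\<^esub>}" for f g :: "'c \<Rightarrow> 'a"
    by (rule finite_subset[OF _ finite_UnI[OF that]]) auto
  have fin2: "finite {x. a \<otimes>\<^bsub>R\<^esub> f x \<noteq> \<zero>\<^bsub>R\<^esub>}"
    if "finite {x. f x \<noteq> \<zero>\<^bsub>R\<^esub>}" "a \<in> carrier R" for f :: "'c \<Rightarrow> 'a" and a
    by (rule finite_subset[OF _ that(1)]) (use that in auto)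
  have fin3: "finite {x. \<ominus>\<^bsub>R\<^esub> f x \<noteq> \<zero>\<^bsub>R\<^esub>}"
    if "finite {x. f x \<noteq> \<zero>\<^bsub>R\<^esub>}" for f :: "'c \<Rightarrow> 'a"
    by (rule finite_subset[OF _ that(1)]) auto
  have "abelian_group (free_module R B)"
  proof (rule abelian_groupI)
    fix f g assume f: "f \<in> carrier (free_module R B)" and g: "g \<in> carrier (free_module R B)"
    have "{x. f x \<oplus>\<^bsub>R\<^esub> g x \<noteq> \<zero>\<^bsub>R\<^esub>} \<subseteq> B"
      using f g unfolding free_module_simps by (auto, metis (mono_tags, lifting) R.r_zero R.zero_closed mem_Collect_eq subsetD)
    then show "f \<oplus>\<^bsub>free_module R B\<^esub> g \<in> carrier (free_module R B)"
      using f g fin unfolding free_module_simps by (auto simp: image_subset_iff)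
  next
    fix f assume f: "f \<in> carrier (free_module R B)"
    show "\<exists>y\<in>carrier (free_module R B). y \<oplus>\<^bsub>free_module R B\<^esub> f = \<zero>\<^bsub>free_module R B\<^esub>"
      using f fin3[of f] unfolding free_module_simps
      by (intro bexI[of _ "\<lambda>x. \<ominus>\<^bsub>R\<^esub> f x"]) (auto simp: image_subset_iff R.l_neg)
  qed (auto simp: free_module_simps image_subset_iff R.a_ac)
  then show ?thesis
  proof (rule moduleI[OF \<open>cring R\<close>])
    fix a f assume "a \<in> carrier R" and f: "f \<in> carrier (free_module R B)"
    then show "a \<odot>\<^bsub>free_module R B\<^esub> f \<in> carrier (free_module R B)"
      using fin2 unfolding free_module_simps by (auto simp: image_subset_iff)
  qed (auto simp: free_module_simps image_subset_iff R.l_distr R.r_distr R.m_assoc)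
qed

lemma unit_vector_carrier:
  assumes "cring R" "b \<in> B" shows "unit_vector R b \<in> carrier (free_module R B)"
proof -
  interpret R: cring R by fact
  have "finite {x. unit_vector R b x \<noteq> \<zero>\<^bsub>R\<^esub>}"
    by (rule finite_subset[of _ "{b}"]) (auto simp: unit_vector_def)
  then show ?thesis using assms(2)
    by (auto simp: free_module_simps unit_vector_def split: if_splits)
qed

context Module.module begin

lemma linear_extension_superset:
  assumes f: "f \<in> carrier (free_module R B)" and g: "g \<in> B \<rightarrow> carrier M"
    and A: "finite A" "{x. f x \<noteq> \<zero>} \<subseteq> A" "A \<subseteq> B"
  shows "linear_extension R M g f = (\<Oplus>\<^bsub>M\<^esub>x\<in>A. f x \<odot>\<^bsub>M\<^esub> g x)"
  unfolding linear_extension_def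
  by (rule M.add.finprod_mono_neutral_cong_left)
     (use f g A in \<open>auto simp: free_module_simps image_subset_iff Pi_def\<close>)

lemma linear_extension_closed:
  assumes f: "f \<in> carrier (free_module R B)" and g: "g \<in> B \<rightarrow> carrier M"
  shows "linear_extension R M g f \<in> carrier M"
  unfolding linear_extension_def
  by (rule M.finsum_closed) (use f g in \<open>auto simp: free_module_simps image_subset_iff Pi_def\<close>)

lemma linear_extension_add:
  assumes f: "f \<in> carrier (free_module R B)" and h: "h \<in> carrier (free_module R B)"
    and g: "g \<in> B \<rightarrow> carrier M"
  shows "linear_extension R M g (\<lambda>x. f x \<oplus> h x) = linear_extension R M g f \<oplus>\<^bsub>M\<^esub> linear_extension R M g h"
proof -
  interpret F: Module.module R "free_module R B" by (rule free_module_is_module) (rule R.is_cring)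
  let ?A = "{x. f x \<noteq> \<zero>} \<union> {x. h x \<noteq> \<zero>}"
  have A: "finite ?A" "?A \<subseteq> B" using f h by (auto simp: free_module_simps)
  have c: "(\<lambda>x. f x \<oplus> h x) \<in> carrier (free_module R B)"
    using F.add.m_closed[OF f h] by (simp add: free_module_simps)
  have s: "{x. f x \<oplus> h x \<noteq> \<zero>} \<subseteq> ?A" by auto
  have fc: "f x \<in> carrier R" "h x \<in> carrier R" for x using f h by (auto simp: free_module_simps)
  show ?thesis
    using linear_extension_superset[OF c g A(1) s A(2)]
      linear_extension_superset[OF f g A(1) _ A(2)] linear_extension_superset[OF h g A(1) _ A(2)]
      fc g A(2)
    by (auto simp: smult_l_distr Pi_def subset_iff intro!: M.finsum_addf[symmetric] M.finsum_cong' trans[OF M.finsum_cong' M.finsum_addf])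
qed

lemma linear_extension_smult:
  assumes f: "f \<in> carrier (free_module R B)" and a: "a \<in> carrier R"
    and g: "g \<in> B \<rightarrow> carrier M"
  shows "linear_extension R M g (\<lambda>x. a \<otimes> f x) = a \<odot>\<^bsub>M\<^esub> linear_extension R M g f"
proof -
  interpret F: Module.module R "free_module R B" by (rule free_module_is_module) (rule R.is_cring)
  let ?A = "{x. f x \<noteq> \<zero>}"
  have A: "finite ?A" "?A \<subseteq> B" using f by (auto simp: free_module_simps)
  have c: "(\<lambda>x. a \<otimes> f x) \<in> carrier (free_module R B)"
    using F.smult_closed[OF a f] by (simp add: free_module_simps)
  have s: "{x. a \<otimes> f x \<noteq> \<zero>} \<subseteq> ?A" using a by auto
  have fc: "f x \<in> carrier R" for x using f by (auto simp: free_module_simps)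
  have "linear_extension R M g (\<lambda>x. a \<otimes> f x) = (\<Oplus>\<^bsub>M\<^esub>x\<in>?A. (a \<otimes> f x) \<odot>\<^bsub>M\<^esub> g x)"
    by (rule linear_extension_superset[OF c g A(1) s A(2)])
  also have "\<dots> = (\<Oplus>\<^bsub>M\<^esub>x\<in>?A. a \<odot>\<^bsub>M\<^esub> (f x \<odot>\<^bsub>M\<^esub> g x))"
    using fc g A(2) a by (intro M.finsum_cong') (auto simp: smult_assoc1 Pi_def subset_iff)
  also have "\<dots> = a \<odot>\<^bsub>M\<^esub> (\<Oplus>\<^bsub>M\<^esub>x\<in>?A. f x \<odot>\<^bsub>M\<^esub> g x)"
    using fc g A a by (intro finsum_smult_ldistr[symmetric]) (auto simp: Pi_def subset_iff)
  finally show ?thesis by (simp add: linear_extension_def)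
qed

lemma linear_extension_unit:
  assumes b: "b \<in> B" and g: "g \<in> B \<rightarrow> carrier M"
  shows "linear_extension R M g (unit_vector R b) = g b"
proof -
  have "linear_extension R M g (unit_vector R b) = (\<Oplus>\<^bsub>M\<^esub>x\<in>{b}. unit_vector R b x \<odot>\<^bsub>M\<^esub> g x)"
    by (rule linear_extension_superset[OF unit_vector_carrier[OF R.is_cring b] g])
       (use b in \<open>auto simp: unit_vector_def\<close>)
  also have "\<dots> = g b" using b g by (subst M.finsum_insert) (auto simp: unit_vector_def Pi_def)
  finally show ?thesis .
qed

end

lemma formal_comb_simps:
  "formal_comb R [] = (\<lambda>_. \<zero>\<^bsub>R\<^esub>)"
  "formal_comb R ((a, x) # xs) = (\<lambda>y. a \<otimes>\<^bsub>R\<^esub> unit_vector R x y \<oplus>\<^bsub>R\<^esub> formal_comb R xs y)"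
  by (simp_all add: formal_comb_def)

lemma formal_comb_carrier:
  assumes "cring R" "xs \<in> lists (carrier R \<times> B)"
  shows "formal_comb R xs \<in> carrier (free_module R B)"
proof -
  interpret F: Module.module R "free_module R B" by (rule free_module_is_module) fact
  show ?thesis using assms(2)
  proof induction
    case Nil show ?case using F.M.zero_closed by (simp add: free_module_simps(2) formal_comb_simps)
  next
    case (Cons p xs)
    then obtain a x where "p = (a,x)" "a \<in> carrier R" "x \<in> B" by auto
    then show ?case using F.add.m_closed[OF F.smult_closed[OF _ unit_vector_carrier[OF assms(1)]] Cons.IH, of a x]
      by (simp add: formal_comb_simps free_module_simps(3,4))
  qed
qed

lemma formal_comb_surj:
  assumes "cring R" "f \<in> carrier (free_module R B)"
  shows "\<exists>xs\<in>lists (carrier R \<times> B). f = formal_comb R xs"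
proof -
  interpret R: cring R by fact
  have "finite {x. f x \<noteq> \<zero>\<^bsub>R\<^esub>}" using assms(2) by (simp add: free_module_simps)
  then show ?thesis using assms(2)
  proof (induction "{x. f x \<noteq> \<zero>\<^bsub>R\<^esub>}" arbitrary: f rule: finite_induct)
    case empty
    then have "f = (\<lambda>_. \<zero>\<^bsub>R\<^esub>)" by auto
    then show ?case by (intro bexI[of _ "[]"]) (auto simp: formal_comb_simps)
  next
    case (insert b F)
    let ?g = "f(b := \<zero>\<^bsub>R\<^esub>)"
    have F: "F = {x. ?g x \<noteq> \<zero>\<^bsub>R\<^esub>}" using insert.hyps by auto
    have "?g \<in> carrier (free_module R B)" using insert.prems insert.hyps F
      by (auto simp: free_module_simps)
    from insert.hyps(3)[OF F this] obtain xs where xs: "xs \<in> lists (carrier R \<times> B)" "?g = formal_comb R xs" by auto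
    have c: "f x \<in> carrier R" for x using insert.prems by (auto simp: free_module_simps)
    have b: "b \<in> B" using insert.prems insert.hyps by (auto simp: free_module_simps)
    have "f = formal_comb R ((f b, b) # xs)"
      unfolding formal_comb_simps xs(2)[symmetric] using c by (auto simp: unit_vector_def)
    with xs b c show ?case by (intro bexI[of _ "(f b, b) # xs"]) auto
  qed
qed

lemma hom_linear_extension_zero:
  assumes F: "Module.module R F" and M: "Module.module R M"
    and \<phi>: "\<phi> \<in> carrier F \<rightarrow> carrier M"
      "\<And>x y. x \<in> carrier F \<Longrightarrow> y \<in> carrier F \<Longrightarrow> \<phi> (x \<oplus>\<^bsub>F\<^esub> y) = \<phi> x \<oplus>\<^bsub>M\<^esub> \<phi> y"
      "\<And>a x. a \<in> carrier R \<Longrightarrow> x \<in> carrier F \<Longrightarrow> \<phi> (a \<odot>\<^bsub>F\<^esub> x) = a \<odot>\<^bsub>M\<^esub> \<phi> x"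
    and f: "f \<in> carrier (free_module R B)" and g: "g \<in> B \<rightarrow> carrier F"
    and z: "\<And>b. b \<in> B \<Longrightarrow> \<phi> (g b) = \<zero>\<^bsub>M\<^esub>"
  shows "\<phi> (linear_extension R F g f) = \<zero>\<^bsub>M\<^esub>"
proof -
  interpret F: Module.module R F by fact
  interpret M: Module.module R M by fact
  have z0: "\<phi> \<zero>\<^bsub>F\<^esub> = \<zero>\<^bsub>M\<^esub>"
    using \<phi>(3)[of "\<zero>\<^bsub>R\<^esub>" "\<zero>\<^bsub>F\<^esub>"] M.smult_l_null[of "\<phi> \<zero>\<^bsub>F\<^esub>"]
      funcset_mem[OF \<phi>(1) F.M.zero_closed] by auto
  have "A \<subseteq> B \<Longrightarrow> finite A \<Longrightarrow> \<phi> (\<Oplus>\<^bsub>F\<^esub>x\<in>A. f x \<odot>\<^bsub>F\<^esub> g x) = \<zero>\<^bsub>M\<^esub>" for A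
  proof (induction A rule: infinite_finite_induct)
    case (insert b A)
    have c: "f x \<in> carrier R" for x using f by (auto simp: free_module_simps)
    show ?case using insert c g z \<phi>
      by (subst F.finsum_insert) (auto simp: Pi_def subset_iff)
  qed (auto simp: z0)
  then show ?thesis unfolding linear_extension_def using f by (auto simp: free_module_simps)
qed

theorem std_resolution_exact:
  assumes "Module.module R M"
  defines "F \<equiv> std_free R M" and "d \<equiv> std_diff R M" and "\<epsilon> \<equiv> std_augmentation R M"
  shows "Module.module R (F n)"
    and "restrict \<epsilon> (carrier (F 0)) \<in> carrier (hom_module R (F 0) M)"
    and "restrict (d n) (carrier (F (Suc n))) \<in> carrier (hom_module R (F (Suc n)) (F n))"
    and "\<epsilon> ` carrier (F 0) = carrier M"
    and "{f \<in> carrier (F 0). \<epsilon> f = \<zero>\<^bsub>M\<^esub>} = d 0 ` carrier (F (Suc 0))"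
    and "{f \<in> carrier (F (Suc n)). d n f = \<zero>\<^bsub>F n\<^esub>} = d (Suc n) ` carrier (F (Suc (Suc n)))"
proof -
  interpret M: Module.module R M by fact
  note cr = M.R.is_cring
  have mF: "Module.module R (F n)" for n
    unfolding F_def std_free_def by (rule free_module_is_module) (rule cr)
  then show "Module.module R (F n)" .
  have g0: "gen_elem \<in> std_basis R M 0 \<rightarrow> carrier M" by auto
  have gS: "(\<lambda>b. formal_comb R (syz_comb b)) \<in> std_basis R M (Suc n) \<rightarrow> carrier (free_module R (std_basis R M n))" for n
    by (cases n) (auto intro!: formal_comb_carrier[OF cr])
  note M' = M.linear_extension_closed M.linear_extension_add M.linear_extension_smult
  have mF': "Module.module R (free_module R (std_basis R M n))" for n
    by (rule free_module_is_module) (rule cr)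
  note F' = module.linear_extension_closed[OF mF'] module.linear_extension_add[OF mF'] module.linear_extension_smult[OF mF']
  have e: "\<epsilon> \<in> carrier (F 0) \<rightarrow> carrier M"
    "\<And>x y. x \<in> carrier (F 0) \<Longrightarrow> y \<in> carrier (F 0) \<Longrightarrow> \<epsilon> (x \<oplus>\<^bsub>F 0\<^esub> y) = \<epsilon> x \<oplus>\<^bsub>M\<^esub> \<epsilon> y"
    "\<And>a x. a \<in> carrier R \<Longrightarrow> x \<in> carrier (F 0) \<Longrightarrow> \<epsilon> (a \<odot>\<^bsub>F 0\<^esub> x) = a \<odot>\<^bsub>M\<^esub> \<epsilon> x"
    using M'(1)[OF _ g0] M'(2)[OF _ _ g0] M'(3)[OF _ _ g0]
    unfolding F_def std_free_def \<epsilon>_def std_augmentation_def by (auto simp only: free_module_simps(3,4))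
  have d: "d n \<in> carrier (F (Suc n)) \<rightarrow> carrier (F n)"
    "\<And>x y. x \<in> carrier (F (Suc n)) \<Longrightarrow> y \<in> carrier (F (Suc n)) \<Longrightarrow> d n (x \<oplus>\<^bsub>F (Suc n)\<^esub> y) = d n x \<oplus>\<^bsub>F n\<^esub> d n y"
    "\<And>a x. a \<in> carrier R \<Longrightarrow> x \<in> carrier (F (Suc n)) \<Longrightarrow> d n (a \<odot>\<^bsub>F (Suc n)\<^esub> x) = a \<odot>\<^bsub>F n\<^esub> d n x" for n
    subgoal unfolding F_def std_free_def d_def std_diff_def syzygy_map_def by (intro Pi_I F'(1)[OF _ gS])
    subgoal for x y unfolding F_def std_free_def d_def std_diff_def syzygy_map_def
      using F'(2)[OF _ _ gS, of x n y] by (simp only: free_module_simps(3))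
    subgoal for a x unfolding F_def std_free_def d_def std_diff_def syzygy_map_def
      using F'(3)[OF _ _ gS, of x n a] by (simp only: free_module_simps(4))
    done
  have mc: "x \<oplus>\<^bsub>F n\<^esub> y \<in> carrier (F n)" "a \<odot>\<^bsub>F n\<^esub> x \<in> carrier (F n)"
    if "x \<in> carrier (F n)" "y \<in> carrier (F n)" "a \<in> carrier R" for x y a n
  proof -
    interpret Fn: Module.module R "F n" by (rule mF)
    show "x \<oplus>\<^bsub>F n\<^esub> y \<in> carrier (F n)" "a \<odot>\<^bsub>F n\<^esub> x \<in> carrier (F n)" using that by auto
  qed
  have mc1: "x \<in> carrier (F n) \<Longrightarrow> y \<in> carrier (F n) \<Longrightarrow> x \<oplus>\<^bsub>F n\<^esub> y \<in> carrier (F n)" for x y n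
    using mc(1)[of x n y "\<zero>\<^bsub>R\<^esub>"] by auto
  show "restrict \<epsilon> (carrier (F 0)) \<in> carrier (hom_module R (F 0) M)"
    using e mc(2) mc1 by (auto simp: hom_module_def)
  show "restrict (d n) (carrier (F (Suc n))) \<in> carrier (hom_module R (F (Suc n)) (F n))"
    using d mc(2) mc1 by (auto simp: hom_module_def)
  show "\<epsilon> ` carrier (F 0) = carrier M"
  proof
    show "carrier M \<subseteq> \<epsilon> ` carrier (F 0)"
    proof
      fix x assume x: "x \<in> carrier M"
      then have b: "Gen x \<in> std_basis R M 0" by simp
      from M.linear_extension_unit[OF b g0] unit_vector_carrier[OF cr b]
      show "x \<in> \<epsilon> ` carrier (F 0)" unfolding \<epsilon>_def F_def std_free_def std_augmentation_def
        by (metis image_eqI res_index.sel(1))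
    qed
  qed (use e in auto)
  have onto: "formal_comb R xs \<in> d n ` carrier (F (Suc n))" if "Syz xs \<in> std_basis R M (Suc n)" for xs n
    using module.linear_extension_unit[OF mF' that gS] unit_vector_carrier[OF cr that]
    unfolding d_def F_def std_free_def std_diff_def syzygy_map_def
    by (metis image_eqI res_index.sel(2))
  show "{f \<in> carrier (F 0). \<epsilon> f = \<zero>\<^bsub>M\<^esub>} = d 0 ` carrier (F (Suc 0))"
  proof
    show "{f \<in> carrier (F 0). \<epsilon> f = \<zero>\<^bsub>M\<^esub>} \<subseteq> d 0 ` carrier (F (Suc 0))"
    proof
      fix f assume f: "f \<in> {f \<in> carrier (F 0). \<epsilon> f = \<zero>\<^bsub>M\<^esub>}"
      then obtain xs where xs: "xs \<in> lists (carrier R \<times> std_basis R M 0)" "f = formal_comb R xs"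
        using formal_comb_surj[OF cr] unfolding F_def std_free_def by blast
      then show "f \<in> d 0 ` carrier (F (Suc 0))" using f onto[of xs 0] by (auto simp: \<epsilon>_def)
    qed
    show "d 0 ` carrier (F (Suc 0)) \<subseteq> {f \<in> carrier (F 0). \<epsilon> f = \<zero>\<^bsub>M\<^esub>}"
    proof clarify
      fix f assume f: "f \<in> carrier (F (Suc 0))"
      have "\<epsilon> (linear_extension R (F 0) (\<lambda>b. formal_comb R (syz_comb b)) f) = \<zero>\<^bsub>M\<^esub>"
        by (rule hom_linear_extension_zero[OF mF assms(1) e(1) _ _ f[unfolded F_def std_free_def]])
          (use e(2,3) gS[of 0] in \<open>auto simp: F_def std_free_def \<epsilon>_def simp del: std_basis.simps(1)\<close>)
      then have "\<epsilon> (d 0 f) = \<zero>\<^bsub>M\<^esub>"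
        by (simp add: d_def std_diff_def syzygy_map_def F_def std_free_def)
      then show "d 0 f \<in> carrier (F 0) \<and> \<epsilon> (d 0 f) = \<zero>\<^bsub>M\<^esub>" using d(1) f by auto
    qed
  qed
  have zF: "\<zero>\<^bsub>F n\<^esub> = (\<lambda>_. \<zero>\<^bsub>R\<^esub>)" for n by (simp add: F_def std_free_def free_module_simps)
  show "{f \<in> carrier (F (Suc n)). d n f = \<zero>\<^bsub>F n\<^esub>} = d (Suc n) ` carrier (F (Suc (Suc n)))"
  proof
    show "{f \<in> carrier (F (Suc n)). d n f = \<zero>\<^bsub>F n\<^esub>} \<subseteq> d (Suc n) ` carrier (F (Suc (Suc n)))"
    proof
      fix f assume f: "f \<in> {f \<in> carrier (F (Suc n)). d n f = \<zero>\<^bsub>F n\<^esub>}"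
      then obtain xs where xs: "xs \<in> lists (carrier R \<times> std_basis R M (Suc n))" "f = formal_comb R xs"
        using formal_comb_surj[OF cr] unfolding F_def std_free_def by blast
      then show "f \<in> d (Suc n) ` carrier (F (Suc (Suc n)))" using f onto[of xs "Suc n"]
        by (auto simp: d_def std_diff_def zF)
    qed
    show "d (Suc n) ` carrier (F (Suc (Suc n))) \<subseteq> {f \<in> carrier (F (Suc n)). d n f = \<zero>\<^bsub>F n\<^esub>}"
    proof clarify
      fix f assume f: "f \<in> carrier (F (Suc (Suc n)))"
      have "d n (linear_extension R (F (Suc n)) (\<lambda>b. formal_comb R (syz_comb b)) f) = \<zero>\<^bsub>F n\<^esub>"
        by (rule hom_linear_extension_zero[OF mF mF d(1) _ _ f[unfolded F_def std_free_def]])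
          (use d(2,3) gS[of "Suc n"] in \<open>auto simp: F_def std_free_def d_def std_diff_def free_module_simps(2)\<close>)
      then have "d n (d (Suc n) f) = \<zero>\<^bsub>F n\<^esub>"
        by (simp add: d_def std_diff_def syzygy_map_def F_def std_free_def)
      then show "d (Suc n) f \<in> carrier (F (Suc n)) \<and> d n (d (Suc n) f) = \<zero>\<^bsub>F n\<^esub>" using d(1) f by auto
    qed
  qed
qed

end

theory Submission
  imports Defs
begin

text \<open>
  Fix a prime \<open>p\<close>.  If \<open>p\<close> is not in the support of \<open>M\<close> or \<open>N\<close>, some \<open>s \<notin> p\<close> kills that module and
  hence the tensor product and all Ext modules; for \<open>M\<close> this uses that multiplication by \<open>s\<close> is
  null-homotopic on a free resolution.  Conversely let \<open>p\<close> be in both supports.  By Nakayama's lemma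
  there are linear maps from \<open>M\<close> and \<open>N\<close> to \<open>R/p\<close>, nonzero at \<open>p\<close>, and their product is a bilinear
  map that is nonzero at \<open>p\<close>.  For Ext, replace \<open>N\<close> by \<open>N/K\<close> and use induction on the submodule \<open>K\<close>:
  if \<open>p\<close> is the annihilator of some element \<open>y\<close> of \<open>N/K\<close>, then \<open>M \<rightarrow> R/p \<rightarrow> N/K\<close> shows that Hom is
  nonzero at \<open>p\<close>.  Otherwise prime avoidance gives \<open>x \<in> p\<close> regular on \<open>N/K\<close> at \<open>p\<close>, and the exact
  sequence of multiplication by \<open>x\<close> turns a nonzero Ext in degree \<open>i\<close> for \<open>N/(K + xN)\<close> into one for
  \<open>N/K\<close> in degree \<open>i\<close> or \<open>i + 1\<close>.  Each such step also lengthens a chain of primes in the support,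
  which bounds the degree by the dimension; no finiteness of the dimension is needed.
\<close>

section \<open>Submodules\<close>

text \<open>Both unions and the tensor side are compared with the intersection of the supports of
  \<open>M\<close> and \<open>N\<close>. The usual route commutes Ext with localization and works
  over the local ring at \<open>p\<close>, which needs a resolution by finitely generated free
  modules. The standard resolution is in general of infinite rank, and Hom out of it does not
  commute with localization. So nothing is localized here: a class is nonzero at \<open>p\<close> if
  no \<open>s\<close> outside \<open>p\<close> multiplies it into the coboundaries. The price is
  that an identity valid at \<open>p\<close> must be reached with one denominator \<open>s\<close>
  for all elements of a term of the resolution at once. Such an \<open>s\<close> exists because
  \<open>N\<close> is noetherian: among the submodules of elements that some \<open>s\<close>
  carries into \<open>K\<close>, a maximal one is the whole saturation of \<open>K\<close>. In the
  same spirit the map to \<open>R/p\<close> is built on \<open>M\<close> itself, with its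
  denominator cleared. Maps into \<open>N/K\<close> or \<open>R/p\<close> are kept as functions into
  \<open>N\<close> or \<open>R\<close> that are linear only modulo a submodule; on a free module
  they can be replaced by linear ones.\<close>

lemma (in noetherian_ring) wf_ideals:
  "wf {(J, I). ideal I R \<and> ideal J R \<and> I \<subset> J}"
proof (subst wf_iff_no_infinite_down_chain, rule notI)
  assume "\<exists>f. \<forall>i. (f (Suc i), f i) \<in> {(J, I). ideal I R \<and> ideal J R \<and> I \<subset> J}"
  then obtain f where f: "\<And>i. ideal (f i) R" "\<And>i. f i \<subset> f (Suc i)" by blast
  have mono: "f i \<subseteq> f j" if "i \<le> j" for i j
    by (rule lift_Suc_mono_le[OF _ that]) (use f(2) in auto)
  \<comment> \<open>\<open>ideal_chain_is_trivial\<close> speaks of the union of a chain of ideals,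
    so the sequence is presented as one; its union is some \<open>f n\<close>, which then contains
    \<open>f (Suc n)\<close>.\<close>
  have "f i \<subset> f j \<or> f j \<subset> f i \<or> f i = f j" for i j
    using mono[of i j] mono[of j i] nle_le[of i j] by blast
  then have "subset.chain {I. ideal I R} (range f)"
    unfolding pred_on.chain_def using f(1) by blast
  from ideal_chain_is_trivial[OF _ this] obtain n where "\<Union>(range f) = f n" by auto
  then have "f (Suc n) \<subseteq> f n" by blast
  with f(2) show False by blast
qed

context Module.module begin

lemma submodule_carrierD: "submodule K R M \<Longrightarrow> x \<in> K \<Longrightarrow> x \<in> carrier M"
  using submoduleE(1) by blast

lemma submodule_zero: assumes "submodule K R M" shows "\<zero>\<^bsub>M\<^esub> \<in> K"
  using submoduleE(2,4)[OF assms] submoduleE(1)[OF assms]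
  by (metis R.zero_closed all_not_in_conv smult_l_null subsetD)

lemma submodule_minus:
  "submodule K R M \<Longrightarrow> x \<in> K \<Longrightarrow> y \<in> K \<Longrightarrow> x \<ominus>\<^bsub>M\<^esub> y \<in> K"
  by (simp add: a_minus_def submoduleE)

lemmas submodule_closed = submodule_carrierD submodule_zero submodule_minus submoduleE(3-5)

lemma submodule_span_is_submodule:
  assumes "S \<subseteq> carrier M" shows "submodule (submodule_span R M S) R M"
proof (rule submoduleI)
  show "submodule_span R M S \<subseteq> carrier M"
    unfolding submodule_span_def using carrier_is_submodule assms by blast
qed (auto simp: submodule_span_def submodule_closed)

lemma submodule_span_superset: "S \<subseteq> submodule_span R M S"
  by (auto simp: submodule_span_def)

lemma submodule_span_minimal: "submodule H R M \<Longrightarrow> S \<subseteq> H \<Longrightarrow> submodule_span R M S \<subseteq> H"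
  by (auto simp: submodule_span_def)

lemma submodule_zero_set: "submodule {\<zero>\<^bsub>M\<^esub>} R M"
  by (rule submoduleI) auto

lemma submodule_set_add:
  assumes H: "submodule H R M" and K: "submodule K R M"
  shows "submodule (H <+>\<^bsub>M\<^esub> K) R M"
proof (rule submoduleI)
  show "H <+>\<^bsub>M\<^esub> K \<subseteq> carrier M"
    using submodule_closed[OF H] submodule_closed[OF K] by (auto simp: set_add_def')
  show "\<zero>\<^bsub>M\<^esub> \<in> H <+>\<^bsub>M\<^esub> K"
    using submodule_closed(2)[OF H] submodule_closed(2)[OF K]
    by (force simp: set_add_def')
next
  fix a assume "a \<in> H <+>\<^bsub>M\<^esub> K"
  then obtain h k where "h \<in> H" "k \<in> K" "a = h \<oplus>\<^bsub>M\<^esub> k" by (auto simp: set_add_def')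
  moreover from this have "\<ominus>\<^bsub>M\<^esub> a = \<ominus>\<^bsub>M\<^esub> h \<oplus>\<^bsub>M\<^esub> \<ominus>\<^bsub>M\<^esub> k"
    using submodule_closed(1)[OF H] submodule_closed(1)[OF K] by (simp add: M.minus_add)
  ultimately show "\<ominus>\<^bsub>M\<^esub> a \<in> H <+>\<^bsub>M\<^esub> K"
    using submodule_closed(4)[OF H] submodule_closed(4)[OF K] by (auto simp: set_add_def')
next
  fix a b assume "a \<in> H <+>\<^bsub>M\<^esub> K" "b \<in> H <+>\<^bsub>M\<^esub> K"
  then obtain h k h' k' where *: "h \<in> H" "k \<in> K" "a = h \<oplus>\<^bsub>M\<^esub> k" "h' \<in> H" "k' \<in> K" "b = h' \<oplus>\<^bsub>M\<^esub> k'"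
    by (auto simp: set_add_def')
  then have "a \<oplus>\<^bsub>M\<^esub> b = (h \<oplus>\<^bsub>M\<^esub> h') \<oplus>\<^bsub>M\<^esub> (k \<oplus>\<^bsub>M\<^esub> k')"
    using submodule_closed(1)[OF H] submodule_closed(1)[OF K] by (simp add: M.a_ac)
  then show "a \<oplus>\<^bsub>M\<^esub> b \<in> H <+>\<^bsub>M\<^esub> K"
    using * submoduleE(5)[OF H] submoduleE(5)[OF K] by (force simp: set_add_def')
next
  fix a x assume a: "a \<in> carrier R" and "x \<in> H <+>\<^bsub>M\<^esub> K"
  then obtain h k where *: "h \<in> H" "k \<in> K" "x = h \<oplus>\<^bsub>M\<^esub> k" by (auto simp: set_add_def')
  then have "a \<odot>\<^bsub>M\<^esub> x = a \<odot>\<^bsub>M\<^esub> h \<oplus>\<^bsub>M\<^esub> a \<odot>\<^bsub>M\<^esub> k"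
    using submodule_closed(1)[OF H] submodule_closed(1)[OF K] a by (simp add: smult_r_distr)
  then show "a \<odot>\<^bsub>M\<^esub> x \<in> H <+>\<^bsub>M\<^esub> K"
    using * a submoduleE(4)[OF H] submoduleE(4)[OF K] by (force simp: set_add_def')
qed

lemma set_add_superset:
  assumes H: "submodule H R M" and K: "submodule K R M"
  shows "H \<subseteq> H <+>\<^bsub>M\<^esub> K" and "K \<subseteq> H <+>\<^bsub>M\<^esub> K"
proof -
  have "x = x \<oplus>\<^bsub>M\<^esub> \<zero>\<^bsub>M\<^esub>" if "x \<in> H" for x using submodule_closed(1)[OF H that] by simp
  then show "H \<subseteq> H <+>\<^bsub>M\<^esub> K"
    using submodule_closed(2)[OF K] unfolding set_add_def' by blast
  have "x = \<zero>\<^bsub>M\<^esub> \<oplus>\<^bsub>M\<^esub> x" if "x \<in> K" for x using submodule_closed(1)[OF K that] by simp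
  then show "K \<subseteq> H <+>\<^bsub>M\<^esub> K"
    using submodule_closed(2)[OF H] unfolding set_add_def' by blast
qed

lemma submodule_cyclic:
  assumes "m \<in> carrier M" shows "submodule ((\<lambda>c. c \<odot>\<^bsub>M\<^esub> m) ` carrier R) R M"
proof (rule submoduleI)
  show "\<zero>\<^bsub>M\<^esub> \<in> (\<lambda>c. c \<odot>\<^bsub>M\<^esub> m) ` carrier R"
    using assms by (force intro: rev_image_eqI[of "\<zero>"])
  show "\<ominus>\<^bsub>M\<^esub> a \<in> (\<lambda>c. c \<odot>\<^bsub>M\<^esub> m) ` carrier R" if "a \<in> (\<lambda>c. c \<odot>\<^bsub>M\<^esub> m) ` carrier R" for a
    using that assms by (auto simp flip: smult_l_minus)
  show "a \<oplus>\<^bsub>M\<^esub> b \<in> (\<lambda>c. c \<odot>\<^bsub>M\<^esub> m) ` carrier R"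
    if "a \<in> (\<lambda>c. c \<odot>\<^bsub>M\<^esub> m) ` carrier R" "b \<in> (\<lambda>c. c \<odot>\<^bsub>M\<^esub> m) ` carrier R" for a b
    using that assms by (auto simp flip: smult_l_distr)
  show "a \<odot>\<^bsub>M\<^esub> x \<in> (\<lambda>c. c \<odot>\<^bsub>M\<^esub> m) ` carrier R"
    if "a \<in> carrier R" "x \<in> (\<lambda>c. c \<odot>\<^bsub>M\<^esub> m) ` carrier R" for a x
    using that assms by (auto simp flip: smult_assoc1)
qed (use assms in auto)

lemma submodule_smult_image:
  assumes "x \<in> carrier R" and N: "submodule N R M" shows "submodule ((\<odot>\<^bsub>M\<^esub>) x ` N) R M"
proof (rule submoduleI)
  note N' = submodule_closed[OF N]
  show "\<zero>\<^bsub>M\<^esub> \<in> (\<odot>\<^bsub>M\<^esub>) x ` N"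
    using assms N'(2) by (force intro: rev_image_eqI[of "\<zero>\<^bsub>M\<^esub>"])
  show "\<ominus>\<^bsub>M\<^esub> a \<in> (\<odot>\<^bsub>M\<^esub>) x ` N" if "a \<in> (\<odot>\<^bsub>M\<^esub>) x ` N" for a
    using that assms N' by (auto simp flip: smult_r_minus)
  show "a \<oplus>\<^bsub>M\<^esub> b \<in> (\<odot>\<^bsub>M\<^esub>) x ` N" if "a \<in> (\<odot>\<^bsub>M\<^esub>) x ` N" "b \<in> (\<odot>\<^bsub>M\<^esub>) x ` N" for a b
    using that assms N' by (auto simp flip: smult_r_distr)
  show "a \<odot>\<^bsub>M\<^esub> y \<in> (\<odot>\<^bsub>M\<^esub>) x ` N" if a: "a \<in> carrier R" and "y \<in> (\<odot>\<^bsub>M\<^esub>) x ` N" for a y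
  proof -
    from that obtain n where n: "n \<in> N" "y = x \<odot>\<^bsub>M\<^esub> n" by auto
    then have "a \<odot>\<^bsub>M\<^esub> y = x \<odot>\<^bsub>M\<^esub> (a \<odot>\<^bsub>M\<^esub> n)"
      using assms(1) a N'(1) by (metis R.m_comm smult_assoc1)
    with n a N' show ?thesis by auto
  qed
qed (use assms submodule_closed[OF N] in auto)

lemma submodule_span_insert:
  assumes m: "m \<in> carrier M" and S: "S \<subseteq> carrier M"
  shows "submodule_span R M (insert m S) = (\<lambda>c. c \<odot>\<^bsub>M\<^esub> m) ` carrier R <+>\<^bsub>M\<^esub> submodule_span R M S"
    (is "?L = ?C <+>\<^bsub>M\<^esub> ?S")
proof
  note C = submodule_cyclic[OF m] and S' = submodule_span_is_submodule[OF S]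
  have "m \<in> ?C" using m by (force intro: rev_image_eqI[of "\<one>"])
  then show "?L \<subseteq> ?C <+>\<^bsub>M\<^esub> ?S"
    using set_add_superset[OF C S'] submodule_span_superset[of S]
    by (intro submodule_span_minimal submodule_set_add C S') auto
  have L: "submodule ?L R M" using m S by (intro submodule_span_is_submodule) auto
  have "?C \<subseteq> ?L" using submoduleE(4)[OF L] submodule_span_superset[of "insert m S"] by auto
  moreover have "?S \<subseteq> ?L" using submodule_span_superset[of "insert m S"]
    by (intro submodule_span_minimal L) auto
  ultimately show "?C <+>\<^bsub>M\<^esub> ?S \<subseteq> ?L"
    using submoduleE(5)[OF L] by (auto simp: set_add_def')
qed

text \<open>This is the colon ideal \<open>(K + H : m)\<close>, the coefficients that
  \<open>m\<close> can have in elements of \<open>K\<close> modulo \<open>H\<close>. Below,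
  \<open>H\<close> is a span without \<open>m\<close>, and the zero submodule as \<open>K\<close>
  gives the ideals \<open>elem_colon\<close>.\<close>

lemma ideal_colon:
  assumes K: "submodule K R M" and m: "m \<in> carrier M" and H: "submodule H R M"
  shows "ideal {r \<in> carrier R. \<exists>k\<in>K. k \<ominus>\<^bsub>M\<^esub> r \<odot>\<^bsub>M\<^esub> m \<in> H} R" (is "ideal ?I R")
proof (rule idealI[OF R.ring_axioms])
  note K' = submodule_closed[OF K] and H' = submodule_closed[OF H]
  have smult: "x \<otimes> a \<in> ?I" if a: "a \<in> ?I" and x: "x \<in> carrier R" for a x
  proof -
    from a obtain k where k: "k \<in> K" "k \<ominus>\<^bsub>M\<^esub> a \<odot>\<^bsub>M\<^esub> m \<in> H" and a: "a \<in> carrier R" by auto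
    have "x \<odot>\<^bsub>M\<^esub> k \<ominus>\<^bsub>M\<^esub> (x \<otimes> a) \<odot>\<^bsub>M\<^esub> m = x \<odot>\<^bsub>M\<^esub> (k \<ominus>\<^bsub>M\<^esub> a \<odot>\<^bsub>M\<^esub> m)"
      using a x m K'(1)[OF k(1)] by (simp add: a_minus_def smult_r_distr smult_r_minus smult_assoc1)
    then show ?thesis using a x k K'(5) H'(5) by (auto intro!: bexI[of _ "x \<odot>\<^bsub>M\<^esub> k"])
  qed
  have add: "a \<oplus> b \<in> ?I" if ab: "a \<in> ?I" "b \<in> ?I" for a b
  proof -
    from ab obtain k l where k: "k \<in> K" "k \<ominus>\<^bsub>M\<^esub> a \<odot>\<^bsub>M\<^esub> m \<in> H" and a: "a \<in> carrier R"
      and l: "l \<in> K" "l \<ominus>\<^bsub>M\<^esub> b \<odot>\<^bsub>M\<^esub> m \<in> H" and b: "b \<in> carrier R" by auto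
    have "(k \<oplus>\<^bsub>M\<^esub> l) \<ominus>\<^bsub>M\<^esub> (a \<oplus> b) \<odot>\<^bsub>M\<^esub> m = (k \<ominus>\<^bsub>M\<^esub> a \<odot>\<^bsub>M\<^esub> m) \<oplus>\<^bsub>M\<^esub> (l \<ominus>\<^bsub>M\<^esub> b \<odot>\<^bsub>M\<^esub> m)"
      using a b m K'(1)[OF k(1)] K'(1)[OF l(1)]
      by (simp add: a_minus_def smult_l_distr M.minus_add M.a_ac)
    then show ?thesis using a b k l K'(6) H'(6) by force
  qed
  show "subgroup ?I (add_monoid R)"
  proof (rule R.add.subgroupI)
    show "?I \<noteq> {}" using K'(2) H'(2,4) m by (auto intro!: exI[of _ "\<zero>"] bexI[of _ "\<zero>\<^bsub>M\<^esub>"] simp: a_minus_def)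
    show "\<ominus> a \<in> ?I" if "a \<in> ?I" for a
      using smult[OF that, of "\<ominus> \<one>"] that by (auto simp: R.l_minus)
  qed (use add in auto)
  show "x \<otimes> a \<in> ?I" "a \<otimes> x \<in> ?I" if "a \<in> ?I" "x \<in> carrier R" for a x
    using smult[OF that] that by (auto simp: R.m_comm)
qed

text \<open>Adding a generator \<open>m\<close> embeds the submodules lexicographically: \<open>K\<close> is determined inside a
  larger submodule by \<open>K \<inter> span S\<close> and the ideal of coefficients of \<open>m\<close>.\<close>

lemma wf_submodules:
  assumes R: "noetherian_ring R" and "finite S" "S \<subseteq> carrier M"
  shows "wf {(L, K). submodule K R M \<and> submodule L R M \<and> K \<subset> L \<and> L \<subseteq> submodule_span R M S}"
  using assms(2,3)
proof (induction S)
  case empty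
  have "submodule_span R M {} \<subseteq> {\<zero>\<^bsub>M\<^esub>}"
    by (rule submodule_span_minimal[OF submodule_zero_set]) auto
  then have "{(L, K). submodule K R M \<and> submodule L R M \<and> K \<subset> L \<and> L \<subseteq> submodule_span R M {}} = {}"
    using submodule_zero by fastforce
  then show ?case by (simp only: wf_def) blast
next
  case (insert m S)
  let ?S = "submodule_span R M S" and ?S' = "submodule_span R M (insert m S)"
  let ?r = "{(L, K). submodule K R M \<and> submodule L R M \<and> K \<subset> L \<and> L \<subseteq> ?S}"
  let ?q = "{(J, I). ideal I R \<and> ideal J R \<and> I \<subset> J}"
  define I where "I K = {r \<in> carrier R. \<exists>k\<in>K. k \<ominus>\<^bsub>M\<^esub> r \<odot>\<^bsub>M\<^esub> m \<in> ?S}" for K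
  from insert have m: "m \<in> carrier M" and S: "S \<subseteq> carrier M" by auto
  note S' = submodule_span_is_submodule[OF S]
  have sub: "submodule (K \<inter> ?S) R M" if "submodule K R M" for K
    by (rule submoduleI) (use submodule_closed[OF that] submodule_closed[OF S'] in auto)
  have wf: "wf (inv_image (?r <*lex*> ?q) (\<lambda>K. (K \<inter> ?S, I K)))"
    using insert.IH S noetherian_ring.wf_ideals[OF R] by (intro wf_inv_image wf_lex_prod) auto
  have emb: "((L \<inter> ?S, I L), (K \<inter> ?S, I K)) \<in> ?r <*lex*> ?q"
    if K: "submodule K R M" and L: "submodule L R M" and KL: "K \<subset> L" and LS: "L \<subseteq> ?S'" for K L
  proof (cases "K \<inter> ?S = L \<inter> ?S")
    case True
    have "I K \<noteq> I L"
    proof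
      assume eq: "I K = I L"
      have "L \<subseteq> K"
      proof
        \<comment> \<open>As the coefficient \<open>c\<close> of \<open>m\<close> in
          \<open>l\<close> also occurs in some \<open>k\<close> of \<open>K\<close>, the difference
          of \<open>l\<close> and \<open>k\<close> lies in \<open>L \<inter> ?S\<close>, which is
          \<open>K \<inter> ?S\<close>. Hence \<open>l\<close> is in \<open>K\<close>.\<close>
        fix l assume l: "l \<in> L"
        with LS obtain c t where c: "c \<in> carrier R" and t: "t \<in> ?S" and lct: "l = c \<odot>\<^bsub>M\<^esub> m \<oplus>\<^bsub>M\<^esub> t"
          by (auto simp: submodule_span_insert[OF m S] set_add_def')
        have tc: "t \<in> carrier M" using t S' submodule_closed(1) by blast
        have "l \<ominus>\<^bsub>M\<^esub> c \<odot>\<^bsub>M\<^esub> m = t"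
          using c m tc by (simp add: lct a_minus_def M.a_ac M.r_neg1 M.r_neg)
        with t l c have "c \<in> I L" by (auto simp: I_def)
        with eq obtain k where k: "k \<in> K" "k \<ominus>\<^bsub>M\<^esub> c \<odot>\<^bsub>M\<^esub> m \<in> ?S" by (auto simp: I_def)
        have kc: "k \<in> carrier M" using k(1) K submodule_closed(1) by blast
        have "l \<ominus>\<^bsub>M\<^esub> k = t \<ominus>\<^bsub>M\<^esub> (k \<ominus>\<^bsub>M\<^esub> c \<odot>\<^bsub>M\<^esub> m)"
          using c m tc kc by (simp add: lct a_minus_def M.a_ac M.minus_add M.r_neg2)
        then have "l \<ominus>\<^bsub>M\<^esub> k \<in> ?S" using t k(2) submodule_minus[OF S'] by auto
        moreover have "l \<ominus>\<^bsub>M\<^esub> k \<in> L" using submodule_minus[OF L l] k(1) KL by auto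
        ultimately have "l \<ominus>\<^bsub>M\<^esub> k \<in> K" using True by auto
        then have "(l \<ominus>\<^bsub>M\<^esub> k) \<oplus>\<^bsub>M\<^esub> k \<in> K" using submoduleE(5)[OF K] k(1) by auto
        moreover have "(l \<ominus>\<^bsub>M\<^esub> k) \<oplus>\<^bsub>M\<^esub> k = l"
          using kc c m tc by (simp add: lct a_minus_def M.a_assoc M.l_neg)
        ultimately show "l \<in> K" by simp
      qed
      with KL show False by blast
    qed
    moreover have "I K \<subseteq> I L" using KL by (auto simp: I_def)
    ultimately show ?thesis using True ideal_colon[OF K m S'] ideal_colon[OF L m S'] by (auto simp: I_def)
  next
    case False
    then show ?thesis using sub[OF K] sub[OF L] KL by auto
  qed
  show ?case
    by (rule wf_subset[OF wf])
      (auto simp only: in_inv_image mem_Collect_eq case_prod_conv intro!: emb)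
qed

end

section \<open>Prime avoidance\<close>

context cring begin

lemma primeideal_facts:
  assumes "primeideal p R"
  shows "a \<in> p \<Longrightarrow> a \<in> carrier R" "a \<in> p \<Longrightarrow> b \<in> p \<Longrightarrow> a \<oplus> b \<in> p" "a \<in> p \<Longrightarrow> b \<in> p \<Longrightarrow> a \<ominus> b \<in> p"
    "a \<in> p \<Longrightarrow> b \<in> carrier R \<Longrightarrow> a \<otimes> b \<in> p" "a \<in> p \<Longrightarrow> b \<in> carrier R \<Longrightarrow> b \<otimes> a \<in> p"
    "\<zero> \<in> p" "\<one> \<notin> p"
    "a \<in> carrier R \<Longrightarrow> b \<in> carrier R \<Longrightarrow> a \<otimes> b \<in> p \<Longrightarrow> a \<in> p \<or> b \<in> p"
proof -
  interpret p: primeideal p R by fact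
  show "a \<in> p \<Longrightarrow> a \<in> carrier R" "a \<in> p \<Longrightarrow> b \<in> p \<Longrightarrow> a \<oplus> b \<in> p" "a \<in> p \<Longrightarrow> b \<in> p \<Longrightarrow> a \<ominus> b \<in> p"
    "a \<in> p \<Longrightarrow> b \<in> carrier R \<Longrightarrow> a \<otimes> b \<in> p" "a \<in> p \<Longrightarrow> b \<in> carrier R \<Longrightarrow> b \<otimes> a \<in> p" "\<zero> \<in> p"
    by (auto simp: p.Icarr a_minus_def p.I_l_closed p.I_r_closed)
  show "\<one> \<notin> p" using p.one_imp_carrier p.I_notcarr by auto
  show "a \<in> carrier R \<Longrightarrow> b \<in> carrier R \<Longrightarrow> a \<otimes> b \<in> p \<Longrightarrow> a \<in> p \<or> b \<in> p" by (rule p.I_prime)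
qed

text \<open>Multiply one element of each prime chosen outside \<open>q\<close>: the product lies in
  all of them, and outside \<open>q\<close> because \<open>q\<close> is prime.\<close>

lemma mem_Inter_not_prime:
  assumes q: "primeideal q R" and p: "primeideal p R" "\<not> p \<subseteq> q"
    and "finite A" "\<forall>a\<in>A. primeideal a R \<and> \<not> a \<subseteq> q"
  shows "\<exists>y\<in>p. (\<forall>a\<in>A. y \<in> a) \<and> y \<notin> q"
  using assms(4,5)
proof (induction A)
  case empty then show ?case using p by auto
next
  case (insert a A)
  then obtain y where y: "y \<in> p" "\<forall>b\<in>A. y \<in> b" "y \<notin> q" by auto
  from insert.prems obtain z where z: "z \<in> a" "z \<notin> q" by auto
  have zc: "z \<in> carrier R" and yc: "y \<in> carrier R"
    using z y primeideal_facts(1)[OF p(1)] primeideal_facts(1)[of a] insert.prems by auto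
  have "y \<otimes> z \<in> p" using primeideal_facts(4)[OF p(1) y(1) zc] .
  moreover have "y \<otimes> z \<in> b" if "b \<in> insert a A" for b
    using that y z zc yc insert.prems primeideal_facts(4)[of b y z] primeideal_facts(5)[of b z y] by auto
  moreover have "y \<otimes> z \<notin> q" using primeideal_facts(8)[OF q yc zc] y z by auto
  ultimately show ?case by blast
qed

text \<open>Induction on \<open>A\<close>. If two members are comparable, the smaller one may be
  dropped. Otherwise an element that avoids all members but \<open>q\<close>, and fails for
  \<open>q\<close>, is corrected by an element that lies in all the others and not in
  \<open>q\<close>.\<close>

lemma prime_avoidance:
  assumes p: "primeideal p R" and "finite A" "\<forall>q\<in>A. primeideal q R \<and> \<not> p \<subseteq> q"
  shows "\<exists>x\<in>p. \<forall>q\<in>A. x \<notin> q"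
  using assms(2,3)
proof (induction A rule: finite_psubset_induct)
  case (psubset A)
  show ?case
  proof (cases "\<exists>a\<in>A. \<exists>b\<in>A. a \<noteq> b \<and> a \<subseteq> b")
    case True
    then obtain a b where ab: "a \<in> A" "b \<in> A" "a \<noteq> b" "a \<subseteq> b" by blast
    then have "A - {a} \<subset> A" by auto
    with psubset.IH psubset.prems obtain x where "x \<in> p" "\<forall>q\<in>A - {a}. x \<notin> q" by (meson DiffD1)
    with ab show ?thesis by (intro bexI[of _ x]) auto
  next
    case anti: False
    show ?thesis
    proof (cases "A = {}")
      case True then show ?thesis using primeideal_facts(6)[OF p] by auto
    next
      case False
      then obtain q where q: "q \<in> A" by auto
      then have "A - {q} \<subset> A" by auto
      with psubset.IH psubset.prems obtain x where x: "x \<in> p" "\<forall>a\<in>A - {q}. x \<notin> a" by (meson DiffD1)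
      show ?thesis
      proof (cases "x \<in> q")
        case False then show ?thesis using x q by auto
      next
        case True
        have "\<forall>a\<in>A - {q}. primeideal a R \<and> \<not> a \<subseteq> q" using psubset.prems anti q by blast
        with psubset.prems q obtain y where y: "y \<in> p" "\<forall>a\<in>A - {q}. y \<in> a" "y \<notin> q"
          using mem_Inter_not_prime[of q p "A - {q}"] psubset.hyps p by (metis finite_Diff)
        have c: "x \<in> carrier R" "y \<in> carrier R" using x y primeideal_facts(1)[OF p] by auto
        \<comment> \<open>Each member of \<open>A\<close> contains exactly one of \<open>x\<close>
          and \<open>y\<close>: \<open>q\<close> contains only \<open>x\<close>, the others only
          \<open>y\<close>. So none contains the sum.\<close>
        have "x \<oplus> y \<in> p" using primeideal_facts(2)[OF p] x y by auto
        moreover have "x \<oplus> y \<notin> a" if a: "a \<in> A" for a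
        proof
          assume xy: "x \<oplus> y \<in> a"
          from a psubset.prems have pa: "primeideal a R" by auto
          have "(x \<oplus> y) \<ominus> x = y" "(x \<oplus> y) \<ominus> y = x"
            using c by algebra+
          then have "x \<in> a \<Longrightarrow> y \<in> a" "y \<in> a \<Longrightarrow> x \<in> a"
            using primeideal_facts(3)[OF pa xy] by metis+
          then show False using x(2) y(2,3) True a by blast
        qed
        ultimately show ?thesis by blast
      qed
    qed
  qed
qed

end

section \<open>Modules at a prime\<close>

text \<open>Localization at \<open>p\<close> is expressed without fractions: for a submodule \<open>K\<close> of \<open>M\<close>, the
  localization of \<open>M/K\<close> at \<open>p\<close> is zero iff the saturation of \<open>K\<close> is all of \<open>M\<close>.\<close>

definition saturation ::
    "('a, 'r) ring_scheme \<Rightarrow> ('a, 'm, 'x) module_scheme \<Rightarrow> 'a set \<Rightarrow> 'm set \<Rightarrow> 'm set" where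
  "saturation R M p K = {y \<in> carrier M. \<exists>s\<in>carrier R - p. s \<odot>\<^bsub>M\<^esub> y \<in> K}"

text \<open>The annihilator of the class of \<open>y\<close> in \<open>M/K\<close>; the primes of
  this form are the associated primes of \<open>M/K\<close>.\<close>

definition elem_colon ::
    "('a, 'r) ring_scheme \<Rightarrow> ('a, 'm, 'x) module_scheme \<Rightarrow> 'm set \<Rightarrow> 'm \<Rightarrow> 'a set" where
  "elem_colon R M K y = {r \<in> carrier R. r \<odot>\<^bsub>M\<^esub> y \<in> K}"

locale noetherian_module = Module.module +
  assumes noetherian: "noetherian_ring R" and finitely_generated: "finitely_generated R M"
begin

lemma wf_submodule: "wf {(L, K). submodule K R M \<and> submodule L R M \<and> K \<subset> L}"
proof -
  obtain S where S: "finite S" "S \<subseteq> carrier M" "submodule_span R M S = carrier M"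
    using finitely_generated unfolding finitely_generated_def by auto
  show ?thesis
    by (rule wf_subset[OF wf_submodules[OF noetherian S(1,2)]]) (use submodule_carrierD S in auto)
qed

lemma elem_colon_ideal:
  assumes K: "submodule K R M" and y: "y \<in> carrier M"
  shows "ideal (elem_colon R M K y) R"
proof -
  have "elem_colon R M K y = {r \<in> carrier R. \<exists>k\<in>{\<zero>\<^bsub>M\<^esub>}. k \<ominus>\<^bsub>M\<^esub> r \<odot>\<^bsub>M\<^esub> y \<in> K}"
    using submoduleE(3)[OF K] y unfolding elem_colon_def a_minus_def
    by (auto, metis M.minus_minus smult_closed)
  then show ?thesis using ideal_colon[OF submodule_zero_set y K] by simp
qed

lemma submodule_smult_preimage:
  assumes K: "submodule K R M" and s: "s \<in> carrier R"
  shows "submodule {y \<in> carrier M. s \<odot>\<^bsub>M\<^esub> y \<in> K} R M"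
proof (rule submoduleI)
  show "a \<odot>\<^bsub>M\<^esub> x \<in> {y \<in> carrier M. s \<odot>\<^bsub>M\<^esub> y \<in> K}"
    if "a \<in> carrier R" "x \<in> {y \<in> carrier M. s \<odot>\<^bsub>M\<^esub> y \<in> K}" for a x
  proof -
    have "s \<odot>\<^bsub>M\<^esub> (a \<odot>\<^bsub>M\<^esub> x) = a \<odot>\<^bsub>M\<^esub> (s \<odot>\<^bsub>M\<^esub> x)"
      using that s by (simp flip: smult_assoc1 add: R.m_comm)
    then show ?thesis using that s submoduleE(4)[OF K] by auto
  qed
qed (use submodule_closed[OF K] s in \<open>auto simp: smult_r_minus smult_r_distr\<close>)

section \<open>Denominators and associated primes at a fixed prime\<close>

context
  fixes p assumes p: "primeideal p R"
begin

lemma compl_mult: "s \<in> carrier R - p \<Longrightarrow> t \<in> carrier R - p \<Longrightarrow> s \<otimes> t \<in> carrier R - p"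
  using R.primeideal_facts(8)[OF p] by auto

lemma compl_one: "\<one> \<in> carrier R - p"
  using R.primeideal_facts(7)[OF p] by auto

text \<open>One denominator for the whole saturation. The submodules \<open>L s\<close> are
  directed, since \<open>L (s \<otimes> t)\<close> contains both \<open>L s\<close> and
  \<open>L t\<close>, so a maximal one contains them all.\<close>

lemma saturation_uniform:
  assumes K: "submodule K R M"
  shows "\<exists>s\<in>carrier R - p. \<forall>y\<in>saturation R M p K. s \<odot>\<^bsub>M\<^esub> y \<in> K"
proof -
  define L where "L s = {y \<in> carrier M. s \<odot>\<^bsub>M\<^esub> y \<in> K}" for s
  have "L \<one> \<in> L ` (carrier R - p)" using compl_one by auto
  from wf_submodule[unfolded wf_eq_minimal, rule_format, OF this]
  obtain L0 where "L0 \<in> L ` (carrier R - p)"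
    and "\<forall>H. (H, L0) \<in> {(L, K). submodule K R M \<and> submodule L R M \<and> K \<subset> L} \<longrightarrow> H \<notin> L ` (carrier R - p)"
    by (rule bexE)
  then obtain s where s: "s \<in> carrier R - p"
    and max: "\<And>H. (H, L s) \<in> {(L, K). submodule K R M \<and> submodule L R M \<and> K \<subset> L} \<Longrightarrow> H \<notin> L ` (carrier R - p)"
    by auto
  have "y \<in> L s" if "y \<in> saturation R M p K" for y
  proof -
    from that obtain t where t: "t \<in> carrier R - p" "t \<odot>\<^bsub>M\<^esub> y \<in> K" and y: "y \<in> carrier M"
      by (auto simp: saturation_def)
    have sub: "submodule (L r) R M" if "r \<in> carrier R - p" for r
      unfolding L_def using that by (intro submodule_smult_preimage K) auto
    have st: "s \<otimes> t \<in> carrier R - p" by (rule compl_mult[OF s t(1)])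
    have "L s \<subseteq> L (s \<otimes> t)" 
    proof
      fix z assume "z \<in> L s"
      then have "t \<odot>\<^bsub>M\<^esub> (s \<odot>\<^bsub>M\<^esub> z) \<in> K" "z \<in> carrier M" using submoduleE(4)[OF K] t by (auto simp: L_def)
      then show "z \<in> L (s \<otimes> t)" using s t by (simp add: L_def R.m_comm[of s t] smult_assoc1)
    qed
    then have "L s = L (s \<otimes> t)" using max[of "L (s \<otimes> t)"] sub[OF s] sub[OF st] st by auto
    moreover have "y \<in> L (s \<otimes> t)"
      using s t y submoduleE(4)[OF K] by (simp add: L_def smult_assoc1)
    ultimately show ?thesis by simp
  qed
  with s show ?thesis by (auto simp: L_def)
qed

text \<open>That \<open>n\<close> survives at \<open>p\<close> means that its annihilator lies
  inside \<open>p\<close>. A maximal one among the annihilators that contain it and stay inside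
  \<open>p\<close> is prime; the bound \<open>p\<close> plays the part of localizing at
  \<open>p\<close>.\<close>

lemma associated_prime_exists:
  assumes K: "submodule K R M" and n: "n \<in> carrier M" "n \<notin> saturation R M p K"
  obtains y where "y \<in> carrier M" "primeideal (elem_colon R M K y) R" "elem_colon R M K y \<subseteq> p"
    "elem_colon R M K n \<subseteq> elem_colon R M K y"
proof -
  define Q where "Q = {elem_colon R M K y | y. y \<in> carrier M \<and> elem_colon R M K n \<subseteq> elem_colon R M K y \<and> elem_colon R M K y \<subseteq> p}"
  have "elem_colon R M K n \<in> Q" unfolding Q_def using n by (auto simp: saturation_def elem_colon_def)
  from noetherian_ring.wf_ideals[OF noetherian, unfolded wf_eq_minimal, rule_format, OF this]
  obtain q where q: "q \<in> Q"
    and max: "\<forall>J. (J, q) \<in> {(J, I). ideal I R \<and> ideal J R \<and> I \<subset> J} \<longrightarrow> J \<notin> Q"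
    by (rule bexE)
  from q obtain y where qy: "q = elem_colon R M K y" and y: "y \<in> carrier M"
    "elem_colon R M K n \<subseteq> elem_colon R M K y" "elem_colon R M K y \<subseteq> p"
    unfolding Q_def by blast
  have max': "elem_colon R M K z = elem_colon R M K y"
    if "z \<in> carrier M" "elem_colon R M K y \<subseteq> elem_colon R M K z" "elem_colon R M K z \<subseteq> p" for z
  proof (rule ccontr)
    assume "elem_colon R M K z \<noteq> elem_colon R M K y"
    then have "elem_colon R M K z \<notin> Q"
      using max[rule_format, of "elem_colon R M K z"] that(1,2) y(1) elem_colon_ideal[OF K] unfolding qy by blast
    moreover have "elem_colon R M K z \<in> Q" using that y unfolding Q_def by blast
    ultimately show False by simp
  qed
  have colon_mono: "elem_colon R M K y \<subseteq> elem_colon R M K (a \<odot>\<^bsub>M\<^esub> y)" if "a \<in> carrier R" for a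
  proof
    fix r assume "r \<in> elem_colon R M K y"
    then have r: "r \<in> carrier R" "a \<odot>\<^bsub>M\<^esub> (r \<odot>\<^bsub>M\<^esub> y) \<in> K"
      using submoduleE(4)[OF K] that by (auto simp: elem_colon_def)
    then show "r \<in> elem_colon R M K (a \<odot>\<^bsub>M\<^esub> y)"
      using that y by (simp add: elem_colon_def flip: smult_assoc1) (simp add: R.m_comm)
  qed
  have "primeideal (elem_colon R M K y) R"
  proof (rule primeidealI[OF elem_colon_ideal[OF K y(1)] R.is_cring])
    show "carrier R \<noteq> elem_colon R M K y" using y(3) compl_one by auto
    fix a b assume a: "a \<in> carrier R" and b: "b \<in> carrier R" and ab: "a \<otimes> b \<in> elem_colon R M K y"
    show "a \<in> elem_colon R M K y \<or> b \<in> elem_colon R M K y"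
    \<comment> \<open>If \<open>a y\<close> survives at \<open>p\<close>, then maximality makes its
      annihilator, which contains \<open>b\<close>, equal to that of \<open>y\<close>. If
      \<open>a y\<close> is killed by some \<open>s\<close> outside \<open>p\<close>, then
      \<open>s y\<close> has the same annihilator as \<open>y\<close> by maximality, and
      \<open>a\<close> lies in it.\<close>
    proof (cases "elem_colon R M K (a \<odot>\<^bsub>M\<^esub> y) \<subseteq> p")
      case True
      have "b \<in> elem_colon R M K (a \<odot>\<^bsub>M\<^esub> y)"
        using a b ab y by (simp add: elem_colon_def R.m_comm[of a b] smult_assoc1)
      then show ?thesis using max'[OF _ colon_mono[OF a] True] a y by auto
    next
      case False
      then obtain s where s: "s \<in> carrier R - p" "s \<odot>\<^bsub>M\<^esub> (a \<odot>\<^bsub>M\<^esub> y) \<in> K" by (auto simp: elem_colon_def)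
      have "elem_colon R M K (s \<odot>\<^bsub>M\<^esub> y) \<subseteq> p"
      proof
        fix t assume "t \<in> elem_colon R M K (s \<odot>\<^bsub>M\<^esub> y)"
        then have t: "t \<in> carrier R" "t \<otimes> s \<in> elem_colon R M K y"
          using s y by (auto simp: elem_colon_def smult_assoc1)
        then show "t \<in> p" using R.primeideal_facts(8)[OF p] y s by blast
      qed
      then have "elem_colon R M K (s \<odot>\<^bsub>M\<^esub> y) = elem_colon R M K y" using s y by (intro max' colon_mono) auto
      moreover have "a \<in> elem_colon R M K (s \<odot>\<^bsub>M\<^esub> y)"
        using s a y by (simp add: elem_colon_def flip: smult_assoc1) (simp add: R.m_comm)
      ultimately show ?thesis by simp
    qed
  qed
  with y that show ?thesis by blast
qed

text \<open>Adjoin to \<open>K\<close> an element \<open>y\<close> whose annihilator is a prime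
  inside \<open>p\<close>. Any other associated prime \<open>(K : n)\<close> inside \<open>p\<close>
  is either equal to \<open>(K : y)\<close> or still associated for the larger submodule, according
  to whether a multiple of \<open>n\<close> outside \<open>K\<close> lies in
  \<open>K + Ry\<close>.\<close>

lemma finite_associated_primes:
  assumes "submodule K R M"
  shows "finite {q. primeideal q R \<and> q \<subseteq> p \<and> (\<exists>y\<in>carrier M. q = elem_colon R M K y)}"
  using assms
proof (induction K rule: wf_induct_rule[OF wf_submodule])
  case (1 K)
  then have K: "submodule K R M" by simp
  let ?A = "\<lambda>K. {q. primeideal q R \<and> q \<subseteq> p \<and> (\<exists>y\<in>carrier M. q = elem_colon R M K y)}"
  show ?case
  proof (cases "saturation R M p K = carrier M")
    case True
    have "?A K = {}"
    proof (rule ccontr)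
      assume "?A K \<noteq> {}"
      then obtain y where "y \<in> carrier M" "elem_colon R M K y \<subseteq> p" by auto
      then have "y \<notin> saturation R M p K" by (auto simp: saturation_def elem_colon_def)
      with \<open>y \<in> carrier M\<close> True show False by simp
    qed
    then show ?thesis by (simp only: finite.emptyI)
  next
    case False
    then obtain n where "n \<in> carrier M" "n \<notin> saturation R M p K" by (auto simp: saturation_def)
    from associated_prime_exists[OF K this] obtain y where y: "y \<in> carrier M"
      "primeideal (elem_colon R M K y) R" "elem_colon R M K y \<subseteq> p" by metis
    let ?L = "K <+>\<^bsub>M\<^esub> (\<lambda>c. c \<odot>\<^bsub>M\<^esub> y) ` carrier R"
    note C = submodule_cyclic[OF y(1)]
    have L: "submodule ?L R M" by (rule submodule_set_add[OF K C])
    have "y \<in> (\<lambda>c. c \<odot>\<^bsub>M\<^esub> y) ` carrier R" using y(1) by (force intro: rev_image_eqI[of "\<one>"])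
    then have "y \<in> ?L" using set_add_superset(2)[OF K C] by auto
    moreover have "y \<notin> K"
      using y(1,3) compl_one by (auto simp: elem_colon_def subset_iff dest: spec[of _ "\<one>"])
    ultimately have "K \<subset> ?L" using set_add_superset(1)[OF K C] by blast
    then have "finite (?A ?L)" using 1 K L by auto
    moreover have "?A K \<subseteq> insert (elem_colon R M K y) (?A ?L)"
    proof
      fix q assume "q \<in> ?A K"
      then obtain n where q: "primeideal q R" "q \<subseteq> p" and n: "n \<in> carrier M" "q = elem_colon R M K n"
        by auto
      show "q \<in> insert (elem_colon R M K y) (?A ?L)"
      proof (cases "\<exists>r\<in>carrier R. r \<odot>\<^bsub>M\<^esub> n \<in> ?L \<and> r \<odot>\<^bsub>M\<^esub> n \<notin> K")
        case True
        then obtain r k a where r: "r \<in> carrier R" "r \<odot>\<^bsub>M\<^esub> n \<notin> K" and k: "k \<in> K" and a: "a \<in> carrier R"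
          and eq: "r \<odot>\<^bsub>M\<^esub> n = k \<oplus>\<^bsub>M\<^esub> a \<odot>\<^bsub>M\<^esub> y" by (auto simp: set_add_def')
        have kc: "k \<in> carrier M" using k K submodule_carrierD by blast
        have ay: "a \<odot>\<^bsub>M\<^esub> y \<notin> K" using r eq k submoduleE(5)[OF K] by metis
        \<comment> \<open>Both annihilators are prime, so \<open>(K : n)\<close> is unchanged when
          \<open>n\<close> is multiplied by \<open>r\<close>, and \<open>(K : y)\<close> when
          \<open>y\<close> is multiplied by \<open>a\<close>; the two multiples differ by the
          element \<open>k\<close> of \<open>K\<close>.\<close>
        have "t \<in> elem_colon R M K y \<longleftrightarrow> t \<in> q" for t
        proof (cases "t \<in> carrier R")
          case t: True
          have "t \<in> q \<longleftrightarrow> t \<otimes> r \<in> q"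
            using r t R.primeideal_facts(4,8)[OF q(1)] n by (auto simp: elem_colon_def)
          also have "\<dots> \<longleftrightarrow> t \<odot>\<^bsub>M\<^esub> k \<oplus>\<^bsub>M\<^esub> t \<odot>\<^bsub>M\<^esub> (a \<odot>\<^bsub>M\<^esub> y) \<in> K"
            using n r t eq kc a y by (simp add: elem_colon_def smult_assoc1 smult_r_distr)
          also have "\<dots> \<longleftrightarrow> t \<odot>\<^bsub>M\<^esub> (a \<odot>\<^bsub>M\<^esub> y) \<in> K"
          proof
            assume "t \<odot>\<^bsub>M\<^esub> k \<oplus>\<^bsub>M\<^esub> t \<odot>\<^bsub>M\<^esub> (a \<odot>\<^bsub>M\<^esub> y) \<in> K"
            then have "(t \<odot>\<^bsub>M\<^esub> k \<oplus>\<^bsub>M\<^esub> t \<odot>\<^bsub>M\<^esub> (a \<odot>\<^bsub>M\<^esub> y)) \<ominus>\<^bsub>M\<^esub> t \<odot>\<^bsub>M\<^esub> k \<in> K"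
              using submodule_minus[OF K] submoduleE(4)[OF K t k] by auto
            moreover have "(t \<odot>\<^bsub>M\<^esub> k \<oplus>\<^bsub>M\<^esub> t \<odot>\<^bsub>M\<^esub> (a \<odot>\<^bsub>M\<^esub> y)) \<ominus>\<^bsub>M\<^esub> t \<odot>\<^bsub>M\<^esub> k = t \<odot>\<^bsub>M\<^esub> (a \<odot>\<^bsub>M\<^esub> y)"
              using t kc a y(1) by (simp add: a_minus_def M.a_ac M.r_neg1 M.r_neg2)
            ultimately show "t \<odot>\<^bsub>M\<^esub> (a \<odot>\<^bsub>M\<^esub> y) \<in> K" by simp
          qed (use submoduleE(4,5)[OF K] k t in auto)
          also have "\<dots> \<longleftrightarrow> t \<otimes> a \<in> elem_colon R M K y"
            using t a y by (simp add: elem_colon_def smult_assoc1)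
          also have "\<dots> \<longleftrightarrow> t \<in> elem_colon R M K y"
            using t a ay R.primeideal_facts(4,8)[OF y(2)] by (auto simp: elem_colon_def)
          finally show ?thesis by simp
        qed (auto simp: elem_colon_def n)
        then show ?thesis by blast
      next
        case False
        then have "q = elem_colon R M ?L n"
          using set_add_superset(1)[OF K C] unfolding n elem_colon_def by blast
        with q n(1) show ?thesis by blast
      qed
    qed
    ultimately show ?thesis by (meson finite.insertI finite_subset)
  qed
qed

text \<open>None of the associated primes inside \<open>p\<close> contains \<open>p\<close>, for it
  would be equal to \<open>p\<close>. An \<open>x\<close> in \<open>p\<close> that avoids them is
  regular at \<open>p\<close>: if it killed an element surviving at \<open>p\<close>, it would lie
  in the associated prime above the annihilator of that element.\<close>

lemma regular_element_exists:
  assumes K: "submodule K R M" and np: "\<And>y. y \<in> carrier M \<Longrightarrow> elem_colon R M K y \<noteq> p"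
  shows "\<exists>x\<in>p. \<forall>n\<in>carrier M. x \<odot>\<^bsub>M\<^esub> n \<in> K \<longrightarrow> n \<in> saturation R M p K"
proof -
  let ?A = "{q. primeideal q R \<and> q \<subseteq> p \<and> (\<exists>y\<in>carrier M. q = elem_colon R M K y)}"
  have "\<forall>q\<in>?A. primeideal q R \<and> \<not> p \<subseteq> q" using np by blast
  from R.prime_avoidance[OF p finite_associated_primes[OF K] this]
  obtain x where x: "x \<in> p" "\<forall>q\<in>?A. x \<notin> q" by blast
  have "n \<in> saturation R M p K" if n: "n \<in> carrier M" "x \<odot>\<^bsub>M\<^esub> n \<in> K" for n
  proof (rule ccontr)
    assume "n \<notin> saturation R M p K"
    from associated_prime_exists[OF K n(1) this] obtain y where "y \<in> carrier M"
      "primeideal (elem_colon R M K y) R" "elem_colon R M K y \<subseteq> p"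
      "elem_colon R M K n \<subseteq> elem_colon R M K y" by metis
    moreover have "x \<in> elem_colon R M K n" using n x R.primeideal_facts(1)[OF p] by (auto simp: elem_colon_def)
    ultimately show False using x(2) by blast
  qed
  with x(1) show ?thesis by blast
qed

end

end

section \<open>Linear maps modulo a submodule\<close>

text \<open>A linear map from \<open>X\<close> to \<open>Y/L\<close>, given by a choice of
  representatives, so that no coset enters the type.\<close>

definition linear_mod ::
    "('a, 'r) ring_scheme \<Rightarrow> ('a, 'm, 'x) module_scheme \<Rightarrow> ('a, 'n, 'y) module_scheme \<Rightarrow> 'n set \<Rightarrow>
     ('m \<Rightarrow> 'n) \<Rightarrow> bool" where
  "linear_mod R X Y L u \<longleftrightarrow> u \<in> carrier X \<rightarrow> carrier Y \<and>
     (\<forall>x\<in>carrier X. \<forall>x'\<in>carrier X. u (x \<oplus>\<^bsub>X\<^esub> x') \<ominus>\<^bsub>Y\<^esub> (u x \<oplus>\<^bsub>Y\<^esub> u x') \<in> L) \<and>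
     (\<forall>a\<in>carrier R. \<forall>x\<in>carrier X. u (a \<odot>\<^bsub>X\<^esub> x) \<ominus>\<^bsub>Y\<^esub> a \<odot>\<^bsub>Y\<^esub> u x \<in> L)"

text \<open>In contrast to the elements of \<open>hom_module\<close>, values off the carrier are
  arbitrary, so compositions and pointwise combinations need no \<open>restrict\<close>.\<close>

definition linear_map ::
    "('a, 'r) ring_scheme \<Rightarrow> ('a, 'm, 'x) module_scheme \<Rightarrow> ('a, 'n, 'y) module_scheme \<Rightarrow>
     ('m \<Rightarrow> 'n) \<Rightarrow> bool" where
  "linear_map R X Y u \<longleftrightarrow> u \<in> carrier X \<rightarrow> carrier Y \<and>
     (\<forall>x\<in>carrier X. \<forall>x'\<in>carrier X. u (x \<oplus>\<^bsub>X\<^esub> x') = u x \<oplus>\<^bsub>Y\<^esub> u x') \<and>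
     (\<forall>a\<in>carrier R. \<forall>x\<in>carrier X. u (a \<odot>\<^bsub>X\<^esub> x) = a \<odot>\<^bsub>Y\<^esub> u x)"

lemma linear_mapD:
  assumes "linear_map R X Y u"
  shows "x \<in> carrier X \<Longrightarrow> u x \<in> carrier Y"
    "x \<in> carrier X \<Longrightarrow> x' \<in> carrier X \<Longrightarrow> u (x \<oplus>\<^bsub>X\<^esub> x') = u x \<oplus>\<^bsub>Y\<^esub> u x'"
    "a \<in> carrier R \<Longrightarrow> x \<in> carrier X \<Longrightarrow> u (a \<odot>\<^bsub>X\<^esub> x) = a \<odot>\<^bsub>Y\<^esub> u x"
  using assms by (auto simp: linear_map_def)

lemma linear_modD:
  assumes "linear_mod R X Y L u"
  shows "x \<in> carrier X \<Longrightarrow> u x \<in> carrier Y"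
    "x \<in> carrier X \<Longrightarrow> x' \<in> carrier X \<Longrightarrow> u (x \<oplus>\<^bsub>X\<^esub> x') \<ominus>\<^bsub>Y\<^esub> (u x \<oplus>\<^bsub>Y\<^esub> u x') \<in> L"
    "a \<in> carrier R \<Longrightarrow> x \<in> carrier X \<Longrightarrow> u (a \<odot>\<^bsub>X\<^esub> x) \<ominus>\<^bsub>Y\<^esub> a \<odot>\<^bsub>Y\<^esub> u x \<in> L"
  using assms by (auto simp: linear_mod_def)

lemma linear_map_compose:
  "linear_map R X Y u \<Longrightarrow> linear_map R Y Z v \<Longrightarrow> linear_map R X Z (\<lambda>x. v (u x))"
  by (auto simp: linear_map_def Pi_def)

section \<open>Differences, congruences and linear maps in a module\<close>

context Module.module begin

lemma a_inv_zero [simp]: "\<ominus>\<^bsub>M\<^esub> \<zero>\<^bsub>M\<^esub> = \<zero>\<^bsub>M\<^esub>"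
  by (rule M.minus_equality) auto

lemma add_minus_cancel:
  assumes "x \<in> carrier M" "y \<in> carrier M" "z \<in> carrier M"
  shows "x \<oplus>\<^bsub>M\<^esub> (y \<oplus>\<^bsub>M\<^esub> (\<ominus>\<^bsub>M\<^esub> x \<oplus>\<^bsub>M\<^esub> z)) = y \<oplus>\<^bsub>M\<^esub> z"
  using assms by (metis M.a_inv_closed M.a_lcomm M.add.m_closed M.r_neg2)

lemma smult_minus:
  "a \<in> carrier R \<Longrightarrow> x \<in> carrier M \<Longrightarrow> y \<in> carrier M \<Longrightarrow>
    a \<odot>\<^bsub>M\<^esub> (x \<ominus>\<^bsub>M\<^esub> y) = a \<odot>\<^bsub>M\<^esub> x \<ominus>\<^bsub>M\<^esub> a \<odot>\<^bsub>M\<^esub> y"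
  by (simp add: a_minus_def smult_r_distr smult_r_minus)

lemma minus_minus_cancel_left:
  assumes "x \<in> carrier M" "y \<in> carrier M" "z \<in> carrier M"
  shows "x \<ominus>\<^bsub>M\<^esub> y \<ominus>\<^bsub>M\<^esub> (x \<ominus>\<^bsub>M\<^esub> z) = z \<ominus>\<^bsub>M\<^esub> y"
proof -
  have "x \<ominus>\<^bsub>M\<^esub> y \<ominus>\<^bsub>M\<^esub> (x \<ominus>\<^bsub>M\<^esub> z) = (x \<oplus>\<^bsub>M\<^esub> \<ominus>\<^bsub>M\<^esub> x) \<oplus>\<^bsub>M\<^esub> (z \<oplus>\<^bsub>M\<^esub> \<ominus>\<^bsub>M\<^esub> y)"
    using assms by (simp add: a_minus_def M.minus_add M.a_ac del: M.r_neg)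
  then show ?thesis using assms by (simp add: M.r_neg a_minus_def)
qed

lemma minus_minus_add_cancel:
  assumes "x \<in> carrier M" "y \<in> carrier M" "z \<in> carrier M"
  shows "x \<ominus>\<^bsub>M\<^esub> y \<ominus>\<^bsub>M\<^esub> z \<oplus>\<^bsub>M\<^esub> y = x \<ominus>\<^bsub>M\<^esub> z"
proof -
  have "x \<ominus>\<^bsub>M\<^esub> y \<ominus>\<^bsub>M\<^esub> z \<oplus>\<^bsub>M\<^esub> y = (y \<oplus>\<^bsub>M\<^esub> \<ominus>\<^bsub>M\<^esub> y) \<oplus>\<^bsub>M\<^esub> (x \<oplus>\<^bsub>M\<^esub> \<ominus>\<^bsub>M\<^esub> z)"
    using assms by (simp add: a_minus_def M.a_ac del: M.r_neg)
  then show ?thesis using assms by (simp add: M.r_neg a_minus_def)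
qed

lemma minus_self: "x \<in> carrier M \<Longrightarrow> x \<ominus>\<^bsub>M\<^esub> x = \<zero>\<^bsub>M\<^esub>"
  by (simp add: a_minus_def M.r_neg)

lemma linear_map_imp_mod:
  assumes L: "submodule L R M" and X: "Module.module R X" and u: "linear_map R X M u"
  shows "linear_mod R X M L u"
proof -
  interpret X: Module.module R X by fact
  show ?thesis using linear_mapD[OF u] submodule_closed(2)[OF L]
    by (auto simp: linear_mod_def minus_self)
qed

lemma linear_map_smult:
  assumes u: "linear_map R X M u" and s: "s \<in> carrier R"
  shows "linear_map R X M (\<lambda>x. s \<odot>\<^bsub>M\<^esub> u x)"
proof -
  have "s \<odot>\<^bsub>M\<^esub> (a \<odot>\<^bsub>M\<^esub> u x) = a \<odot>\<^bsub>M\<^esub> (s \<odot>\<^bsub>M\<^esub> u x)" if "a \<in> carrier R" "x \<in> carrier X" for a x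
    using that s linear_mapD(1)[OF u] by (simp flip: smult_assoc1 add: R.m_comm)
  then show ?thesis using s linear_mapD[OF u]
    by (simp add: linear_map_def smult_r_distr)
qed

lemma linear_map_minus:
  assumes u: "linear_map R X M u" and v: "linear_map R X M v"
  shows "linear_map R X M (\<lambda>x. u x \<ominus>\<^bsub>M\<^esub> v x)"
  using linear_mapD[OF u] linear_mapD[OF v]
  by (auto simp: linear_map_def a_minus_def smult_r_distr smult_r_minus M.minus_add M.a_ac)

lemma linear_map_zero:
  assumes "Module.module R X" and u: "linear_map R X M u" shows "u \<zero>\<^bsub>X\<^esub> = \<zero>\<^bsub>M\<^esub>"
proof -
  interpret X: Module.module R X by fact
  show ?thesis
    using linear_mapD(3)[OF u R.zero_closed X.M.zero_closed] linear_mapD(1)[OF u X.M.zero_closed] by simp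
qed

lemma linear_map_zero_map: "Module.module R X \<Longrightarrow> linear_map R X M (\<lambda>_. \<zero>\<^bsub>M\<^esub>)"
  by (auto simp: linear_map_def)

text \<open>The way in which maps that are linear only modulo \<open>K\<close> are used: a
  membership in \<open>K\<close> is transported along their congruences.\<close>

lemma mem_submodule_cong:
  assumes K: "submodule K R M" and "x \<ominus>\<^bsub>M\<^esub> y \<in> K" "x \<in> carrier M" "y \<in> carrier M"
  shows "x \<in> K \<longleftrightarrow> y \<in> K"
proof
  assume "x \<in> K"
  then have "x \<ominus>\<^bsub>M\<^esub> (x \<ominus>\<^bsub>M\<^esub> y) \<in> K" using submodule_minus[OF K] assms by auto
  moreover have "x \<ominus>\<^bsub>M\<^esub> (x \<ominus>\<^bsub>M\<^esub> y) = y"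
    using assms(3,4) by (simp add: a_minus_def M.minus_add M.r_neg2)
  ultimately show "y \<in> K" by simp
next
  assume "y \<in> K"
  then have "(x \<ominus>\<^bsub>M\<^esub> y) \<oplus>\<^bsub>M\<^esub> y \<in> K" using submoduleE(5)[OF K] assms by auto
  moreover have "(x \<ominus>\<^bsub>M\<^esub> y) \<oplus>\<^bsub>M\<^esub> y = x"
    using assms(3,4) by (simp add: a_minus_def M.a_assoc M.l_neg)
  ultimately show "x \<in> K" by simp
qed

end

section \<open>The ring as a module over itself\<close>

lemma ring_as_module_simps [simp]:
  "carrier (ring_as_module R) = carrier R" "\<zero>\<^bsub>ring_as_module R\<^esub> = \<zero>\<^bsub>R\<^esub>"
  "x \<oplus>\<^bsub>ring_as_module R\<^esub> y = x \<oplus>\<^bsub>R\<^esub> y" "a \<odot>\<^bsub>ring_as_module R\<^esub> x = a \<otimes>\<^bsub>R\<^esub> x"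
  by (simp_all add: ring_as_module_def)

lemma (in cring) ring_as_module_is_module: "Module.module R (ring_as_module R)"
proof (rule moduleI[OF is_cring])
  show "abelian_group (ring_as_module R)"
    by (rule abelian_groupI) (auto simp: a_ac intro: bexI[of _ "\<ominus> x" for x] l_neg)
qed (auto simp: l_distr r_distr m_assoc)

lemma (in cring) ring_as_module_minus:
  assumes "y \<in> carrier R"
  shows "\<ominus>\<^bsub>ring_as_module R\<^esub> y = \<ominus> y" "x \<ominus>\<^bsub>ring_as_module R\<^esub> y = x \<ominus> y"
proof -
  interpret RM: Module.module R "ring_as_module R" by (rule ring_as_module_is_module)
  show *: "\<ominus>\<^bsub>ring_as_module R\<^esub> y = \<ominus> y"
    by (rule RM.M.minus_equality) (use assms in \<open>auto simp: l_neg\<close>)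
  show "x \<ominus>\<^bsub>ring_as_module R\<^esub> y = x \<ominus> y" by (simp add: a_minus_def *)
qed

lemma (in cring) primeideal_submodule:
  assumes "primeideal p R" shows "submodule p R (ring_as_module R)"
proof -
  interpret RM: Module.module R "ring_as_module R" by (rule ring_as_module_is_module)
  note p = primeideal_facts[OF assms]
  show ?thesis
  proof (rule RM.submoduleI)
    show "\<ominus>\<^bsub>ring_as_module R\<^esub> a \<in> p" if "a \<in> p" for a
      using p(3)[OF p(6) that] p(1)[OF that] by (simp add: ring_as_module_minus a_minus_def)
  qed (use p in auto)
qed

section \<open>Free modules\<close>

lemma free_module_induct [consumes 2, case_names zero add]:
  assumes "cring R" and f: "f \<in> carrier (free_module R B)"
    and zero: "P \<zero>\<^bsub>free_module R B\<^esub>"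
    and add: "\<And>a b g. a \<in> carrier R \<Longrightarrow> b \<in> B \<Longrightarrow> g \<in> carrier (free_module R B) \<Longrightarrow> P g \<Longrightarrow>
      P (a \<odot>\<^bsub>free_module R B\<^esub> unit_vector R b \<oplus>\<^bsub>free_module R B\<^esub> g)"
  shows "P f"
proof -
  obtain xs where xs: "xs \<in> lists (carrier R \<times> B)" and f: "f = formal_comb R xs"
    using formal_comb_surj[OF assms(1) f] by blast
  from xs show ?thesis unfolding f
  proof (induction xs)
    case Nil then show ?case using zero by (simp add: formal_comb_simps free_module_simps)
  next
    case (Cons ab xs)
    then obtain a b where "ab = (a, b)" "a \<in> carrier R" "b \<in> B" by auto
    with Cons add[OF _ _ formal_comb_carrier[OF assms(1)], of a b xs] show ?case
      by (simp add: formal_comb_simps free_module_simps(3,4))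
  qed
qed

lemma (in Module.module) linear_map_linear_extension:
  assumes g: "g \<in> B \<rightarrow> carrier M"
  shows "linear_map R (free_module R B) M (linear_extension R M g)"
  using linear_extension_closed[OF _ g] linear_extension_add[OF _ _ g] linear_extension_smult[OF _ _ g]
  by (simp add: linear_map_def Pi_def free_module_simps(3,4))

text \<open>Free modules are projective; the map \<open>u\<close> to be lifted need only be linear modulo \<open>L\<close>.\<close>

lemma free_module_lift:
  assumes X: "Module.module R X" and Y: "Module.module R Y" and L: "submodule L R X"
    and v: "linear_map R Y X v" and u: "linear_mod R (free_module R B) X L u"
    and ex: "\<And>b. b \<in> B \<Longrightarrow> \<exists>y\<in>carrier Y. v y \<ominus>\<^bsub>X\<^esub> u (unit_vector R b) \<in> L"
  obtains w where "linear_map R (free_module R B) Y w"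
    "\<And>f. f \<in> carrier (free_module R B) \<Longrightarrow> v (w f) \<ominus>\<^bsub>X\<^esub> u f \<in> L"
proof -
  interpret X: Module.module R X by fact
  interpret Y: Module.module R Y by fact
  note cr = X.R.is_cring
  interpret F: Module.module R "free_module R B" by (rule free_module_is_module[OF cr])
  let ?F = "free_module R B"
  obtain g where g: "\<And>b. b \<in> B \<Longrightarrow> g b \<in> carrier Y" "\<And>b. b \<in> B \<Longrightarrow> v (g b) \<ominus>\<^bsub>X\<^esub> u (unit_vector R b) \<in> L"
    using ex by metis
  define w where "w = linear_extension R Y g"
  have g': "g \<in> B \<rightarrow> carrier Y" using g by auto
  have w: "linear_map R ?F Y w" unfolding w_def by (rule Y.linear_map_linear_extension[OF g'])
  note e = unit_vector_carrier[OF cr]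
  have "v (w f) \<ominus>\<^bsub>X\<^esub> u f \<in> L" if "f \<in> carrier ?F" for f
    using cr that
  proof (induction f rule: free_module_induct)
    case zero
    \<comment> \<open>Linearity modulo \<open>L\<close> does not make \<open>u\<close> vanish at
      zero; the scalar zero shows that its value there lies in \<open>L\<close>.\<close>
    have u0: "u \<zero>\<^bsub>?F\<^esub> \<in> carrier X" using linear_modD(1)[OF u] by auto
    have "u (\<zero>\<^bsub>R\<^esub> \<odot>\<^bsub>?F\<^esub> \<zero>\<^bsub>?F\<^esub>) \<ominus>\<^bsub>X\<^esub> \<zero>\<^bsub>R\<^esub> \<odot>\<^bsub>X\<^esub> u \<zero>\<^bsub>?F\<^esub> \<in> L" by (rule linear_modD(3)[OF u]) auto
    then have "u \<zero>\<^bsub>?F\<^esub> \<in> L" using u0 by (simp add: a_minus_def)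
    then have "\<zero>\<^bsub>X\<^esub> \<ominus>\<^bsub>X\<^esub> u \<zero>\<^bsub>?F\<^esub> \<in> L" using X.submodule_minus[OF L X.submodule_zero[OF L]] by auto
    then show ?case using Y.linear_map_zero[OF F.module_axioms w] X.linear_map_zero[OF Y v] by simp
  next
    case (add a b f)
    let ?e = "unit_vector R b"
    have "?e \<in> carrier ?F" by (rule e[OF add(2)])
    with F.smult_closed[OF add(1) this] have c: "a \<odot>\<^bsub>?F\<^esub> ?e \<in> carrier ?F" "?e \<in> carrier ?F" by blast+
    have uc: "u ?e \<in> carrier X" "u f \<in> carrier X" "u (a \<odot>\<^bsub>?F\<^esub> ?e) \<in> carrier X"
      "u (a \<odot>\<^bsub>?F\<^esub> ?e \<oplus>\<^bsub>?F\<^esub> f) \<in> carrier X"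
      using linear_modD(1)[OF u] add c by auto
    have wc: "w f \<in> carrier Y" "w ?e = g b" "v (g b) \<in> carrier X" "v (w f) \<in> carrier X"
      using linear_mapD(1)[OF w] linear_mapD(1)[OF v] add g Y.linear_extension_unit[OF _ g'] by (auto simp: w_def)
    have vw: "v (w (a \<odot>\<^bsub>?F\<^esub> ?e \<oplus>\<^bsub>?F\<^esub> f)) = a \<odot>\<^bsub>X\<^esub> v (g b) \<oplus>\<^bsub>X\<^esub> v (w f)"
      using linear_mapD[OF w] linear_mapD[OF v] add c wc g by simp
    have 1: "u (a \<odot>\<^bsub>?F\<^esub> ?e \<oplus>\<^bsub>?F\<^esub> f) \<ominus>\<^bsub>X\<^esub> (u (a \<odot>\<^bsub>?F\<^esub> ?e) \<oplus>\<^bsub>X\<^esub> u f) \<in> L" (is "?D1 \<in> L")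
      by (rule linear_modD(2)[OF u c(1) add(3)])
    have 2: "u (a \<odot>\<^bsub>?F\<^esub> ?e) \<ominus>\<^bsub>X\<^esub> a \<odot>\<^bsub>X\<^esub> u ?e \<in> L" (is "?D2 \<in> L")
      by (rule linear_modD(3)[OF u add(1) c(2)])
    have 3: "a \<odot>\<^bsub>X\<^esub> (v (g b) \<ominus>\<^bsub>X\<^esub> u ?e) \<in> L" (is "?D3 \<in> L") using X.submoduleE(4)[OF L add(1) g(2)[OF add(2)]] .
    \<comment> \<open>The error at the new element is \<open>a\<close> times the error at the
      generator, plus the error at \<open>f\<close>, minus the two defects of linearity of
      \<open>u\<close>; all four lie in \<open>L\<close>.\<close>
    have "?D3 \<oplus>\<^bsub>X\<^esub> (v (w f) \<ominus>\<^bsub>X\<^esub> u f) \<ominus>\<^bsub>X\<^esub> ?D1 \<ominus>\<^bsub>X\<^esub> ?D2 \<in> L"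
      by (intro X.submodule_minus[OF L] X.submoduleE(5)[OF L] 1 2 3 add)
    moreover have "?D3 \<oplus>\<^bsub>X\<^esub> (v (w f) \<ominus>\<^bsub>X\<^esub> u f) \<ominus>\<^bsub>X\<^esub> ?D1 \<ominus>\<^bsub>X\<^esub> ?D2 =
       a \<odot>\<^bsub>X\<^esub> v (g b) \<oplus>\<^bsub>X\<^esub> v (w f) \<ominus>\<^bsub>X\<^esub> u (a \<odot>\<^bsub>?F\<^esub> ?e \<oplus>\<^bsub>?F\<^esub> f)"
      using uc wc add(1)
      by (simp add: a_minus_def X.smult_r_distr X.smult_r_minus X.M.minus_add X.M.a_ac X.M.r_neg X.M.r_neg1 X.M.r_neg2 X.add_minus_cancel)
    ultimately show ?case by (simp add: vw)
  qed
  with w that show ?thesis by blast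
qed

section \<open>Functionals to the residue domain\<close>

context noetherian_module begin

context
  fixes p assumes p: "primeideal p R"
begin

text \<open>Nakayama's lemma: discarding redundant generators one by one leads to a generator \<open>m\<close> whose
  coefficient modulo \<open>p\<close> is well defined.\<close>

lemma coefficient_submodule_exists:
  assumes "finite T" "T \<subseteq> carrier M" "submodule K R M"
    and "s \<in> carrier R - p" "\<And>m. m \<in> carrier M \<Longrightarrow> s \<odot>\<^bsub>M\<^esub> m \<in> submodule_span R M (T \<union> K)"
    and "saturation R M p K \<noteq> carrier M"
  shows "\<exists>m\<in>carrier M. \<exists>s\<in>carrier R - p. \<exists>H. submodule H R M \<and> K \<subseteq> H \<and>
    (\<forall>r\<in>carrier R. r \<odot>\<^bsub>M\<^esub> m \<in> H \<longrightarrow> r \<in> p) \<and>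
    (\<forall>x\<in>carrier M. \<exists>a\<in>carrier R. s \<odot>\<^bsub>M\<^esub> x \<ominus>\<^bsub>M\<^esub> a \<odot>\<^bsub>M\<^esub> m \<in> H)"
  using assms(1,2,4,5)
proof (induction T arbitrary: s)
  case empty
  have "saturation R M p K = carrier M"
    using empty submodule_span_minimal[OF assms(3), of K] by (auto simp: saturation_def)
  with assms(6) show ?case by simp
next
  case (insert m T)
  let ?L = "submodule_span R M (T \<union> K)"
  have TK: "T \<union> K \<subseteq> carrier M" and m: "m \<in> carrier M"
    using insert.prems submodule_carrierD[OF assms(3)] by auto
  note L = submodule_span_is_submodule[OF TK] and pf = R.primeideal_facts[OF p]
  note Lc = submodule_carrierD[OF L]
  have split: "\<exists>c\<in>carrier R. \<exists>l\<in>?L. s \<odot>\<^bsub>M\<^esub> x = c \<odot>\<^bsub>M\<^esub> m \<oplus>\<^bsub>M\<^esub> l" if "x \<in> carrier M" for x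
    using insert.prems(3)[OF that] submodule_span_insert[OF m TK] by (auto simp: set_add_def')
  show ?case
  proof (cases "\<exists>t\<in>carrier R - p. \<forall>x\<in>carrier M. t \<odot>\<^bsub>M\<^esub> x \<in> ?L")
    case True
    \<comment> \<open>Up to the denominator \<open>t\<close> the generator \<open>m\<close> is
      redundant; \<open>t\<close> is the new \<open>s\<close>.\<close>
    then show ?thesis using insert.IH insert.prems by blast
  next
    case False
    \<comment> \<open>After multiplication by \<open>s\<close>, the elements of \<open>H\<close> can
      be written with a coefficient of \<open>m\<close> in \<open>p\<close>. Up to denominators
      \<open>M/H\<close> is generated by \<open>m\<close>, and it remains to see that only
      coefficients in \<open>p\<close> kill \<open>m\<close>.\<close>
    define H where "H = {h \<in> carrier M. \<exists>a\<in>p. s \<odot>\<^bsub>M\<^esub> h \<ominus>\<^bsub>M\<^esub> a \<odot>\<^bsub>M\<^esub> m \<in> ?L}"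
    have s: "s \<in> carrier R" "s \<notin> p" using insert.prems by auto
    have LH: "?L \<subseteq> H"
    proof
      fix l assume l: "l \<in> ?L"
      then show "l \<in> H" using submoduleE(4)[OF L s(1) l] Lc pf(6) m s
        by (auto simp: H_def a_minus_def intro!: bexI[of _ "\<zero>"])
    qed
    have H: "submodule H R M"
    proof (rule submoduleI)
      show "\<zero>\<^bsub>M\<^esub> \<in> H" using LH submodule_zero[OF L] by auto
      have smult: "a \<odot>\<^bsub>M\<^esub> x \<in> H" if a: "a \<in> carrier R" and x: "x \<in> H" for a x
      proof -
        from x obtain b where b: "b \<in> p" "s \<odot>\<^bsub>M\<^esub> x \<ominus>\<^bsub>M\<^esub> b \<odot>\<^bsub>M\<^esub> m \<in> ?L" and xc: "x \<in> carrier M"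
          by (auto simp: H_def)
        have "s \<odot>\<^bsub>M\<^esub> (a \<odot>\<^bsub>M\<^esub> x) = a \<odot>\<^bsub>M\<^esub> (s \<odot>\<^bsub>M\<^esub> x)"
          using a s xc by (simp flip: smult_assoc1 add: R.m_comm)
        then have "s \<odot>\<^bsub>M\<^esub> (a \<odot>\<^bsub>M\<^esub> x) \<ominus>\<^bsub>M\<^esub> (a \<otimes> b) \<odot>\<^bsub>M\<^esub> m = a \<odot>\<^bsub>M\<^esub> (s \<odot>\<^bsub>M\<^esub> x \<ominus>\<^bsub>M\<^esub> b \<odot>\<^bsub>M\<^esub> m)"
          using a s xc m pf(1)[OF b(1)]
          by (simp add: a_minus_def smult_r_distr smult_r_minus smult_assoc1)
        then show ?thesis using submoduleE(4)[OF L a b(2)] pf(5)[OF b(1) a] a xc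
          unfolding H_def by (auto intro!: bexI[of _ "a \<otimes> b"])
      qed
      show "a \<odot>\<^bsub>M\<^esub> x \<in> H" if "a \<in> carrier R" "x \<in> H" for a x using smult that .
      have "\<ominus>\<^bsub>M\<^esub> a = (\<ominus> \<one>) \<odot>\<^bsub>M\<^esub> a" if "a \<in> carrier M" for a using that by (simp add: smult_l_minus)
      then show "\<ominus>\<^bsub>M\<^esub> a \<in> H" if "a \<in> H" for a using smult[of "\<ominus> \<one>" a] that H_def by auto
      fix x y assume "x \<in> H" "y \<in> H"
      then obtain a b where a: "a \<in> p" "s \<odot>\<^bsub>M\<^esub> x \<ominus>\<^bsub>M\<^esub> a \<odot>\<^bsub>M\<^esub> m \<in> ?L" and x: "x \<in> carrier M"
        and b: "b \<in> p" "s \<odot>\<^bsub>M\<^esub> y \<ominus>\<^bsub>M\<^esub> b \<odot>\<^bsub>M\<^esub> m \<in> ?L" and y: "y \<in> carrier M"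
        by (auto simp: H_def)
      have "s \<odot>\<^bsub>M\<^esub> (x \<oplus>\<^bsub>M\<^esub> y) \<ominus>\<^bsub>M\<^esub> (a \<oplus> b) \<odot>\<^bsub>M\<^esub> m =
        (s \<odot>\<^bsub>M\<^esub> x \<ominus>\<^bsub>M\<^esub> a \<odot>\<^bsub>M\<^esub> m) \<oplus>\<^bsub>M\<^esub> (s \<odot>\<^bsub>M\<^esub> y \<ominus>\<^bsub>M\<^esub> b \<odot>\<^bsub>M\<^esub> m)"
        using s x y m pf(1)[OF a(1)] pf(1)[OF b(1)]
        by (simp add: a_minus_def smult_r_distr smult_l_distr M.minus_add M.a_ac)
      with submoduleE(5)[OF L a(2) b(2)] have "s \<odot>\<^bsub>M\<^esub> (x \<oplus>\<^bsub>M\<^esub> y) \<ominus>\<^bsub>M\<^esub> (a \<oplus> b) \<odot>\<^bsub>M\<^esub> m \<in> ?L"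
        by (simp only:)
      then show "x \<oplus>\<^bsub>M\<^esub> y \<in> H"
        using x y pf(2)[OF a(1) b(1)] unfolding H_def by blast
    qed (auto simp: H_def)
    have "r \<in> p" if r: "r \<in> carrier R" "r \<odot>\<^bsub>M\<^esub> m \<in> H" for r
    proof (rule ccontr)
      assume rp: "r \<notin> p"
      from r obtain a where a: "a \<in> p" "s \<odot>\<^bsub>M\<^esub> (r \<odot>\<^bsub>M\<^esub> m) \<ominus>\<^bsub>M\<^esub> a \<odot>\<^bsub>M\<^esub> m \<in> ?L" by (auto simp: H_def)
      note ac = pf(1)[OF a(1)]
      \<comment> \<open>\<open>t\<close> is outside \<open>p\<close>, because \<open>s\<close> and
        \<open>r\<close> are and \<open>a\<close> is not, and it carries \<open>m\<close> into
        \<open>?L\<close>. Then \<open>t \<otimes> s\<close> carries all of \<open>M\<close> into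
        \<open>?L\<close>, and \<open>m\<close> would be redundant.\<close>
      define t where "t = s \<otimes> r \<ominus> a"
      have tc: "t \<in> carrier R" using s r ac by (auto simp: t_def)
      have tm: "t \<odot>\<^bsub>M\<^esub> m \<in> ?L"
        using a(2) s r ac m by (simp add: t_def a_minus_def smult_l_distr smult_l_minus smult_assoc1)
      have "t \<notin> p"
      proof
        assume "t \<in> p"
        moreover have "t \<oplus> a = s \<otimes> r" using s r ac by (simp add: t_def a_minus_def R.a_assoc R.l_neg)
        ultimately show False using pf(2)[OF _ a(1), of t] pf(8)[of s r] s r rp by auto
      qed
      have "(t \<otimes> s) \<odot>\<^bsub>M\<^esub> x \<in> ?L" if x: "x \<in> carrier M" for x
      proof -
        from split[OF x] obtain c l where c: "c \<in> carrier R" and l: "l \<in> ?L"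
          and eq: "s \<odot>\<^bsub>M\<^esub> x = c \<odot>\<^bsub>M\<^esub> m \<oplus>\<^bsub>M\<^esub> l" by blast
        have "t \<odot>\<^bsub>M\<^esub> (c \<odot>\<^bsub>M\<^esub> m) = c \<odot>\<^bsub>M\<^esub> (t \<odot>\<^bsub>M\<^esub> m)"
          using c tc m by (simp flip: smult_assoc1 add: R.m_comm)
        then have "(t \<otimes> s) \<odot>\<^bsub>M\<^esub> x = c \<odot>\<^bsub>M\<^esub> (t \<odot>\<^bsub>M\<^esub> m) \<oplus>\<^bsub>M\<^esub> t \<odot>\<^bsub>M\<^esub> l"
          using tc s x c m Lc[OF l] by (simp add: smult_assoc1 eq smult_r_distr)
        then show ?thesis using submoduleE(5)[OF L submoduleE(4)[OF L c tm] submoduleE(4)[OF L tc l]] by simp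
      qed
      with False compl_mult[OF p, of t s] tc \<open>t \<notin> p\<close> s show False by blast
    qed
    moreover have "\<exists>a\<in>carrier R. s \<odot>\<^bsub>M\<^esub> x \<ominus>\<^bsub>M\<^esub> a \<odot>\<^bsub>M\<^esub> m \<in> H" if x: "x \<in> carrier M" for x
    proof -
      from split[OF x] obtain c l where c: "c \<in> carrier R" and l: "l \<in> ?L"
        and eq: "s \<odot>\<^bsub>M\<^esub> x = c \<odot>\<^bsub>M\<^esub> m \<oplus>\<^bsub>M\<^esub> l" by blast
      have "s \<odot>\<^bsub>M\<^esub> x \<ominus>\<^bsub>M\<^esub> c \<odot>\<^bsub>M\<^esub> m = l"
        using c m Lc[OF l] by (simp add: eq a_minus_def M.a_ac M.r_neg M.r_neg1)
      with c l LH show ?thesis by auto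
    qed
    moreover have "K \<subseteq> H" using LH submodule_span_superset[of "T \<union> K"] by auto
    ultimately show ?thesis using m s H by blast
  qed
qed

text \<open>\<open>c x\<close> is a coefficient of \<open>m\<close> in \<open>s x\<close> modulo
  \<open>H\<close>. It is chosen arbitrarily, but two choices differ by an element of
  \<open>p\<close>, since a multiple of \<open>m\<close> lies in \<open>H\<close> only if its
  coefficient is in \<open>p\<close>. This uniqueness yields linearity modulo \<open>p\<close>. The
  factor \<open>s\<close> clears the denominator of a functional on the fibre at
  \<open>p\<close>.\<close>

lemma residue_functional_exists:
  assumes K: "submodule K R M" and sat: "saturation R M p K \<noteq> carrier M"
  obtains c where "linear_mod R M (ring_as_module R) p c" "\<And>k. k \<in> K \<Longrightarrow> c k \<in> p"
    "\<exists>m\<in>carrier M. c m \<notin> p"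
proof -
  obtain S where S: "finite S" "S \<subseteq> carrier M" "submodule_span R M S = carrier M"
    using finitely_generated unfolding finitely_generated_def by auto
  have SK: "submodule_span R M S \<subseteq> submodule_span R M (S \<union> K)"
    using S submodule_carrierD[OF K] submodule_span_superset[of "S \<union> K"]
    by (intro submodule_span_minimal submodule_span_is_submodule) auto
  have "\<one> \<odot>\<^bsub>M\<^esub> x \<in> submodule_span R M (S \<union> K)" if "x \<in> carrier M" for x
    using SK S that by auto
  from coefficient_submodule_exists[OF S(1,2) K compl_one[OF p] this sat]
  obtain m s H where m: "m \<in> carrier M" and s: "s \<in> carrier R" "s \<notin> p" and H: "submodule H R M"
    and KH: "K \<subseteq> H" and rp: "\<And>r. r \<in> carrier R \<Longrightarrow> r \<odot>\<^bsub>M\<^esub> m \<in> H \<Longrightarrow> r \<in> p"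
    and ex: "\<forall>x\<in>carrier M. \<exists>a\<in>carrier R. s \<odot>\<^bsub>M\<^esub> x \<ominus>\<^bsub>M\<^esub> a \<odot>\<^bsub>M\<^esub> m \<in> H"
    by blast
  from ex obtain c where c: "\<And>x. x \<in> carrier M \<Longrightarrow> c x \<in> carrier R"
    "\<And>x. x \<in> carrier M \<Longrightarrow> s \<odot>\<^bsub>M\<^esub> x \<ominus>\<^bsub>M\<^esub> c x \<odot>\<^bsub>M\<^esub> m \<in> H" by metis
  note Hm = submodule_minus[OF H] and He = submoduleE(4,5)[OF H] and pf = R.primeideal_facts[OF p]
  have "linear_mod R M (ring_as_module R) p c"
    unfolding linear_mod_def
  proof (intro conjI ballI)
    fix x y assume x: "x \<in> carrier M" and y: "y \<in> carrier M"
    \<comment> \<open>The terms with \<open>s\<close> cancel in this element of \<open>H\<close>,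
      and a multiple of \<open>m\<close> remains, so its coefficient lies in
      \<open>p\<close>.\<close>
    have "(s \<odot>\<^bsub>M\<^esub> x \<ominus>\<^bsub>M\<^esub> c x \<odot>\<^bsub>M\<^esub> m) \<oplus>\<^bsub>M\<^esub> (s \<odot>\<^bsub>M\<^esub> y \<ominus>\<^bsub>M\<^esub> c y \<odot>\<^bsub>M\<^esub> m) \<ominus>\<^bsub>M\<^esub> (s \<odot>\<^bsub>M\<^esub> (x \<oplus>\<^bsub>M\<^esub> y) \<ominus>\<^bsub>M\<^esub> c (x \<oplus>\<^bsub>M\<^esub> y) \<odot>\<^bsub>M\<^esub> m) \<in> H"
      using c x y by (intro Hm[OF He(2)[OF c(2) c(2)] c(2)]) auto
    moreover have "(s \<odot>\<^bsub>M\<^esub> x \<ominus>\<^bsub>M\<^esub> c x \<odot>\<^bsub>M\<^esub> m) \<oplus>\<^bsub>M\<^esub> (s \<odot>\<^bsub>M\<^esub> y \<ominus>\<^bsub>M\<^esub> c y \<odot>\<^bsub>M\<^esub> m) \<ominus>\<^bsub>M\<^esub> (s \<odot>\<^bsub>M\<^esub> (x \<oplus>\<^bsub>M\<^esub> y) \<ominus>\<^bsub>M\<^esub> c (x \<oplus>\<^bsub>M\<^esub> y) \<odot>\<^bsub>M\<^esub> m)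
      = (c (x \<oplus>\<^bsub>M\<^esub> y) \<ominus> (c x \<oplus> c y)) \<odot>\<^bsub>M\<^esub> m"
      using c(1) x y s m
      by (simp add: a_minus_def smult_l_distr smult_r_distr smult_l_minus R.minus_add M.minus_add M.a_ac M.r_neg M.r_neg1 M.r_neg2)
    ultimately show "c (x \<oplus>\<^bsub>M\<^esub> y) \<ominus>\<^bsub>ring_as_module R\<^esub> (c x \<oplus>\<^bsub>ring_as_module R\<^esub> c y) \<in> p"
      using c x y by (simp add: R.ring_as_module_minus rp)
  next
    fix a x assume a: "a \<in> carrier R" and x: "x \<in> carrier M"
    have "a \<odot>\<^bsub>M\<^esub> (s \<odot>\<^bsub>M\<^esub> x \<ominus>\<^bsub>M\<^esub> c x \<odot>\<^bsub>M\<^esub> m) \<ominus>\<^bsub>M\<^esub> (s \<odot>\<^bsub>M\<^esub> (a \<odot>\<^bsub>M\<^esub> x) \<ominus>\<^bsub>M\<^esub> c (a \<odot>\<^bsub>M\<^esub> x) \<odot>\<^bsub>M\<^esub> m) \<in> H"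
      using c a x by (intro Hm[OF He(1)[OF a c(2)] c(2)]) auto
    moreover have "a \<odot>\<^bsub>M\<^esub> (s \<odot>\<^bsub>M\<^esub> x \<ominus>\<^bsub>M\<^esub> c x \<odot>\<^bsub>M\<^esub> m) \<ominus>\<^bsub>M\<^esub> (s \<odot>\<^bsub>M\<^esub> (a \<odot>\<^bsub>M\<^esub> x) \<ominus>\<^bsub>M\<^esub> c (a \<odot>\<^bsub>M\<^esub> x) \<odot>\<^bsub>M\<^esub> m)
      = (c (a \<odot>\<^bsub>M\<^esub> x) \<ominus> a \<otimes> c x) \<odot>\<^bsub>M\<^esub> m"
    proof -
      have "s \<odot>\<^bsub>M\<^esub> (a \<odot>\<^bsub>M\<^esub> x) = a \<odot>\<^bsub>M\<^esub> (s \<odot>\<^bsub>M\<^esub> x)"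
        using a s x by (simp flip: smult_assoc1 add: R.m_comm)
      then show ?thesis using c(1) a x s m
        by (simp add: a_minus_def smult_l_distr smult_r_distr smult_l_minus smult_r_minus smult_assoc1 M.minus_add M.a_ac M.r_neg M.r_neg1 M.r_neg2)
    qed
    ultimately show "c (a \<odot>\<^bsub>M\<^esub> x) \<ominus>\<^bsub>ring_as_module R\<^esub> a \<odot>\<^bsub>ring_as_module R\<^esub> c x \<in> p"
      using c a x by (simp add: R.ring_as_module_minus rp)
  qed (use c in auto)
  moreover have "c k \<in> p" if k: "k \<in> K" for k
  proof -
    have kH: "k \<in> H" and kc: "k \<in> carrier M" using k KH submodule_carrierD[OF K] by auto
    have "c k \<odot>\<^bsub>M\<^esub> m \<in> H"
      using mem_submodule_cong[OF H c(2)[OF kc]] He(1)[OF s(1) kH] c(1)[OF kc] kc m s by auto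
    then show ?thesis using rp c(1)[OF kc] by auto
  qed
  \<comment> \<open>In fact \<open>c m\<close> is congruent to \<open>s\<close> modulo
    \<open>p\<close>, because \<open>(s \<ominus> c m) m\<close> lies in \<open>H\<close>.\<close>
  moreover have "c m \<notin> p"
  proof
    assume cm: "c m \<in> p"
    have "s \<odot>\<^bsub>M\<^esub> m \<ominus>\<^bsub>M\<^esub> c m \<odot>\<^bsub>M\<^esub> m = (s \<ominus> c m) \<odot>\<^bsub>M\<^esub> m"
      using s c(1)[OF m] m by (simp add: a_minus_def smult_l_distr smult_l_minus)
    then have "s \<ominus> c m \<in> p" using c(1,2)[OF m] s rp[of "s \<ominus> c m"] by auto
    then have "(s \<ominus> c m) \<oplus> c m \<in> p" using pf(2) cm by auto
    moreover have "(s \<ominus> c m) \<oplus> c m = s" using s c(1)[OF m] by (simp add: a_minus_def R.a_assoc R.l_neg)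
    ultimately show False using s by simp
  qed
  ultimately show ?thesis using m by (intro that[of c]) auto
qed

text \<open>Nakayama's lemma once more. A residue functional vanishing on \<open>K\<close> modulo
  \<open>p\<close> also sends \<open>x M\<close> into \<open>p\<close>, so an \<open>m\<close> with
  value outside \<open>p\<close> survives modulo \<open>K + xM\<close>. This carries the hypothesis
  on \<open>K\<close> through the induction.\<close>

lemma saturation_add_smult:
  assumes K: "submodule K R M" and x: "x \<in> p" and sat: "saturation R M p K \<noteq> carrier M"
  shows "saturation R M p (K <+>\<^bsub>M\<^esub> (\<odot>\<^bsub>M\<^esub>) x ` carrier M) \<noteq> carrier M"
proof
  assume eq: "saturation R M p (K <+>\<^bsub>M\<^esub> (\<odot>\<^bsub>M\<^esub>) x ` carrier M) = carrier M"
  obtain c m where c: "linear_mod R M (ring_as_module R) p c" "\<And>k. k \<in> K \<Longrightarrow> c k \<in> p"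
    and m: "m \<in> carrier M" "c m \<notin> p"
    using residue_functional_exists[OF K sat] by metis
  interpret RM: Module.module R "ring_as_module R" by (rule R.ring_as_module_is_module)
  note pf = R.primeideal_facts[OF p] and P = R.primeideal_submodule[OF p] and cD = linear_modD[OF c(1), simplified]
  note cong = RM.mem_submodule_cong[OF P, simplified]
  from m(1) eq obtain s k y where s: "s \<in> carrier R" "s \<notin> p" and k: "k \<in> K" and y: "y \<in> carrier M"
    and sm: "s \<odot>\<^bsub>M\<^esub> m = k \<oplus>\<^bsub>M\<^esub> x \<odot>\<^bsub>M\<^esub> y" unfolding saturation_def set_add_def' by blast
  have kc: "k \<in> carrier M" and xc: "x \<in> carrier R" using k submodule_carrierD[OF K] pf(1) x by auto
  have xy: "c (x \<odot>\<^bsub>M\<^esub> y) \<in> p"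
    using cong[OF cD(3)[OF xc y]] pf(4)[OF x cD(1)[OF y]] cD(1) xc y by auto
  have "c (k \<oplus>\<^bsub>M\<^esub> x \<odot>\<^bsub>M\<^esub> y) \<in> p"
    using cong[OF cD(2)[OF kc, of "x \<odot>\<^bsub>M\<^esub> y"]] pf(2)[OF c(2)[OF k] xy] cD(1) kc xc y by auto
  then have "c (s \<odot>\<^bsub>M\<^esub> m) \<in> p" by (simp only: sm)
  then have "s \<otimes> c m \<in> p"
    using cong[OF cD(3)[OF s(1) m(1)]] cD(1) s m by auto
  then show False using pf(8)[OF s(1) cD(1)[OF m(1)]] s m by auto
qed

end

end

section \<open>Cochains of the standard resolution\<close>

text \<open>Since the modules \<open>F\<^sub>i\<close> are free, classes in the Ext modules of \<open>M\<close> and \<open>N/K\<close> are represented by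
  linear maps \<open>F\<^sub>i \<rightarrow> N\<close> whose coboundary lies in \<open>K\<close>.  This keeps all submodules \<open>K\<close> of \<open>N\<close> in one
  type and permits induction over them.\<close>

definition coboundary_maps ::
    "('a, 'r) ring_scheme \<Rightarrow> ('a, 'm, 'x) module_scheme \<Rightarrow> ('a, 'n, 'y) module_scheme \<Rightarrow> nat \<Rightarrow>
     ((('a, 'm) res_index \<Rightarrow> 'a) \<Rightarrow> 'n) set" where
  "coboundary_maps R M N i = (case i of 0 \<Rightarrow> {\<lambda>_. \<zero>\<^bsub>N\<^esub>}
     | Suc j \<Rightarrow> {\<lambda>f. \<psi> (std_diff R M j f) | \<psi>. linear_map R (std_free R M j) N \<psi>})"

text \<open>The class of \<open>\<phi>\<close> in degree \<open>i\<close> of Ext of \<open>M\<close>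
  and \<open>N/K\<close> survives multiplication by every \<open>s\<close> outside \<open>p\<close>.
  A coboundary with values in \<open>N/K\<close> lifts to one with values in \<open>N\<close>, since
  the previous term of the resolution is free; hence \<open>\<theta>\<close> takes values in
  \<open>N\<close> and only the comparison is modulo \<open>K\<close>.\<close>

definition ext_nonzero_at ::
    "('a, 'r) ring_scheme \<Rightarrow> ('a, 'm, 'x) module_scheme \<Rightarrow> ('a, 'n, 'y) module_scheme \<Rightarrow> 'a set \<Rightarrow>
     'n set \<Rightarrow> nat \<Rightarrow> bool" where
  "ext_nonzero_at R M N p K i \<longleftrightarrow> (\<exists>\<phi>. linear_map R (std_free R M i) N \<phi> \<and>
     (\<forall>f\<in>carrier (std_free R M (Suc i)). \<phi> (std_diff R M i f) \<in> K) \<and>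
     (\<forall>s\<in>carrier R - p. \<forall>\<theta>\<in>coboundary_maps R M N i.
        \<exists>f\<in>carrier (std_free R M i). s \<odot>\<^bsub>N\<^esub> \<phi> f \<ominus>\<^bsub>N\<^esub> \<theta> f \<notin> K))"

locale module_pair = M: Module.module R M + N: Module.module R N
  for R (structure) and M :: "('a, 'm, 'x) module_scheme" and N :: "('a, 'n, 'y) module_scheme"
begin

abbreviation "F \<equiv> std_free R M"
abbreviation "d \<equiv> std_diff R M"
abbreviation "\<epsilon> \<equiv> std_augmentation R M"

lemmas cr = M.R.is_cring

lemmas resolution = std_resolution_exact[OF M.module_axioms]

lemma std_diff_linear: "linear_map R (F (Suc i)) (F i) (d i)"
proof -
  interpret Fi: Module.module R "F i" by (rule resolution(1))
  interpret Fs: Module.module R "F (Suc i)" by (rule resolution(1))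
  show ?thesis using resolution(3)[of i]
    by (auto simp: hom_module_def linear_map_def Pi_def)
qed

lemma std_augmentation_linear: "linear_map R (F 0) M \<epsilon>"
proof -
  interpret F0: Module.module R "F 0" by (rule resolution(1))
  show ?thesis using resolution(2) by (auto simp: hom_module_def linear_map_def Pi_def)
qed

lemmas d_closed = linear_mapD(1)[OF std_diff_linear]

lemma d_d: "f \<in> carrier (F (Suc (Suc i))) \<Longrightarrow> d i (d (Suc i) f) = \<zero>\<^bsub>F i\<^esub>"
  using resolution(6)[of i] by blast

lemma augmentation_d: "f \<in> carrier (F (Suc 0)) \<Longrightarrow> \<epsilon> (d 0 f) = \<zero>\<^bsub>M\<^esub>"
  using resolution(5) by blast

lemma linear_map_F_zero: "linear_map R (F i) N \<phi> \<Longrightarrow> \<phi> \<zero>\<^bsub>F i\<^esub> = \<zero>\<^bsub>N\<^esub>"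
  by (rule N.linear_map_zero[OF resolution(1)])

lemma coboundary_maps_linear:
  assumes "\<theta> \<in> coboundary_maps R M N i" shows "linear_map R (F i) N \<theta>"
proof (cases i)
  case 0
  then show ?thesis using assms N.linear_map_zero_map[OF resolution(1)] by (simp add: coboundary_maps_def)
next
  case (Suc j)
  then obtain \<psi> where "linear_map R (F j) N \<psi>" "\<theta> = (\<lambda>f. \<psi> (d j f))"
    using assms by (auto simp: coboundary_maps_def)
  with Suc show ?thesis using linear_map_compose[OF std_diff_linear] by auto
qed

lemma coboundary_maps_d:
  assumes "\<theta> \<in> coboundary_maps R M N i" "f \<in> carrier (F (Suc i))" shows "\<theta> (d i f) = \<zero>\<^bsub>N\<^esub>"
proof (cases i)
  case 0
  then show ?thesis using assms by (simp add: coboundary_maps_def)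
next
  case (Suc j)
  then obtain \<psi> where "linear_map R (F j) N \<psi>" "\<theta> = (\<lambda>f. \<psi> (d j f))"
    using assms by (auto simp: coboundary_maps_def)
  with Suc assms show ?thesis using linear_map_F_zero d_d by simp
qed

text \<open>The condition is asked of all elements rather than of the basis, because this is the
  form in which exactness of the resolution supplies it.\<close>

lemma F_lift:
  assumes "Module.module R X" "Module.module R Y" "submodule L R X"
    and "linear_map R Y X v" "linear_mod R (F i) X L u"
    and "\<And>f. f \<in> carrier (F i) \<Longrightarrow> \<exists>y\<in>carrier Y. v y \<ominus>\<^bsub>X\<^esub> u f \<in> L"
  obtains w where "linear_map R (F i) Y w" "\<And>f. f \<in> carrier (F i) \<Longrightarrow> v (w f) \<ominus>\<^bsub>X\<^esub> u f \<in> L"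
proof (rule free_module_lift[OF assms(1-4) assms(5)[unfolded std_free_def]])
  show "\<exists>y\<in>carrier Y. v y \<ominus>\<^bsub>X\<^esub> u (unit_vector R b) \<in> L" if "b \<in> std_basis R M i" for b
    by (rule assms(6)) (simp add: std_free_def unit_vector_carrier[OF cr that])
qed (use that in \<open>simp add: std_free_def\<close>)

end

section \<open>Nonvanishing of Ext at a fixed prime\<close>

locale noetherian_pair = M: noetherian_module R M + N: noetherian_module R N
  for R (structure) and M :: "('a, 'm, 'x) module_scheme" and N :: "('a, 'n, 'y) module_scheme" +
  fixes p assumes p: "primeideal p R"

sublocale noetherian_pair \<subseteq> module_pair ..

context noetherian_pair begin

lemmas pf = M.R.primeideal_facts[OF p]

lemma not_ext_nonzero_atD:
  assumes neg: "\<not> ext_nonzero_at R M N p K i" and \<phi>: "linear_map R (F i) N \<phi>"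
    and coc: "\<And>f. f \<in> carrier (F (Suc i)) \<Longrightarrow> \<phi> (d i f) \<in> K"
  obtains s \<theta> where "s \<in> carrier R - p" "\<theta> \<in> coboundary_maps R M N i"
    "\<And>f. f \<in> carrier (F i) \<Longrightarrow> s \<odot>\<^bsub>N\<^esub> \<phi> f \<ominus>\<^bsub>N\<^esub> \<theta> f \<in> K"
proof (rule ccontr)
  assume "\<not> thesis"
  then have "\<forall>s\<in>carrier R - p. \<forall>\<theta>\<in>coboundary_maps R M N i.
      \<exists>f\<in>carrier (F i). s \<odot>\<^bsub>N\<^esub> \<phi> f \<ominus>\<^bsub>N\<^esub> \<theta> f \<notin> K"
    using that by metis
  then have "ext_nonzero_at R M N p K i" unfolding ext_nonzero_at_def using \<phi> coc
    by (intro exI[of _ \<phi>] conjI ballI) auto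
  with neg show False by simp
qed

text \<open>The long exact sequence of \<open>x\<close> on \<open>N/K\<close>, written out on
  cochains with explicit denominators. If both groups for \<open>K\<close> vanish at
  \<open>p\<close>, then the connecting map sends the class of \<open>\<phi>\<close> to zero, so a
  multiple of \<open>\<phi>\<close> can be changed by a multiple of \<open>x\<close> into a cocycle
  modulo \<open>K\<close>, which is a coboundary at \<open>p\<close>.\<close>

lemma ext_nonzero_at_step:
  assumes K: "submodule K R N" and x: "x \<in> carrier R"
    and reg: "\<forall>n\<in>carrier N. x \<odot>\<^bsub>N\<^esub> n \<in> K \<longrightarrow> n \<in> saturation R N p K"
    and E: "ext_nonzero_at R M N p (K <+>\<^bsub>N\<^esub> (\<odot>\<^bsub>N\<^esub>) x ` carrier N) i"
  shows "ext_nonzero_at R M N p K i \<or> ext_nonzero_at R M N p K (Suc i)"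
proof (rule ccontr)
  assume "\<not> ?thesis"
  then have neg: "\<not> ext_nonzero_at R M N p K i" "\<not> ext_nonzero_at R M N p K (Suc i)" by auto
  let ?K = "K <+>\<^bsub>N\<^esub> (\<odot>\<^bsub>N\<^esub>) x ` carrier N"
  obtain \<phi> where \<phi>: "linear_map R (F i) N \<phi>" "\<And>f. f \<in> carrier (F (Suc i)) \<Longrightarrow> \<phi> (d i f) \<in> ?K"
    and nz: "\<And>s \<theta>. s \<in> carrier R - p \<Longrightarrow> \<theta> \<in> coboundary_maps R M N i \<Longrightarrow>
        \<exists>f\<in>carrier (F i). s \<odot>\<^bsub>N\<^esub> \<phi> f \<ominus>\<^bsub>N\<^esub> \<theta> f \<notin> ?K"
    using E unfolding ext_nonzero_at_def by blast
  have \<phi>d: "linear_map R (F (Suc i)) N (\<lambda>f. \<phi> (d i f))"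
    by (rule linear_map_compose[OF std_diff_linear \<phi>(1)])
  have "linear_map R N N (\<lambda>y. y)" by (simp add: linear_map_def)
  then have xlin: "linear_map R N N ((\<odot>\<^bsub>N\<^esub>) x)" by (rule N.linear_map_smult[OF _ x])
  have ex: "\<exists>y\<in>carrier N. x \<odot>\<^bsub>N\<^esub> y \<ominus>\<^bsub>N\<^esub> \<phi> (d i f) \<in> K" if f: "f \<in> carrier (F (Suc i))" for f
  proof -
    obtain k y where k: "k \<in> K" and y: "y \<in> carrier N" and eq: "\<phi> (d i f) = k \<oplus>\<^bsub>N\<^esub> x \<odot>\<^bsub>N\<^esub> y"
      using \<phi>(2)[OF f] unfolding set_add_def' by blast
    have "x \<odot>\<^bsub>N\<^esub> y \<ominus>\<^bsub>N\<^esub> \<phi> (d i f) = \<ominus>\<^bsub>N\<^esub> k"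
      using N.submodule_carrierD[OF K k] x y
      by (simp add: eq a_minus_def N.M.minus_add N.M.a_ac N.M.r_neg)
    then show ?thesis using y N.submoduleE(3)[OF K k] by (intro bexI[of _ y]) simp_all
  qed
  \<comment> \<open>\<open>\<psi>\<close> represents the image of \<open>\<phi>\<close> under the
    connecting map: the coboundary of \<open>\<phi>\<close> divided by \<open>x\<close>, modulo
    \<open>K\<close>.\<close>
  obtain \<psi> where \<psi>: "linear_map R (F (Suc i)) N \<psi>"
    "\<And>f. f \<in> carrier (F (Suc i)) \<Longrightarrow> x \<odot>\<^bsub>N\<^esub> \<psi> f \<ominus>\<^bsub>N\<^esub> \<phi> (d i f) \<in> K"
    by (rule F_lift[OF N.module_axioms N.module_axioms K xlin N.linear_map_imp_mod[OF K resolution(1) \<phi>d] ex],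
        assumption, rule that)
  \<comment> \<open>Regularity of \<open>x\<close> puts the coboundary of \<open>\<psi>\<close> into
    the saturation of \<open>K\<close> only; a single \<open>s\<close> moves all its values into
    \<open>K\<close>.\<close>
  obtain s where s: "s \<in> carrier R - p" and sat: "\<And>y. y \<in> saturation R N p K \<Longrightarrow> s \<odot>\<^bsub>N\<^esub> y \<in> K"
    using N.saturation_uniform[OF p K] by blast
  have coc: "s \<odot>\<^bsub>N\<^esub> \<psi> (d (Suc i) f) \<in> K" if f: "f \<in> carrier (F (Suc (Suc i)))" for f
  proof -
    note df = d_closed[OF f]
    have "x \<odot>\<^bsub>N\<^esub> \<psi> (d (Suc i) f) \<in> K"
      using \<psi>(2)[OF df] linear_mapD(1)[OF \<psi>(1) df] x
      by (simp add: d_d[OF f] linear_map_F_zero[OF \<phi>(1)] a_minus_def)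
    then show ?thesis using reg linear_mapD(1)[OF \<psi>(1) df] sat by blast
  qed
  have lin: "linear_map R (F (Suc i)) N (\<lambda>f. s \<odot>\<^bsub>N\<^esub> \<psi> f)"
    using N.linear_map_smult[OF \<psi>(1)] s by blast
  obtain t \<theta>' where t: "t \<in> carrier R - p" and \<theta>': "\<theta>' \<in> coboundary_maps R M N (Suc i)"
    and t\<theta>': "\<And>f. f \<in> carrier (F (Suc i)) \<Longrightarrow> t \<odot>\<^bsub>N\<^esub> (s \<odot>\<^bsub>N\<^esub> \<psi> f) \<ominus>\<^bsub>N\<^esub> \<theta>' f \<in> K"
    by (rule not_ext_nonzero_atD[OF neg(2) lin coc], assumption, rule that)
  from \<theta>' obtain \<theta> where \<theta>: "linear_map R (F i) N \<theta>" "\<theta>' = (\<lambda>f. \<theta> (d i f))"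
    by (auto simp: coboundary_maps_def)
  note t\<theta> = t\<theta>'[unfolded \<theta>(2)] and \<theta> = \<theta>(1)
  \<comment> \<open>The correction is a multiple of \<open>x\<close>, hence invisible modulo
    \<open>?K\<close>, and makes the coboundary vanish modulo \<open>K\<close>.\<close>
  define \<eta> where "\<eta> f = (t \<otimes> s) \<odot>\<^bsub>N\<^esub> \<phi> f \<ominus>\<^bsub>N\<^esub> x \<odot>\<^bsub>N\<^esub> \<theta> f" for f
  have c: "s \<in> carrier R" "t \<in> carrier R" using s t by auto
  note \<phi>c = linear_mapD(1)[OF \<phi>(1)] and \<psi>c = linear_mapD(1)[OF \<psi>(1)] and \<theta>c = linear_mapD(1)[OF \<theta>]
  have lin_\<eta>: "linear_map R (F i) N \<eta>"
    unfolding \<eta>_def using c x by (intro N.linear_map_minus N.linear_map_smult \<phi>(1) \<theta>) auto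
  have coc_\<eta>: "\<eta> (d i f) \<in> K" if f: "f \<in> carrier (F (Suc i))" for f
  proof -
    note dc = \<phi>c[OF d_closed[OF f]] \<psi>c[OF f] \<theta>c[OF d_closed[OF f]]
    \<comment> \<open>\<open>x\<close> times the relation for \<open>\<theta>\<close> minus
      \<open>t \<otimes> s\<close> times the relation for \<open>\<psi>\<close>; the terms with
      \<open>\<psi>\<close> cancel.\<close>
    have "x \<odot>\<^bsub>N\<^esub> (t \<odot>\<^bsub>N\<^esub> (s \<odot>\<^bsub>N\<^esub> \<psi> f) \<ominus>\<^bsub>N\<^esub> \<theta> (d i f)) \<ominus>\<^bsub>N\<^esub> (t \<otimes> s) \<odot>\<^bsub>N\<^esub> (x \<odot>\<^bsub>N\<^esub> \<psi> f \<ominus>\<^bsub>N\<^esub> \<phi> (d i f)) \<in> K"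
      using c x by (intro N.submodule_minus[OF K] N.submoduleE(4)[OF K] t\<theta> \<psi>(2) f) auto
    moreover have A: "x \<odot>\<^bsub>N\<^esub> (t \<odot>\<^bsub>N\<^esub> (s \<odot>\<^bsub>N\<^esub> \<psi> f)) = (t \<otimes> s) \<odot>\<^bsub>N\<^esub> (x \<odot>\<^bsub>N\<^esub> \<psi> f)"
      using c x dc by (simp flip: N.smult_assoc1 add: M.R.m_ac)
    have "x \<odot>\<^bsub>N\<^esub> (t \<odot>\<^bsub>N\<^esub> (s \<odot>\<^bsub>N\<^esub> \<psi> f) \<ominus>\<^bsub>N\<^esub> \<theta> (d i f)) \<ominus>\<^bsub>N\<^esub> (t \<otimes> s) \<odot>\<^bsub>N\<^esub> (x \<odot>\<^bsub>N\<^esub> \<psi> f \<ominus>\<^bsub>N\<^esub> \<phi> (d i f)) = \<eta> (d i f)"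
      using c x dc by (simp add: \<eta>_def N.smult_minus A N.minus_minus_cancel_left)
    ultimately show "\<eta> (d i f) \<in> K" by (simp only:)
  qed
  obtain u \<omega> where u: "u \<in> carrier R - p" and \<omega>: "\<omega> \<in> coboundary_maps R M N i"
    and u\<omega>: "\<And>f. f \<in> carrier (F i) \<Longrightarrow> u \<odot>\<^bsub>N\<^esub> \<eta> f \<ominus>\<^bsub>N\<^esub> \<omega> f \<in> K"
    by (rule not_ext_nonzero_atD[OF neg(1) lin_\<eta> coc_\<eta>], assumption, rule that)
  have uc: "u \<in> carrier R" using u by auto
  obtain f where f: "f \<in> carrier (F i)" and nf: "(u \<otimes> (t \<otimes> s)) \<odot>\<^bsub>N\<^esub> \<phi> f \<ominus>\<^bsub>N\<^esub> \<omega> f \<notin> ?K"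
    using nz[OF N.compl_mult[OF p u N.compl_mult[OF p t s]] \<omega>] by (rule bexE)
  note fc = \<phi>c[OF f] \<theta>c[OF f] linear_mapD(1)[OF coboundary_maps_linear[OF \<omega>] f]
  have "u \<odot>\<^bsub>N\<^esub> (x \<odot>\<^bsub>N\<^esub> \<theta> f) = x \<odot>\<^bsub>N\<^esub> (u \<odot>\<^bsub>N\<^esub> \<theta> f)"
    using uc x fc by (simp flip: N.smult_assoc1 add: M.R.m_comm)
  then have "(u \<otimes> (t \<otimes> s)) \<odot>\<^bsub>N\<^esub> \<phi> f \<ominus>\<^bsub>N\<^esub> \<omega> f = (u \<odot>\<^bsub>N\<^esub> \<eta> f \<ominus>\<^bsub>N\<^esub> \<omega> f) \<oplus>\<^bsub>N\<^esub> x \<odot>\<^bsub>N\<^esub> (u \<odot>\<^bsub>N\<^esub> \<theta> f)"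
    using c x uc fc
    by (simp add: \<eta>_def N.smult_minus N.smult_assoc1 N.minus_minus_add_cancel)
  moreover have "\<dots> \<in> ?K"
  proof -
    note X = N.submodule_smult_image[OF x N.carrier_is_submodule]
    have "x \<odot>\<^bsub>N\<^esub> (u \<odot>\<^bsub>N\<^esub> \<theta> f) \<in> (\<odot>\<^bsub>N\<^esub>) x ` carrier N" using uc fc by (intro imageI) auto
    then show ?thesis
      using N.submoduleE(5)[OF N.submodule_set_add[OF K X]] N.set_add_superset[OF K X] u\<omega>[OF f]
      by (meson subsetD)
  qed
  ultimately show False using nf by (simp only: not_True_eq_False)
qed

text \<open>The map from \<open>R/p\<close> to \<open>N/K\<close> sending 1 to \<open>y\<close> is
  well defined and injective, because \<open>p\<close> is exactly the annihilator of
  \<open>y\<close>. On \<open>F 0\<close> the composite is \<open>?u\<close>, linear modulo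
  \<open>K\<close>; its linear replacement \<open>\<phi>\<close> satisfies
  \<open>\<phi> f \<in> K\<close> iff \<open>c (\<epsilon> f) \<in> p\<close>. This gives the
  cocycle condition, and survival at a preimage of \<open>m\<close>.\<close>

lemma ext_nonzero_at_0:
  assumes K: "submodule K R N" and y: "y \<in> carrier N" "elem_colon R N K y = p"
    and M: "saturation R M p {\<zero>\<^bsub>M\<^esub>} \<noteq> carrier M"
  shows "ext_nonzero_at R M N p K 0"
proof -
  obtain c m where c: "linear_mod R M (ring_as_module R) p c" "\<And>k. k \<in> {\<zero>\<^bsub>M\<^esub>} \<Longrightarrow> c k \<in> p"
    and m: "m \<in> carrier M" "c m \<notin> p"
    using M.residue_functional_exists[OF p M.submodule_zero_set M] by metis
  note cD = linear_modD[OF c(1), simplified] and \<epsilon>D = linear_mapD[OF std_augmentation_linear]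
  have py: "r \<odot>\<^bsub>N\<^esub> y \<in> K \<longleftrightarrow> r \<in> p" if "r \<in> carrier R" for r
    using that unfolding y(2)[symmetric] by (simp add: elem_colon_def)
  let ?u = "\<lambda>f. c (\<epsilon> f) \<odot>\<^bsub>N\<^esub> y"
  have u: "linear_mod R (F 0) N K ?u"
    unfolding linear_mod_def
  proof (intro conjI ballI)
    fix f g assume f: "f \<in> carrier (F 0)" and g: "g \<in> carrier (F 0)"
    note cc = cD(1)[OF \<epsilon>D(1)[OF f]] cD(1)[OF \<epsilon>D(1)[OF g]]
    have e: "\<epsilon> (f \<oplus>\<^bsub>F 0\<^esub> g) = \<epsilon> f \<oplus>\<^bsub>M\<^esub> \<epsilon> g" by (rule \<epsilon>D(2)[OF f g])
    have cs: "c (\<epsilon> f \<oplus>\<^bsub>M\<^esub> \<epsilon> g) \<in> carrier R" using cD(1) \<epsilon>D(1) f g by auto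
    have "?u (f \<oplus>\<^bsub>F 0\<^esub> g) \<ominus>\<^bsub>N\<^esub> (?u f \<oplus>\<^bsub>N\<^esub> ?u g) = (c (\<epsilon> f \<oplus>\<^bsub>M\<^esub> \<epsilon> g) \<ominus> (c (\<epsilon> f) \<oplus> c (\<epsilon> g))) \<odot>\<^bsub>N\<^esub> y"
      using cc cs y(1) by (simp add: e a_minus_def N.smult_l_distr N.smult_l_minus)
    then show "?u (f \<oplus>\<^bsub>F 0\<^esub> g) \<ominus>\<^bsub>N\<^esub> (?u f \<oplus>\<^bsub>N\<^esub> ?u g) \<in> K"
      using cD(2)[OF \<epsilon>D(1)[OF f] \<epsilon>D(1)[OF g]] cc cs py by (simp add: M.R.ring_as_module_minus)
  next
    fix a f assume a: "a \<in> carrier R" and f: "f \<in> carrier (F 0)"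
    note cc = cD(1)[OF \<epsilon>D(1)[OF f]]
    have e: "\<epsilon> (a \<odot>\<^bsub>F 0\<^esub> f) = a \<odot>\<^bsub>M\<^esub> \<epsilon> f" by (rule \<epsilon>D(3)[OF a f])
    have cs: "c (a \<odot>\<^bsub>M\<^esub> \<epsilon> f) \<in> carrier R" using cD(1) \<epsilon>D(1) f a by auto
    have "?u (a \<odot>\<^bsub>F 0\<^esub> f) \<ominus>\<^bsub>N\<^esub> a \<odot>\<^bsub>N\<^esub> ?u f = (c (a \<odot>\<^bsub>M\<^esub> \<epsilon> f) \<ominus> a \<otimes> c (\<epsilon> f)) \<odot>\<^bsub>N\<^esub> y"
      using cc cs y(1) a by (simp add: e a_minus_def N.smult_l_distr N.smult_l_minus N.smult_assoc1)
    then show "?u (a \<odot>\<^bsub>F 0\<^esub> f) \<ominus>\<^bsub>N\<^esub> a \<odot>\<^bsub>N\<^esub> ?u f \<in> K"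
      using cD(3)[OF a \<epsilon>D(1)[OF f]] cc cs a py by (simp add: M.R.ring_as_module_minus)
  qed (use cD(1) \<epsilon>D(1) y in auto)
  have id: "linear_map R N N (\<lambda>y. y)" by (simp add: linear_map_def)
  have uc: "?u f \<in> carrier N" if "f \<in> carrier (F 0)" for f using that cD(1) \<epsilon>D(1) y by auto
  obtain \<phi> where \<phi>: "linear_map R (F 0) N \<phi>" "\<And>f. f \<in> carrier (F 0) \<Longrightarrow> \<phi> f \<ominus>\<^bsub>N\<^esub> ?u f \<in> K"
    using F_lift[OF N.module_axioms N.module_axioms K id u]
      uc N.minus_self[OF uc] N.submodule_zero[OF K] by metis
  have mem: "\<phi> f \<in> K \<longleftrightarrow> c (\<epsilon> f) \<in> p" if f: "f \<in> carrier (F 0)" for f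
    using N.mem_submodule_cong[OF K \<phi>(2)[OF f] linear_mapD(1)[OF \<phi>(1) f] uc[OF f]] py cD(1) \<epsilon>D(1)[OF f]
    by auto
  have "\<phi> (d 0 f) \<in> K" if "f \<in> carrier (F (Suc 0))" for f
    using mem[OF d_closed[OF that]] augmentation_d[OF that] c(2) by simp
  moreover obtain f where f: "f \<in> carrier (F 0)" "\<epsilon> f = m" using m(1) resolution(4) by (metis imageE)
  have "s \<odot>\<^bsub>N\<^esub> \<phi> f \<ominus>\<^bsub>N\<^esub> \<theta> f \<notin> K" if s: "s \<in> carrier R - p" and "\<theta> \<in> coboundary_maps R M N 0" for s \<theta>
  proof
    note \<phi>f = linear_mapD(1)[OF \<phi>(1) f(1)]
    assume "s \<odot>\<^bsub>N\<^esub> \<phi> f \<ominus>\<^bsub>N\<^esub> \<theta> f \<in> K"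
    then have "\<phi> (s \<odot>\<^bsub>F 0\<^esub> f) \<in> K"
      using that \<phi>f linear_mapD(3)[OF \<phi>(1) _ f(1)] by (auto simp: coboundary_maps_def a_minus_def)
    moreover interpret F0: Module.module R "F 0" by (rule resolution(1))
    have sf: "s \<odot>\<^bsub>F 0\<^esub> f \<in> carrier (F 0)" using s f by auto
    ultimately have "c (s \<odot>\<^bsub>M\<^esub> m) \<in> p" using mem[OF sf] \<epsilon>D(3)[OF _ f(1)] s f(2) by auto
    moreover interpret RM: Module.module R "ring_as_module R" by (rule M.R.ring_as_module_is_module)
    have "c (s \<odot>\<^bsub>M\<^esub> m) \<in> p \<longleftrightarrow> s \<otimes> c m \<in> p"
      using RM.mem_submodule_cong[OF M.R.primeideal_submodule[OF p], simplified, OF cD(3)] cD(1) s m by auto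
    ultimately show False using pf(8)[of s "c m"] cD(1) s m by auto
  qed
  ultimately show ?thesis unfolding ext_nonzero_at_def using \<phi>(1) f(1) by blast
qed

text \<open>A regular element \<open>x \<in> p\<close> on \<open>N/K\<close> lies in no minimal prime of the support, so a chain of primes
  in the support of \<open>N/(K + xN)\<close> extends at its lower end to one in the support of \<open>N/K\<close>.  This
  pays for the degree lost in passing from \<open>K + xN\<close> to \<open>K\<close>.\<close>

theorem ext_nonzero_at_exists:
  assumes "submodule K R N" "saturation R N p K \<noteq> carrier N"
    and M: "saturation R M p {\<zero>\<^bsub>M\<^esub>} \<noteq> carrier M"
  shows "\<exists>i q. ext_nonzero_at R M N p K i \<and> q i = p \<and>
    (\<forall>j\<le>i. primeideal (q j) R \<and> saturation R N (q j) K \<noteq> carrier N) \<and> (\<forall>j<i. q j \<subset> q (Suc j))"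
  using assms(1,2)
proof (induction K rule: wf_induct_rule[OF N.wf_submodule])
  case (1 K)
  note K = 1(2) and sat = 1(3)
  show ?case
  proof (cases "\<exists>y\<in>carrier N. elem_colon R N K y = p")
    case True
    then have "ext_nonzero_at R M N p K 0" using ext_nonzero_at_0[OF K _ _ M] by blast
    then show ?thesis using p sat by (intro exI[of _ 0] exI[of _ "\<lambda>_. p"]) auto
  next
    case False
    then obtain x where x: "x \<in> p" and reg: "\<forall>n\<in>carrier N. x \<odot>\<^bsub>N\<^esub> n \<in> K \<longrightarrow> n \<in> saturation R N p K"
      using N.regular_element_exists[OF p K] by blast
    note xc = pf(1)[OF x]
    let ?K = "K <+>\<^bsub>N\<^esub> (\<odot>\<^bsub>N\<^esub>) x ` carrier N"
    note X = N.submodule_smult_image[OF xc N.carrier_is_submodule]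
    have K': "submodule ?K R N" by (rule N.submodule_set_add[OF K X])
    note sup = N.set_add_superset[OF K X]
    obtain n where n: "n \<in> carrier N" "n \<notin> saturation R N p K" using sat by (auto simp: saturation_def)
    \<comment> \<open>This gives the strict inclusion for the induction: \<open>x n\<close> would
      lie in \<open>K\<close> only if \<open>n\<close> were killed at \<open>p\<close>.\<close>
    then have "x \<odot>\<^bsub>N\<^esub> n \<notin> K" using reg by blast
    moreover have "x \<odot>\<^bsub>N\<^esub> n \<in> ?K" using sup(2) n(1) by blast
    ultimately have "K \<subset> ?K" using sup(1) by blast
    then obtain i q where E: "ext_nonzero_at R M N p ?K i" and qi: "q i = p"
      and q: "\<And>j. j \<le> i \<Longrightarrow> primeideal (q j) R" "\<And>j. j \<le> i \<Longrightarrow> saturation R N (q j) ?K \<noteq> carrier N"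
      and chain: "\<forall>j<i. q j \<subset> q (Suc j)"
      using 1(1)[of ?K] K K' N.saturation_add_smult[OF p K x sat] by blast
    have sat_mono: "saturation R N q K \<subseteq> saturation R N q ?K" "saturation R N q K \<subseteq> carrier N"
      "saturation R N q ?K \<subseteq> carrier N" for q
      using sup(1) unfolding saturation_def by blast+
    have qK: "saturation R N (q j) K \<noteq> carrier N" if "j \<le> i" for j
      using q(2)[OF that] sat_mono by blast
    consider "ext_nonzero_at R M N p K i" | "ext_nonzero_at R M N p K (Suc i)"
      using ext_nonzero_at_step[OF K xc reg E] by blast
    then show ?thesis
    proof cases
      case 1
      then show ?thesis using qi q(1) qK chain by blast
    next
      case 2
      have "q j \<subseteq> q i" if "j \<le> i" for j
        using that chain by (induction rule: inc_induct) auto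
      then have q0p: "q 0 \<subseteq> p" using qi by auto
      obtain l where l: "l \<in> carrier N" "l \<notin> saturation R N (q 0) K"
        using qK[of 0] by (auto simp: saturation_def)
      \<comment> \<open>The new lowest prime is an associated prime of \<open>N/K\<close> inside
        \<open>q 0\<close>. It omits \<open>x\<close>, because \<open>y\<close> survives at
        \<open>p\<close> and \<open>x\<close> is regular there. But \<open>q 0\<close> contains
        \<open>x\<close>, since otherwise \<open>N/(K + xN)\<close> would vanish at
        \<open>q 0\<close>.\<close>
      obtain y where y: "y \<in> carrier N" "primeideal (elem_colon R N K y) R" "elem_colon R N K y \<subseteq> q 0"
        using N.associated_prime_exists[OF q(1)[of 0] K l] by (metis zero_le)
      have "y \<notin> saturation R N p K"
        using y(3) q0p by (auto simp: saturation_def elem_colon_def)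
      then have xy: "x \<notin> elem_colon R N K y" using reg y(1) by (auto simp: elem_colon_def)
      have "x \<in> q 0"
      proof (rule ccontr)
        assume "x \<notin> q 0"
        then have "n \<in> saturation R N (q 0) ?K" if "n \<in> carrier N" for n
          using that xc sup(2) by (auto simp: saturation_def)
        then show False using q(2)[of 0] sat_mono(3) by blast
      qed
      with xy y(3) have sub: "elem_colon R N K y \<subset> q 0" by blast
      have "y \<notin> saturation R N (elem_colon R N K y) K" by (auto simp: saturation_def elem_colon_def)
      then have "saturation R N (elem_colon R N K y) K \<noteq> carrier N" using y(1) by blast
      \<comment> \<open>\<open>case_nat\<close> puts the new prime at index 0 and shifts
        \<open>q\<close> by one, so \<open>p\<close> moves to index \<open>Suc i\<close>, the new
        degree.\<close>
      with 2 sub chain qi q(1) qK y(2) show ?thesis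
        by (intro exI[of _ "Suc i"] exI[of _ "case_nat (elem_colon R N K y) q"])
          (auto split: nat.split simp: less_Suc_eq_0_disj)
    qed
  qed
qed

end

section \<open>Supports\<close>

lemma image_eq_singleton_iff: "b \<in> X \<Longrightarrow> f ` X = {f b} \<longleftrightarrow> (\<forall>a\<in>X. f a = f b)"
  by blast

context Module.module begin

text \<open>A fraction with numerator \<open>x\<close> is zero iff some element outside
  \<open>p\<close> kills \<open>x\<close>; once \<open>fraction_rel\<close> is an equivalence, this
  is a comparison of each class with that of \<open>(0, 1)\<close>.\<close>

lemma Supp_iff:
  "p \<in> Supp R M \<longleftrightarrow> primeideal p R \<and> (\<exists>x\<in>carrier M. \<forall>s\<in>carrier R - p. s \<odot>\<^bsub>M\<^esub> x \<noteq> \<zero>\<^bsub>M\<^esub>)"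
proof (cases "primeideal p R")
  case True
  note pf = R.primeideal_facts[OF True]
  let ?S = "carrier R - p" and ?X = "carrier M \<times> (carrier R - p)"
  let ?r = "fraction_rel R M ?S"
  have one: "\<one> \<in> ?S" using pf by auto
  have mult: "s \<otimes> t \<in> ?S" if "s \<in> ?S" "t \<in> ?S" for s t using that pf(8) by auto
  have comm: "a \<odot>\<^bsub>M\<^esub> (b \<odot>\<^bsub>M\<^esub> x) = b \<odot>\<^bsub>M\<^esub> (a \<odot>\<^bsub>M\<^esub> x)" if "a \<in> carrier R" "b \<in> carrier R" "x \<in> carrier M" for a b x
    using that by (simp flip: smult_assoc1 add: R.m_comm)
  have "trans ?r"
  proof (rule transI, clarify)
    fix x s y t z u assume "((x, s), (y, t)) \<in> ?r" "((y, t), (z, u)) \<in> ?r"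
    then obtain v w where c: "x \<in> carrier M" "y \<in> carrier M" "z \<in> carrier M" "s \<in> ?S" "t \<in> ?S" "u \<in> ?S" "v \<in> ?S" "w \<in> ?S"
      and v: "v \<odot>\<^bsub>M\<^esub> (t \<odot>\<^bsub>M\<^esub> x) = v \<odot>\<^bsub>M\<^esub> (s \<odot>\<^bsub>M\<^esub> y)" and w: "w \<odot>\<^bsub>M\<^esub> (u \<odot>\<^bsub>M\<^esub> y) = w \<odot>\<^bsub>M\<^esub> (t \<odot>\<^bsub>M\<^esub> z)"
      by (auto simp: fraction_rel_def)
    have r: "s \<in> carrier R" "t \<in> carrier R" "u \<in> carrier R" "v \<in> carrier R" "w \<in> carrier R" using c by auto
    \<comment> \<open>The multiplier contains the middle denominator \<open>t\<close>, which cannot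
      be cancelled.\<close>
    have "(v \<otimes> w \<otimes> t) \<odot>\<^bsub>M\<^esub> (u \<odot>\<^bsub>M\<^esub> x) = (w \<otimes> u) \<odot>\<^bsub>M\<^esub> (v \<odot>\<^bsub>M\<^esub> (t \<odot>\<^bsub>M\<^esub> x))"
      using r c by (simp flip: smult_assoc1 add: R.m_ac)
    also have "\<dots> = (v \<otimes> s) \<odot>\<^bsub>M\<^esub> (w \<odot>\<^bsub>M\<^esub> (u \<odot>\<^bsub>M\<^esub> y))"
      unfolding v using r c by (simp flip: smult_assoc1 add: R.m_ac)
    also have "\<dots> = (v \<otimes> w \<otimes> t) \<odot>\<^bsub>M\<^esub> (s \<odot>\<^bsub>M\<^esub> z)"
      unfolding w using r c by (simp flip: smult_assoc1 add: R.m_ac)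
    finally show "((x, s), (z, u)) \<in> ?r"
      using c mult[OF mult, of v w t] by (auto simp: fraction_rel_def)
  qed
  moreover have "refl_on ?X ?r" "sym ?r" "?r \<subseteq> ?X \<times> ?X"
    using one by (auto simp: fraction_rel_def refl_on_def sym_def intro: sym)
  ultimately have eq: "equiv ?X ?r" by (intro equivI) auto
  have z: "\<zero>\<^bsub>localization R M p\<^esub> = ?r `` {(\<zero>\<^bsub>M\<^esub>, \<one>)}" "carrier (localization R M p) = ?X // ?r"
    by (simp_all add: localization_def Let_def)
  have zX: "(\<zero>\<^bsub>M\<^esub>, \<one>) \<in> ?X" using one by auto
  have "carrier (localization R M p) = {\<zero>\<^bsub>localization R M p\<^esub>} \<longleftrightarrow> (\<forall>a\<in>?X. ?r `` {a} = ?r `` {(\<zero>\<^bsub>M\<^esub>, \<one>)})"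
  proof -
    have "?X // ?r = (\<lambda>a. ?r `` {a}) ` ?X" by (auto simp: quotient_def)
    then show ?thesis unfolding z using image_eq_singleton_iff[OF zX, of "\<lambda>a. ?r `` {a}"] by simp
  qed
  also have "\<dots> \<longleftrightarrow> (\<forall>a\<in>?X. (a, (\<zero>\<^bsub>M\<^esub>, \<one>)) \<in> ?r)"
    using eq_equiv_class_iff[OF eq _ zX] by auto
  also have "\<dots> \<longleftrightarrow> (\<forall>x\<in>carrier M. \<exists>t\<in>?S. t \<odot>\<^bsub>M\<^esub> x = \<zero>\<^bsub>M\<^esub>)"
    using one by (auto simp: fraction_rel_def)
  finally show ?thesis using True by (auto simp: Supp_def)
qed (simp add: Supp_def)

section \<open>Quotient modules and their supports\<close>

lemma quotient_module_simps:
  assumes H: "submodule H R M"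
  shows "carrier (quotient_module M H) = (\<lambda>x. H +>\<^bsub>M\<^esub> x) ` carrier M"
    "\<zero>\<^bsub>quotient_module M H\<^esub> = H"
    "x \<in> carrier M \<Longrightarrow> y \<in> carrier M \<Longrightarrow> (H +>\<^bsub>M\<^esub> x) \<oplus>\<^bsub>quotient_module M H\<^esub> (H +>\<^bsub>M\<^esub> y) = H +>\<^bsub>M\<^esub> (x \<oplus>\<^bsub>M\<^esub> y)"
    "a \<in> carrier R \<Longrightarrow> x \<in> carrier M \<Longrightarrow> a \<odot>\<^bsub>quotient_module M H\<^esub> (H +>\<^bsub>M\<^esub> x) = H +>\<^bsub>M\<^esub> (a \<odot>\<^bsub>M\<^esub> x)"
    "x \<in> carrier M \<Longrightarrow> H +>\<^bsub>M\<^esub> x = H \<longleftrightarrow> x \<in> H"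
proof -
  have "subgroup H (add_monoid M)" using H by (simp add: submodule_def)
  then have "additive_subgroup H M" by (rule additive_subgroupI)
  then interpret H: abelian_subgroup H M by (rule abelian_subgroupI3) (rule M.abelian_group_axioms)
  show "carrier (quotient_module M H) = (\<lambda>x. H +>\<^bsub>M\<^esub> x) ` carrier M"
    by (auto simp: quotient_module_def A_RCOSETS_def' )
  show "\<zero>\<^bsub>quotient_module M H\<^esub> = H" by (simp add: quotient_module_def)
  show "(H +>\<^bsub>M\<^esub> x) \<oplus>\<^bsub>quotient_module M H\<^esub> (H +>\<^bsub>M\<^esub> y) = H +>\<^bsub>M\<^esub> (x \<oplus>\<^bsub>M\<^esub> y)"
    if "x \<in> carrier M" "y \<in> carrier M"
    using H.a_rcos_sum[OF that] by (simp add: quotient_module_def)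
  show mem: "H +>\<^bsub>M\<^esub> x = H \<longleftrightarrow> x \<in> H" if "x \<in> carrier M" for x
    using H.a_rcos_const H.a_rcos_self[OF that] by blast
  show "a \<odot>\<^bsub>quotient_module M H\<^esub> (H +>\<^bsub>M\<^esub> x) = H +>\<^bsub>M\<^esub> (a \<odot>\<^bsub>M\<^esub> x)" if a: "a \<in> carrier R" and x: "x \<in> carrier M"
  proof -
    \<comment> \<open>Scalar multiplication is defined as a union over all representatives of a
      coset; each of them contributes the same coset.\<close>
    have "H +>\<^bsub>M\<^esub> (a \<odot>\<^bsub>M\<^esub> y) = H +>\<^bsub>M\<^esub> (a \<odot>\<^bsub>M\<^esub> x)" if y: "y \<in> H +>\<^bsub>M\<^esub> x" for y
    proof -
      from y obtain h where h: "h \<in> H" "y = h \<oplus>\<^bsub>M\<^esub> x" by (auto simp: a_r_coset_def')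
      then have "a \<odot>\<^bsub>M\<^esub> y = a \<odot>\<^bsub>M\<^esub> h \<oplus>\<^bsub>M\<^esub> a \<odot>\<^bsub>M\<^esub> x" "a \<odot>\<^bsub>M\<^esub> h \<in> H"
        using submodule_carrierD[OF H] submoduleE(4)[OF H] a x by (auto simp: smult_r_distr)
      then have "a \<odot>\<^bsub>M\<^esub> y \<in> H +>\<^bsub>M\<^esub> (a \<odot>\<^bsub>M\<^esub> x)" by (auto simp: a_r_coset_def')
      from H.a_repr_independence'[OF this smult_closed[OF a x]] show ?thesis ..
    qed
    then have "(\<Union>y\<in>H +>\<^bsub>M\<^esub> x. H +>\<^bsub>M\<^esub> (a \<odot>\<^bsub>M\<^esub> y)) = (\<Union>y\<in>H +>\<^bsub>M\<^esub> x. H +>\<^bsub>M\<^esub> (a \<odot>\<^bsub>M\<^esub> x))"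
      by (rule SUP_cong[OF refl])
    also have "\<dots> = H +>\<^bsub>M\<^esub> (a \<odot>\<^bsub>M\<^esub> x)" using H.a_rcos_self[OF x] by blast
    finally show ?thesis by (simp only: quotient_module_def module.select_convs)
  qed
qed

lemma quotient_module_is_module:
  assumes H: "submodule H R M" shows "Module.module R (quotient_module M H)"
proof (rule moduleI[OF R.is_cring])
  note q = quotient_module_simps[OF H]
  show "abelian_group (quotient_module M H)"
  proof (rule abelian_groupI)
    have H0: "H = H +>\<^bsub>M\<^esub> \<zero>\<^bsub>M\<^esub>" using q(5) submodule_zero[OF H] by auto
    show "\<zero>\<^bsub>quotient_module M H\<^esub> \<in> carrier (quotient_module M H)"
      using H0 by (auto simp: q(1,2))
    fix x assume x: "x \<in> carrier (quotient_module M H)"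
    then obtain y where y: "y \<in> carrier M" "x = H +>\<^bsub>M\<^esub> y" by (auto simp: q(1))
    show "\<zero>\<^bsub>quotient_module M H\<^esub> \<oplus>\<^bsub>quotient_module M H\<^esub> x = x"
      using q(3)[OF M.zero_closed y(1)] y H0 by (simp add: q(2))
    have "(H +>\<^bsub>M\<^esub> \<ominus>\<^bsub>M\<^esub> y) \<oplus>\<^bsub>quotient_module M H\<^esub> x = \<zero>\<^bsub>quotient_module M H\<^esub>"
      using y H0 by (simp add: q(2,3) M.l_neg)
    then show "\<exists>y\<in>carrier (quotient_module M H). y \<oplus>\<^bsub>quotient_module M H\<^esub> x = \<zero>\<^bsub>quotient_module M H\<^esub>"
      using y by (auto simp: q(1))
  qed (auto simp: q(1,3) M.a_ac)
qed (auto simp: quotient_module_simps[OF H] smult_l_distr smult_r_distr smult_assoc1)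

lemma Supp_quotient_module:
  assumes H: "submodule H R M"
  shows "p \<in> Supp R (quotient_module M H) \<longleftrightarrow>
    primeideal p R \<and> (\<exists>x\<in>carrier M. \<forall>s\<in>carrier R - p. s \<odot>\<^bsub>M\<^esub> x \<notin> H)"
  unfolding module.Supp_iff[OF quotient_module_is_module[OF H]]
  by (auto simp: quotient_module_simps[OF H])

lemma Supp_saturation:
  assumes "primeideal p R" shows "p \<in> Supp R M \<longleftrightarrow> saturation R M p {\<zero>\<^bsub>M\<^esub>} \<noteq> carrier M"
  using assms unfolding Supp_iff saturation_def by blast

section \<open>Modules of homomorphisms\<close>

lemma hom_module_simps:
  "\<phi> \<in> carrier (hom_module R X M) \<longleftrightarrow> linear_map R X M \<phi> \<and> \<phi> \<in> extensional (carrier X)"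
  "\<zero>\<^bsub>hom_module R X M\<^esub> = (\<lambda>x\<in>carrier X. \<zero>\<^bsub>M\<^esub>)"
  "\<phi> \<oplus>\<^bsub>hom_module R X M\<^esub> \<psi> = (\<lambda>x\<in>carrier X. \<phi> x \<oplus>\<^bsub>M\<^esub> \<psi> x)"
  "a \<odot>\<^bsub>hom_module R X M\<^esub> \<phi> = (\<lambda>x\<in>carrier X. a \<odot>\<^bsub>M\<^esub> \<phi> x)"
  by (auto simp: hom_module_def linear_map_def PiE_iff)

lemma hom_module_closed:
  "\<phi> \<in> carrier (hom_module R X M) \<Longrightarrow> x \<in> carrier X \<Longrightarrow> \<phi> x \<in> carrier M"
  by (auto simp: hom_module_simps linear_map_def)

lemma linear_map_restrict:
  assumes "Module.module R X" shows "linear_map R X M (restrict \<phi> (carrier X)) \<longleftrightarrow> linear_map R X M \<phi>"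
proof -
  interpret X: Module.module R X by fact
  show ?thesis by (simp add: linear_map_def Pi_def)
qed

lemma linear_map_add:
  assumes u: "linear_map R X M u" and v: "linear_map R X M v"
  shows "linear_map R X M (\<lambda>x. u x \<oplus>\<^bsub>M\<^esub> v x)"
  using linear_mapD[OF u] linear_mapD[OF v]
  by (auto simp: linear_map_def smult_r_distr M.a_ac)

lemma hom_module_is_module:
  assumes X: "Module.module R X" shows "Module.module R (hom_module R X M)"
proof (rule moduleI[OF R.is_cring])
  note restr = linear_map_restrict[OF X]
  show "abelian_group (hom_module R X M)"
  proof (rule abelian_groupI)
    fix f g assume f: "f \<in> carrier (hom_module R X M)" and g: "g \<in> carrier (hom_module R X M)"
    then show "f \<oplus>\<^bsub>hom_module R X M\<^esub> g \<in> carrier (hom_module R X M)"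
      by (simp add: hom_module_simps restr linear_map_add)
    show "f \<oplus>\<^bsub>hom_module R X M\<^esub> g = g \<oplus>\<^bsub>hom_module R X M\<^esub> f"
      using hom_module_closed[OF f] hom_module_closed[OF g] unfolding hom_module_simps
      by (intro restrict_ext) (simp add: M.a_comm)
    fix h assume h: "h \<in> carrier (hom_module R X M)"
    show "f \<oplus>\<^bsub>hom_module R X M\<^esub> g \<oplus>\<^bsub>hom_module R X M\<^esub> h = f \<oplus>\<^bsub>hom_module R X M\<^esub> (g \<oplus>\<^bsub>hom_module R X M\<^esub> h)"
      using hom_module_closed[OF f] hom_module_closed[OF g] hom_module_closed[OF h] unfolding hom_module_simps
      by (intro restrict_ext) (simp add: M.a_assoc)
  next
    show "\<zero>\<^bsub>hom_module R X M\<^esub> \<in> carrier (hom_module R X M)"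
      by (simp add: hom_module_simps restr linear_map_zero_map[OF X])
  next
    fix f assume f: "f \<in> carrier (hom_module R X M)"
    show "\<zero>\<^bsub>hom_module R X M\<^esub> \<oplus>\<^bsub>hom_module R X M\<^esub> f = f"
      using f hom_module_closed[OF f] unfolding hom_module_simps
      by (intro extensionalityI[of _ "carrier X"]) simp_all
    have inv: "(\<ominus> \<one>) \<odot>\<^bsub>hom_module R X M\<^esub> f \<in> carrier (hom_module R X M)"
      using f by (simp add: hom_module_simps restr linear_map_smult)
    have l_inv: "(\<ominus> \<one>) \<odot>\<^bsub>hom_module R X M\<^esub> f \<oplus>\<^bsub>hom_module R X M\<^esub> f = \<zero>\<^bsub>hom_module R X M\<^esub>"
      using hom_module_closed[OF f] unfolding hom_module_simps
      by (intro restrict_ext) (simp add: smult_l_minus M.l_neg)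
    show "\<exists>g\<in>carrier (hom_module R X M). g \<oplus>\<^bsub>hom_module R X M\<^esub> f = \<zero>\<^bsub>hom_module R X M\<^esub>"
      using inv l_inv by (intro bexI[of _ "(\<ominus> \<one>) \<odot>\<^bsub>hom_module R X M\<^esub> f"])
  qed
  fix a f assume a: "a \<in> carrier R" and f: "f \<in> carrier (hom_module R X M)"
  then show "a \<odot>\<^bsub>hom_module R X M\<^esub> f \<in> carrier (hom_module R X M)"
    by (simp add: hom_module_simps restr linear_map_smult)
  show "(a \<oplus> b) \<odot>\<^bsub>hom_module R X M\<^esub> f = a \<odot>\<^bsub>hom_module R X M\<^esub> f \<oplus>\<^bsub>hom_module R X M\<^esub> b \<odot>\<^bsub>hom_module R X M\<^esub> f"
    if "b \<in> carrier R" for b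
    using a that hom_module_closed[OF f] unfolding hom_module_simps
    by (intro restrict_ext) (simp add: smult_l_distr)
  show "(a \<otimes> b) \<odot>\<^bsub>hom_module R X M\<^esub> f = a \<odot>\<^bsub>hom_module R X M\<^esub> (b \<odot>\<^bsub>hom_module R X M\<^esub> f)"
    if "b \<in> carrier R" for b
    using a that hom_module_closed[OF f] unfolding hom_module_simps
    by (intro restrict_ext) (simp add: smult_assoc1)
  show "a \<odot>\<^bsub>hom_module R X M\<^esub> (f \<oplus>\<^bsub>hom_module R X M\<^esub> g) =
      a \<odot>\<^bsub>hom_module R X M\<^esub> f \<oplus>\<^bsub>hom_module R X M\<^esub> a \<odot>\<^bsub>hom_module R X M\<^esub> g"
    if "g \<in> carrier (hom_module R X M)" for g
    using a hom_module_closed[OF f] hom_module_closed[OF that] unfolding hom_module_simps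
    by (intro restrict_ext) (simp add: smult_r_distr)
next
  fix f assume f: "f \<in> carrier (hom_module R X M)"
  then show "\<one> \<odot>\<^bsub>hom_module R X M\<^esub> f = f"
    using hom_module_closed[OF f] unfolding hom_module_simps
    by (intro extensionalityI[of _ "carrier X"]) simp_all
qed

end

section \<open>Ext of the standard resolution\<close>

context Module.module begin

lemma submoduleI':
  assumes "H \<subseteq> carrier M" "\<zero>\<^bsub>M\<^esub> \<in> H"
    and "\<And>a b. a \<in> H \<Longrightarrow> b \<in> H \<Longrightarrow> a \<oplus>\<^bsub>M\<^esub> b \<in> H"
    and smult: "\<And>a x. a \<in> carrier R \<Longrightarrow> x \<in> H \<Longrightarrow> a \<odot>\<^bsub>M\<^esub> x \<in> H"
  shows "submodule H R M"
proof (rule submoduleI)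
  fix a assume a: "a \<in> H"
  then have "(\<ominus> \<one>) \<odot>\<^bsub>M\<^esub> a = \<ominus>\<^bsub>M\<^esub> a" using assms(1) by (simp add: smult_l_minus subset_iff)
  then show "\<ominus>\<^bsub>M\<^esub> a \<in> H" using smult[of "\<ominus> \<one>" a] a by simp
qed (use assms in auto)

lemma eq_iff_minus_eq_zero:
  assumes "x \<in> carrier M" "y \<in> carrier M" shows "x \<ominus>\<^bsub>M\<^esub> y = \<zero>\<^bsub>M\<^esub> \<longleftrightarrow> x = y"
  using mem_submodule_cong[OF submodule_zero_set, of "x \<ominus>\<^bsub>M\<^esub> y" "\<zero>\<^bsub>M\<^esub>"] assms
  by (metis M.minus_equality M.minus_minus M.a_inv_closed a_minus_def minus_self)

end

context module_pair begin

lemma coboundary_maps_zero: "(\<lambda>_. \<zero>\<^bsub>N\<^esub>) \<in> coboundary_maps R M N i"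
  using N.linear_map_zero_map[OF resolution(1)]
  by (auto simp: coboundary_maps_def split: nat.split intro!: exI[of _ "\<lambda>_. \<zero>\<^bsub>N\<^esub>"])

lemma coboundary_maps_add:
  assumes "\<theta> \<in> coboundary_maps R M N i" "\<theta>' \<in> coboundary_maps R M N i"
  shows "(\<lambda>f. \<theta> f \<oplus>\<^bsub>N\<^esub> \<theta>' f) \<in> coboundary_maps R M N i"
proof (cases i)
  case 0
  then show ?thesis using assms by (simp add: coboundary_maps_def)
next
  case (Suc j)
  then obtain \<psi> \<psi>' where "linear_map R (F j) N \<psi>" "\<theta> = (\<lambda>f. \<psi> (d j f))"
    "linear_map R (F j) N \<psi>'" "\<theta>' = (\<lambda>f. \<psi>' (d j f))"
    using assms by (auto simp: coboundary_maps_def)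
  with Suc N.linear_map_add[of "F j" \<psi> \<psi>'] show ?thesis
    by (auto simp: coboundary_maps_def intro!: exI[of _ "\<lambda>f. \<psi> f \<oplus>\<^bsub>N\<^esub> \<psi>' f"])
qed

lemma coboundary_maps_smult:
  assumes "\<theta> \<in> coboundary_maps R M N i" "a \<in> carrier R"
  shows "(\<lambda>f. a \<odot>\<^bsub>N\<^esub> \<theta> f) \<in> coboundary_maps R M N i"
proof (cases i)
  case 0
  then show ?thesis using assms by (simp add: coboundary_maps_def)
next
  case (Suc j)
  then obtain \<psi> where "linear_map R (F j) N \<psi>" "\<theta> = (\<lambda>f. \<psi> (d j f))"
    using assms by (auto simp: coboundary_maps_def)
  with Suc N.linear_map_smult[of "F j" \<psi> a] assms(2) show ?thesis
    by (auto simp: coboundary_maps_def intro!: exI[of _ "\<lambda>f. a \<odot>\<^bsub>N\<^esub> \<psi> f"])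
qed

section \<open>Cocycles and coboundaries as modules\<close>

abbreviation "C i \<equiv> hom_module R (F i) N"

lemma C_is_module: "Module.module R (C i)"
  by (rule N.hom_module_is_module[OF resolution(1)])

lemma ext_cocycles_iff:
  "\<phi> \<in> ext_cocycles R M N i \<longleftrightarrow>
    \<phi> \<in> carrier (C i) \<and> (\<forall>f\<in>carrier (F (Suc i)). \<phi> (d i f) = \<zero>\<^bsub>N\<^esub>)"
  by (auto simp: ext_cocycles_def ext_coboundary_map_def N.hom_module_simps compose_def restrict_def fun_eq_iff)

lemma ext_coboundaries_iff:
  "\<phi> \<in> ext_coboundaries R M N i \<longleftrightarrow> (\<exists>\<theta>\<in>coboundary_maps R M N i. \<phi> = restrict \<theta> (carrier (F i)))"
proof (cases i)
  case 0
  then show ?thesis by (simp add: coboundary_maps_def N.hom_module_simps restrict_def)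
next
  case (Suc j)
  have "\<phi> \<in> ext_coboundaries R M N i \<longleftrightarrow>
      (\<exists>\<psi>\<in>carrier (C j). \<phi> = restrict (\<lambda>f. \<psi> (d j f)) (carrier (F i)))"
    by (auto simp: Suc ext_coboundary_map_def compose_def)
  also have "\<dots> \<longleftrightarrow> (\<exists>\<psi>. linear_map R (F j) N \<psi> \<and> \<phi> = restrict (\<lambda>f. \<psi> (d j f)) (carrier (F i)))"
  proof
    assume "\<exists>\<psi>. linear_map R (F j) N \<psi> \<and> \<phi> = restrict (\<lambda>f. \<psi> (d j f)) (carrier (F i))"
    then obtain \<psi> where \<psi>: "linear_map R (F j) N \<psi>" "\<phi> = restrict (\<lambda>f. \<psi> (d j f)) (carrier (F i))" by blast
    \<comment> \<open>\<open>\<psi>\<close> is evaluated only on the image of the differential,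
      inside \<open>F j\<close>, so restricting it there changes nothing.\<close>
    have "\<phi> = restrict (\<lambda>f. restrict \<psi> (carrier (F j)) (d j f)) (carrier (F i))"
      unfolding \<psi>(2) by (rule restrict_ext) (use d_closed Suc in simp)
    moreover have "restrict \<psi> (carrier (F j)) \<in> carrier (C j)"
      using \<psi>(1) by (simp add: N.hom_module_simps N.linear_map_restrict[OF resolution(1)])
    ultimately show "\<exists>\<psi>\<in>carrier (C j). \<phi> = restrict (\<lambda>f. \<psi> (d j f)) (carrier (F i))" by (rule bexI)
  qed (auto simp: N.hom_module_simps)
  also have "\<dots> \<longleftrightarrow> (\<exists>\<theta>\<in>coboundary_maps R M N i. \<phi> = restrict \<theta> (carrier (F i)))"
    by (auto simp: coboundary_maps_def Suc)
  finally show ?thesis .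
qed

lemma submodule_ext_cocycles: "submodule (ext_cocycles R M N i) R (C i)"
proof -
  interpret C: Module.module R "C i" by (rule C_is_module)
  show ?thesis
  proof (rule C.submoduleI')
    show "\<zero>\<^bsub>C i\<^esub> \<in> ext_cocycles R M N i"
      using C.M.zero_closed by (simp add: ext_cocycles_iff N.hom_module_simps(2) d_closed)
  next
    fix a b assume ab: "a \<in> ext_cocycles R M N i" "b \<in> ext_cocycles R M N i"
    then have "a \<oplus>\<^bsub>C i\<^esub> b \<in> carrier (C i)" by (intro C.M.a_closed) (auto simp: ext_cocycles_iff)
    then show "a \<oplus>\<^bsub>C i\<^esub> b \<in> ext_cocycles R M N i"
      using ab by (simp add: ext_cocycles_iff N.hom_module_simps(3) d_closed)
  next
    fix a \<phi> assume a: "a \<in> carrier R" and \<phi>: "\<phi> \<in> ext_cocycles R M N i"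
    then have "a \<odot>\<^bsub>C i\<^esub> \<phi> \<in> carrier (C i)" by (intro C.smult_closed) (auto simp: ext_cocycles_iff)
    then show "a \<odot>\<^bsub>C i\<^esub> \<phi> \<in> ext_cocycles R M N i"
      using a \<phi> by (simp add: ext_cocycles_iff N.hom_module_simps(4) d_closed)
  qed (auto simp: ext_cocycles_iff)
qed

abbreviation "Z i \<equiv> (C i)\<lparr>carrier := ext_cocycles R M N i\<rparr>"

lemma Z_is_module: "Module.module R (Z i)"
  by (rule submodule.submodule_is_module[OF submodule_ext_cocycles C_is_module])

lemma submodule_ext_coboundaries: "submodule (ext_coboundaries R M N i) R (Z i)"
proof -
  interpret Z: Module.module R "Z i" by (rule Z_is_module)
  show ?thesis
  proof (rule Z.submoduleI')
    show "ext_coboundaries R M N i \<subseteq> carrier (Z i)"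
    proof
      fix \<phi> assume "\<phi> \<in> ext_coboundaries R M N i"
      then obtain \<theta> where \<theta>: "\<theta> \<in> coboundary_maps R M N i" "\<phi> = restrict \<theta> (carrier (F i))"
        by (auto simp: ext_coboundaries_iff)
      show "\<phi> \<in> carrier (Z i)"
        using coboundary_maps_d[OF \<theta>(1)] coboundary_maps_linear[OF \<theta>(1)] d_closed
        by (simp add: \<theta>(2) ext_cocycles_iff N.hom_module_simps N.linear_map_restrict[OF resolution(1)])
    qed
    show "\<zero>\<^bsub>Z i\<^esub> \<in> ext_coboundaries R M N i"
      using coboundary_maps_zero by (auto simp: ext_coboundaries_iff N.hom_module_simps)
    show "a \<oplus>\<^bsub>Z i\<^esub> b \<in> ext_coboundaries R M N i"
      if "a \<in> ext_coboundaries R M N i" "b \<in> ext_coboundaries R M N i" for a b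
    proof -
      from that obtain \<theta> \<theta>' where \<theta>: "\<theta> \<in> coboundary_maps R M N i" "a = restrict \<theta> (carrier (F i))"
        "\<theta>' \<in> coboundary_maps R M N i" "b = restrict \<theta>' (carrier (F i))"
        by (auto simp: ext_coboundaries_iff)
      have "a \<oplus>\<^bsub>Z i\<^esub> b = restrict (\<lambda>f. \<theta> f \<oplus>\<^bsub>N\<^esub> \<theta>' f) (carrier (F i))"
        using \<theta>(2,4) by (simp add: N.hom_module_simps) (rule restrict_ext, simp)
      then show ?thesis using coboundary_maps_add[OF \<theta>(1,3)] unfolding ext_coboundaries_iff by (rule bexI)
    qed
    show "a \<odot>\<^bsub>Z i\<^esub> b \<in> ext_coboundaries R M N i"
      if a: "a \<in> carrier R" and "b \<in> ext_coboundaries R M N i" for a b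
    proof -
      from that obtain \<theta> where \<theta>: "\<theta> \<in> coboundary_maps R M N i" "b = restrict \<theta> (carrier (F i))"
        by (auto simp: ext_coboundaries_iff)
      have "a \<odot>\<^bsub>Z i\<^esub> b = restrict (\<lambda>f. a \<odot>\<^bsub>N\<^esub> \<theta> f) (carrier (F i))"
        using \<theta>(2) by (simp add: N.hom_module_simps) (rule restrict_ext, simp)
      then show ?thesis using coboundary_maps_smult[OF \<theta>(1) a] unfolding ext_coboundaries_iff by (rule bexI)
    qed
  qed
qed

lemma smult_Z: "a \<odot>\<^bsub>Z i\<^esub> \<phi> = (\<lambda>f\<in>carrier (F i). a \<odot>\<^bsub>N\<^esub> \<phi> f)"
  by (simp add: N.hom_module_simps)

text \<open>The bridge between the Ext modules and cochains, with zero as \<open>K\<close>: for a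
  quotient, surviving at \<open>p\<close> means that no \<open>s\<close> outside \<open>p\<close>
  carries a cocycle into the coboundaries. The rest is the passage between linear maps and their
  extensional restrictions.\<close>

lemma Supp_Ext:
  "p \<in> Supp R (Ext R M N i) \<longleftrightarrow> primeideal p R \<and> ext_nonzero_at R M N p {\<zero>\<^bsub>N\<^esub>} i"
proof -
  interpret Z: Module.module R "Z i" by (rule Z_is_module)
  have eq: "s \<odot>\<^bsub>Z i\<^esub> \<phi> = restrict \<theta> (carrier (F i)) \<longleftrightarrow>
      (\<forall>f\<in>carrier (F i). s \<odot>\<^bsub>N\<^esub> \<phi> f \<ominus>\<^bsub>N\<^esub> \<theta> f \<in> {\<zero>\<^bsub>N\<^esub>})"
    if "s \<in> carrier R" "linear_map R (F i) N \<phi>" "\<theta> \<in> coboundary_maps R M N i" for s \<phi> \<theta>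
  proof -
    have "s \<odot>\<^bsub>N\<^esub> \<phi> f \<ominus>\<^bsub>N\<^esub> \<theta> f \<in> {\<zero>\<^bsub>N\<^esub>} \<longleftrightarrow> s \<odot>\<^bsub>N\<^esub> \<phi> f = \<theta> f" if "f \<in> carrier (F i)" for f
      using N.eq_iff_minus_eq_zero linear_mapD(1)[OF \<open>linear_map R (F i) N \<phi>\<close> that]
        linear_mapD(1)[OF coboundary_maps_linear[OF \<open>\<theta> \<in> _\<close>] that] \<open>s \<in> carrier R\<close> by auto
    then show ?thesis unfolding smult_Z by (auto simp: fun_eq_iff restrict_def)
  qed
  have "p \<in> Supp R (Ext R M N i) \<longleftrightarrow> primeideal p R \<and>
      (\<exists>\<phi>\<in>carrier (Z i). \<forall>s\<in>carrier R - p. s \<odot>\<^bsub>Z i\<^esub> \<phi> \<notin> ext_coboundaries R M N i)"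
    unfolding Ext_def by (rule Z.Supp_quotient_module[OF submodule_ext_coboundaries])
  also have "(\<exists>\<phi>\<in>carrier (Z i). \<forall>s\<in>carrier R - p. s \<odot>\<^bsub>Z i\<^esub> \<phi> \<notin> ext_coboundaries R M N i) \<longleftrightarrow>
      ext_nonzero_at R M N p {\<zero>\<^bsub>N\<^esub>} i"
  proof
    assume "\<exists>\<phi>\<in>carrier (Z i). \<forall>s\<in>carrier R - p. s \<odot>\<^bsub>Z i\<^esub> \<phi> \<notin> ext_coboundaries R M N i"
    then obtain \<phi> where \<phi>: "\<phi> \<in> ext_cocycles R M N i"
      "\<And>s. s \<in> carrier R - p \<Longrightarrow> s \<odot>\<^bsub>Z i\<^esub> \<phi> \<notin> ext_coboundaries R M N i" by auto
    then have lin: "linear_map R (F i) N \<phi>" by (simp add: ext_cocycles_iff N.hom_module_simps)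
    have nz: "\<exists>f\<in>carrier (F i). s \<odot>\<^bsub>N\<^esub> \<phi> f \<ominus>\<^bsub>N\<^esub> \<theta> f \<notin> {\<zero>\<^bsub>N\<^esub>}"
      if s: "s \<in> carrier R - p" and \<theta>: "\<theta> \<in> coboundary_maps R M N i" for s \<theta>
    proof -
      have "s \<odot>\<^bsub>Z i\<^esub> \<phi> \<noteq> restrict \<theta> (carrier (F i))"
        using \<phi>(2)[OF s] \<theta> unfolding ext_coboundaries_iff by (auto simp only: bex_simps)
      then show ?thesis using eq[OF _ lin \<theta>, of s] s by blast
    qed
    have "\<forall>f\<in>carrier (F (Suc i)). \<phi> (d i f) \<in> {\<zero>\<^bsub>N\<^esub>}" using \<phi>(1) by (simp add: ext_cocycles_iff)
    with lin nz show "ext_nonzero_at R M N p {\<zero>\<^bsub>N\<^esub>} i"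
      unfolding ext_nonzero_at_def by (intro exI[of _ \<phi>] conjI ballI) auto
  next
    assume "ext_nonzero_at R M N p {\<zero>\<^bsub>N\<^esub>} i"
    then obtain \<phi> where lin: "linear_map R (F i) N \<phi>"
      and coc: "\<forall>f\<in>carrier (F (Suc i)). \<phi> (d i f) \<in> {\<zero>\<^bsub>N\<^esub>}"
      and nz: "\<forall>s\<in>carrier R - p. \<forall>\<theta>\<in>coboundary_maps R M N i.
        \<exists>f\<in>carrier (F i). s \<odot>\<^bsub>N\<^esub> \<phi> f \<ominus>\<^bsub>N\<^esub> \<theta> f \<notin> {\<zero>\<^bsub>N\<^esub>}"
      unfolding ext_nonzero_at_def by (elim exE conjE)
    let ?\<phi> = "restrict \<phi> (carrier (F i))"
    have "?\<phi> \<in> carrier (Z i)"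
      using lin coc by (simp add: ext_cocycles_iff N.hom_module_simps N.linear_map_restrict[OF resolution(1)] d_closed)
    moreover have "s \<odot>\<^bsub>Z i\<^esub> ?\<phi> \<notin> ext_coboundaries R M N i" if s: "s \<in> carrier R - p" for s
    proof
      assume "s \<odot>\<^bsub>Z i\<^esub> ?\<phi> \<in> ext_coboundaries R M N i"
      then obtain \<theta> where \<theta>: "\<theta> \<in> coboundary_maps R M N i" "s \<odot>\<^bsub>Z i\<^esub> ?\<phi> = restrict \<theta> (carrier (F i))"
        unfolding ext_coboundaries_iff by (elim bexE)
      have "s \<odot>\<^bsub>Z i\<^esub> ?\<phi> = s \<odot>\<^bsub>Z i\<^esub> \<phi>" unfolding smult_Z by (rule restrict_ext) simp
      then have "\<forall>f\<in>carrier (F i). s \<odot>\<^bsub>N\<^esub> \<phi> f \<ominus>\<^bsub>N\<^esub> \<theta> f \<in> {\<zero>\<^bsub>N\<^esub>}"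
        using eq[OF _ lin \<theta>(1), of s] s \<theta>(2) by (metis DiffD1)
      with nz s \<theta>(1) show False by blast
    qed
    ultimately show "\<exists>\<phi>\<in>carrier (Z i). \<forall>s\<in>carrier R - p. s \<odot>\<^bsub>Z i\<^esub> \<phi> \<notin> ext_coboundaries R M N i"
      by (intro bexI[of _ ?\<phi>] ballI)
  qed
  finally show ?thesis .
qed

text \<open>Since \<open>s\<close> kills \<open>M\<close>, multiplication by \<open>s\<close> sends
  \<open>F 0\<close> into the kernel of \<open>\<epsilon>\<close>, which is the image of
  \<open>d 0\<close>. Freeness makes the choice of preimages linear.\<close>

lemma lift_smult_0:
  assumes s: "s \<in> carrier R" and sM: "\<And>m. m \<in> carrier M \<Longrightarrow> s \<odot>\<^bsub>M\<^esub> m = \<zero>\<^bsub>M\<^esub>"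
  shows "\<exists>g. linear_map R (F 0) (F (Suc 0)) g \<and> (\<forall>f\<in>carrier (F 0). d 0 (g f) = s \<odot>\<^bsub>F 0\<^esub> f)"
proof -
  interpret F0: Module.module R "F 0" by (rule resolution(1))
  let ?u = "\<lambda>f. s \<odot>\<^bsub>F 0\<^esub> f"
  have u: "linear_map R (F 0) (F 0) ?u"
    by (rule F0.linear_map_smult[OF _ s]) (simp add: linear_map_def)
  have ex: "\<exists>y\<in>carrier (F (Suc 0)). d 0 y \<ominus>\<^bsub>F 0\<^esub> ?u f \<in> {\<zero>\<^bsub>F 0\<^esub>}" if f: "f \<in> carrier (F 0)" for f
  proof -
    have "\<epsilon> (?u f) = \<zero>\<^bsub>M\<^esub>"
      using linear_mapD(1,3)[OF std_augmentation_linear] s f sM by simp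
    then have "?u f \<in> d 0 ` carrier (F (Suc 0))" using resolution(5) s f by blast
    then obtain y where "y \<in> carrier (F (Suc 0))" "?u f = d 0 y" by (rule imageE)
    then show ?thesis using F0.minus_self[OF F0.smult_closed[OF s f]] by (metis singletonI)
  qed
  obtain g where lin: "linear_map R (F 0) (F (Suc 0)) g"
    and g: "\<And>f. f \<in> carrier (F 0) \<Longrightarrow> d 0 (g f) \<ominus>\<^bsub>F 0\<^esub> ?u f \<in> {\<zero>\<^bsub>F 0\<^esub>}"
    by (rule F_lift[OF resolution(1) resolution(1) F0.submodule_zero_set std_diff_linear
          F0.linear_map_imp_mod[OF F0.submodule_zero_set resolution(1) u] ex], assumption, rule that)
  have "d 0 (g f) = ?u f" if f: "f \<in> carrier (F 0)" for f
    using g[OF f] F0.eq_iff_minus_eq_zero[OF d_closed[OF linear_mapD(1)[OF lin f]] linear_mapD(1)[OF u f]]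
    by simp
  with lin show ?thesis by blast
qed

text \<open>The map \<open>s - g d\<close> is sent to zero by \<open>d i\<close>, so exactness and
  freeness lift it through the next differential. The condition on \<open>g\<close> concerns
  boundaries only, and so covers both the lift in degree 0 and the later terms, whose extra summand
  vanishes on boundaries.\<close>

lemma homotopy_step:
  assumes s: "s \<in> carrier R" and g: "linear_map R (F i) (F (Suc i)) g"
    and dg: "\<And>f. f \<in> carrier (F (Suc i)) \<Longrightarrow> d i (g (d i f)) = s \<odot>\<^bsub>F i\<^esub> d i f"
  shows "\<exists>h. linear_map R (F (Suc i)) (F (Suc (Suc i))) h \<and>
    (\<forall>f\<in>carrier (F (Suc i)). d (Suc i) (h f) = s \<odot>\<^bsub>F (Suc i)\<^esub> f \<ominus>\<^bsub>F (Suc i)\<^esub> g (d i f))"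
proof -
  interpret Fi: Module.module R "F i" by (rule resolution(1))
  interpret Fs: Module.module R "F (Suc i)" by (rule resolution(1))
  let ?u = "\<lambda>f. s \<odot>\<^bsub>F (Suc i)\<^esub> f \<ominus>\<^bsub>F (Suc i)\<^esub> g (d i f)"
  have u: "linear_map R (F (Suc i)) (F (Suc i)) ?u"
    by (intro Fs.linear_map_minus Fs.linear_map_smult s linear_map_compose[OF std_diff_linear g])
      (simp add: linear_map_def)
  have ex: "\<exists>y\<in>carrier (F (Suc (Suc i))). d (Suc i) y \<ominus>\<^bsub>F (Suc i)\<^esub> ?u f \<in> {\<zero>\<^bsub>F (Suc i)\<^esub>}"
    if f: "f \<in> carrier (F (Suc i))" for f
  proof -
    note uf = linear_mapD(1)[OF u f]
    have gd: "g (d i f) \<in> carrier (F (Suc i))" using linear_mapD(1)[OF g d_closed[OF f]] .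
    have dm: "d i (?u f \<oplus>\<^bsub>F (Suc i)\<^esub> g (d i f)) = d i (?u f) \<oplus>\<^bsub>F i\<^esub> d i (g (d i f))"
      using linear_mapD(2)[OF std_diff_linear uf gd] .
    have "?u f \<oplus>\<^bsub>F (Suc i)\<^esub> g (d i f) = s \<odot>\<^bsub>F (Suc i)\<^esub> f"
      using gd s f by (simp add: a_minus_def Fs.M.a_assoc Fs.M.l_neg)
    then have "d i (?u f) \<oplus>\<^bsub>F i\<^esub> s \<odot>\<^bsub>F i\<^esub> d i f = s \<odot>\<^bsub>F i\<^esub> d i f"
      using dm linear_mapD(3)[OF std_diff_linear s f] dg[OF f] by simp
    then have "d i (?u f) = \<zero>\<^bsub>F i\<^esub>"
      using d_closed[OF uf] d_closed[OF f] s by (simp add: Fi.M.add.l_cancel_one)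
    then have "?u f \<in> d (Suc i) ` carrier (F (Suc (Suc i)))" using resolution(6)[of i] uf by blast
    then obtain y where "y \<in> carrier (F (Suc (Suc i)))" "?u f = d (Suc i) y" by (rule imageE)
    then show ?thesis using Fs.minus_self[OF uf] by (metis singletonI)
  qed
  obtain h where h: "linear_map R (F (Suc i)) (F (Suc (Suc i))) h"
    and dh: "\<And>f. f \<in> carrier (F (Suc i)) \<Longrightarrow> d (Suc i) (h f) \<ominus>\<^bsub>F (Suc i)\<^esub> ?u f \<in> {\<zero>\<^bsub>F (Suc i)\<^esub>}"
    by (rule F_lift[OF resolution(1) resolution(1) Fs.submodule_zero_set std_diff_linear
          Fs.linear_map_imp_mod[OF Fs.submodule_zero_set resolution(1) u] ex], assumption, rule that)
  have "d (Suc i) (h f) = ?u f" if f: "f \<in> carrier (F (Suc i))" for f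
    using dh[OF f] Fs.eq_iff_minus_eq_zero[OF d_closed[OF linear_mapD(1)[OF h f]] linear_mapD(1)[OF u f]]
    by simp
  with h show ?thesis by blast
qed

text \<open>Two consecutive terms of a null-homotopy for \<open>s\<close>; in the induction the
  upper term \<open>h\<close> becomes the next \<open>g\<close>.\<close>

lemma homotopy_exists:
  assumes s: "s \<in> carrier R" and sM: "\<And>m. m \<in> carrier M \<Longrightarrow> s \<odot>\<^bsub>M\<^esub> m = \<zero>\<^bsub>M\<^esub>"
  shows "\<exists>g h. linear_map R (F i) (F (Suc i)) g \<and> linear_map R (F (Suc i)) (F (Suc (Suc i))) h \<and>
    (\<forall>f\<in>carrier (F (Suc i)). d (Suc i) (h f) = s \<odot>\<^bsub>F (Suc i)\<^esub> f \<ominus>\<^bsub>F (Suc i)\<^esub> g (d i f))"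
proof (induction i)
  case 0
  obtain g where g: "linear_map R (F 0) (F (Suc 0)) g" "\<forall>f\<in>carrier (F 0). d 0 (g f) = s \<odot>\<^bsub>F 0\<^esub> f"
    using lift_smult_0[OF s sM] by blast
  then have "d 0 (g (d 0 f)) = s \<odot>\<^bsub>F 0\<^esub> d 0 f" if "f \<in> carrier (F (Suc 0))" for f
    using d_closed[OF that] by blast
  with homotopy_step[OF s g(1)] g(1) show ?case by blast
next
  case (Suc i)
  then obtain g h where g: "linear_map R (F i) (F (Suc i)) g" and h: "linear_map R (F (Suc i)) (F (Suc (Suc i))) h"
    and gh: "\<forall>f\<in>carrier (F (Suc i)). d (Suc i) (h f) = s \<odot>\<^bsub>F (Suc i)\<^esub> f \<ominus>\<^bsub>F (Suc i)\<^esub> g (d i f)" by blast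
  interpret Fi: Module.module R "F i" by (rule resolution(1))
  interpret Fs: Module.module R "F (Suc i)" by (rule resolution(1))
  have "d (Suc i) (h (d (Suc i) f)) = s \<odot>\<^bsub>F (Suc i)\<^esub> d (Suc i) f" if f: "f \<in> carrier (F (Suc (Suc i)))" for f
  proof -
    have "d (Suc i) (h (d (Suc i) f)) = s \<odot>\<^bsub>F (Suc i)\<^esub> d (Suc i) f \<ominus>\<^bsub>F (Suc i)\<^esub> g (d i (d (Suc i) f))"
      using gh d_closed[OF f] by blast
    also have "\<dots> = s \<odot>\<^bsub>F (Suc i)\<^esub> d (Suc i) f"
      using d_d[OF f] Fs.linear_map_zero[OF Fi.module_axioms g] s d_closed[OF f] by (simp add: a_minus_def)
    finally show ?thesis .
  qed
  with homotopy_step[OF s h] h show ?case by blast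
qed

section \<open>Vanishing of Ext at a prime\<close>

lemma not_ext_nonzero_atI:
  assumes "s \<in> carrier R - p"
    and "\<And>\<phi>. linear_map R (F i) N \<phi> \<Longrightarrow> \<forall>f\<in>carrier (F (Suc i)). \<phi> (d i f) = \<zero>\<^bsub>N\<^esub> \<Longrightarrow>
      \<exists>\<theta>\<in>coboundary_maps R M N i. \<forall>f\<in>carrier (F i). s \<odot>\<^bsub>N\<^esub> \<phi> f = \<theta> f"
  shows "\<not> ext_nonzero_at R M N p {\<zero>\<^bsub>N\<^esub>} i"
proof
  assume "ext_nonzero_at R M N p {\<zero>\<^bsub>N\<^esub>} i"
  then obtain \<phi> where lin: "linear_map R (F i) N \<phi>"
    and coc: "\<forall>f\<in>carrier (F (Suc i)). \<phi> (d i f) \<in> {\<zero>\<^bsub>N\<^esub>}"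
    and nz: "\<forall>s\<in>carrier R - p. \<forall>\<theta>\<in>coboundary_maps R M N i.
      \<exists>f\<in>carrier (F i). s \<odot>\<^bsub>N\<^esub> \<phi> f \<ominus>\<^bsub>N\<^esub> \<theta> f \<notin> {\<zero>\<^bsub>N\<^esub>}"
    unfolding ext_nonzero_at_def by (elim exE conjE)
  obtain \<theta> where \<theta>: "\<theta> \<in> coboundary_maps R M N i" "\<forall>f\<in>carrier (F i). s \<odot>\<^bsub>N\<^esub> \<phi> f = \<theta> f"
    using assms(2)[OF lin] coc by (auto simp only: singleton_iff)
  obtain f where f: "f \<in> carrier (F i)" "s \<odot>\<^bsub>N\<^esub> \<phi> f \<ominus>\<^bsub>N\<^esub> \<theta> f \<notin> {\<zero>\<^bsub>N\<^esub>}"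
    using nz assms(1) \<theta>(1) by blast
  then show False
    using \<theta>(2) N.minus_self[OF linear_mapD(1)[OF coboundary_maps_linear[OF \<theta>(1)] f(1)]] by simp
qed

text \<open>Applying a cocycle \<open>\<phi>\<close> to \<open>s = d h + g d\<close> removes the
  first term, so \<open>s \<phi>\<close> is the coboundary of \<open>\<phi> g\<close>. In degree 0
  the only coboundary is zero, and there \<open>s = d g\<close> already gives
  \<open>s \<phi> = 0\<close>.\<close>

lemma Ext_annihilated_left:
  assumes s: "s \<in> carrier R - p" and sM: "\<And>m. m \<in> carrier M \<Longrightarrow> s \<odot>\<^bsub>M\<^esub> m = \<zero>\<^bsub>M\<^esub>"
  shows "\<not> ext_nonzero_at R M N p {\<zero>\<^bsub>N\<^esub>} i"
proof (rule not_ext_nonzero_atI[OF s])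
  fix \<phi> assume lin: "linear_map R (F i) N \<phi>" and coc: "\<forall>f\<in>carrier (F (Suc i)). \<phi> (d i f) = \<zero>\<^bsub>N\<^esub>"
  have sR: "s \<in> carrier R" using s by auto
  show "\<exists>\<theta>\<in>coboundary_maps R M N i. \<forall>f\<in>carrier (F i). s \<odot>\<^bsub>N\<^esub> \<phi> f = \<theta> f"
  proof (cases i)
    case 0
    obtain g where g: "linear_map R (F 0) (F (Suc 0)) g" "\<forall>f\<in>carrier (F 0). d 0 (g f) = s \<odot>\<^bsub>F 0\<^esub> f"
      using lift_smult_0[OF sR sM] by blast
    have "s \<odot>\<^bsub>N\<^esub> \<phi> f = \<zero>\<^bsub>N\<^esub>" if f: "f \<in> carrier (F i)" for f
    proof -
      have f': "f \<in> carrier (F 0)" using f 0 by simp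
      have "\<phi> (d 0 (g f)) = \<zero>\<^bsub>N\<^esub>" using coc linear_mapD(1)[OF g(1) f'] unfolding 0 by blast
      then show ?thesis using linear_mapD(3)[OF lin sR f] g(2) f' by (simp add: 0)
    qed
    then show ?thesis by (intro bexI[OF _ coboundary_maps_zero]) simp
  next
    case (Suc j)
    obtain g h where g: "linear_map R (F j) (F (Suc j)) g" and h: "linear_map R (F (Suc j)) (F (Suc (Suc j))) h"
      and gh: "\<forall>f\<in>carrier (F (Suc j)). d (Suc j) (h f) = s \<odot>\<^bsub>F (Suc j)\<^esub> f \<ominus>\<^bsub>F (Suc j)\<^esub> g (d j f)"
      using homotopy_exists[OF sR sM] by blast
    interpret Fi: Module.module R "F i" by (rule resolution(1))
    have "s \<odot>\<^bsub>N\<^esub> \<phi> f = \<phi> (g (d j f))" if f: "f \<in> carrier (F i)" for f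
    proof -
      have f': "f \<in> carrier (F (Suc j))" using f Suc by simp
      have gd: "g (d j f) \<in> carrier (F i)" using linear_mapD(1)[OF g d_closed[OF f']] Suc by simp
      have hf: "h f \<in> carrier (F (Suc i))" using linear_mapD(1)[OF h f'] Suc by simp
      have "s \<odot>\<^bsub>F i\<^esub> f = d i (h f) \<oplus>\<^bsub>F i\<^esub> g (d j f)"
        using gh f' gd f sR by (simp add: Suc[symmetric] a_minus_def Fi.M.a_assoc Fi.M.l_neg)
      then have "s \<odot>\<^bsub>N\<^esub> \<phi> f = \<phi> (d i (h f)) \<oplus>\<^bsub>N\<^esub> \<phi> (g (d j f))"
        using linear_mapD(3)[OF lin sR f] linear_mapD(2)[OF lin d_closed[OF hf] gd] by simp
      then show ?thesis using coc hf linear_mapD(1)[OF lin gd] by simp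
    qed
    moreover have "(\<lambda>f. \<phi> (g (d j f))) \<in> coboundary_maps R M N i"
      unfolding Suc coboundary_maps_def nat.case
      by (rule CollectI, rule exI[of _ "\<lambda>f. \<phi> (g f)"])
        (use linear_map_compose[OF g lin[unfolded Suc]] in simp)
    ultimately show ?thesis by (intro bexI[of _ "\<lambda>f. \<phi> (g (d j f))"] ballI)
  qed
qed

lemma Ext_annihilated_right:
  assumes s: "s \<in> carrier R - p" and sN: "\<And>n. n \<in> carrier N \<Longrightarrow> s \<odot>\<^bsub>N\<^esub> n = \<zero>\<^bsub>N\<^esub>"
  shows "\<not> ext_nonzero_at R M N p {\<zero>\<^bsub>N\<^esub>} i"
proof (rule not_ext_nonzero_atI[OF s])
  fix \<phi> assume lin: "linear_map R (F i) N \<phi>"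
  then show "\<exists>\<theta>\<in>coboundary_maps R M N i. \<forall>f\<in>carrier (F i). s \<odot>\<^bsub>N\<^esub> \<phi> f = \<theta> f"
    using sN linear_mapD(1)[OF lin] by (intro bexI[OF _ coboundary_maps_zero]) simp
qed

end

section \<open>Tensor products\<close>

context Module.module begin

lemma linear_map_vimage_submodule:
  assumes X: "Module.module R X" and v: "linear_map R X M v" and L: "submodule L R M"
  shows "submodule {x \<in> carrier X. v x \<in> L} R X"
proof -
  interpret X: Module.module R X by fact
  show ?thesis
    by (rule X.submoduleI')
      (use linear_mapD[OF v] submodule_closed[OF L] linear_map_zero[OF X v] in auto)
qed

lemma linear_map_diff:
  assumes X: "Module.module R X" and v: "linear_map R X M v" and x: "x \<in> carrier X" and y: "y \<in> carrier X"
  shows "v (x \<ominus>\<^bsub>X\<^esub> y) = v x \<ominus>\<^bsub>M\<^esub> v y"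
proof -
  interpret X: Module.module R X by fact
  have "\<ominus>\<^bsub>X\<^esub> y = (\<ominus> \<one>) \<odot>\<^bsub>X\<^esub> y" using y by (simp add: X.smult_l_minus)
  then have "v (\<ominus>\<^bsub>X\<^esub> y) = \<ominus>\<^bsub>M\<^esub> v y"
    using linear_mapD(1,3)[OF v] y by (simp add: smult_l_minus)
  then show ?thesis using linear_mapD(2)[OF v] x y by (simp add: a_minus_def)
qed

end

context module_pair begin

abbreviation "T \<equiv> free_module R (carrier M \<times> carrier N)"
abbreviation "e \<equiv> unit_vector R"
abbreviation "W \<equiv> submodule_span R T (tensor_relations R M N)"

lemma T_is_module: "Module.module R T"
  by (rule free_module_is_module[OF cr])

lemma e_closed: "x \<in> carrier M \<Longrightarrow> y \<in> carrier N \<Longrightarrow> e (x, y) \<in> carrier T"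
  by (rule unit_vector_carrier[OF cr]) simp

lemma tensor_relations_cases:
  assumes "r \<in> tensor_relations R M N"
    and "\<And>x x' y. x \<in> carrier M \<Longrightarrow> x' \<in> carrier M \<Longrightarrow> y \<in> carrier N \<Longrightarrow>
      P (e (x \<oplus>\<^bsub>M\<^esub> x', y) \<ominus>\<^bsub>T\<^esub> (e (x, y) \<oplus>\<^bsub>T\<^esub> e (x', y)))"
    and "\<And>x y y'. x \<in> carrier M \<Longrightarrow> y \<in> carrier N \<Longrightarrow> y' \<in> carrier N \<Longrightarrow>
      P (e (x, y \<oplus>\<^bsub>N\<^esub> y') \<ominus>\<^bsub>T\<^esub> (e (x, y) \<oplus>\<^bsub>T\<^esub> e (x, y')))"
    and "\<And>a x y. a \<in> carrier R \<Longrightarrow> x \<in> carrier M \<Longrightarrow> y \<in> carrier N \<Longrightarrow>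
      P (e (a \<odot>\<^bsub>M\<^esub> x, y) \<ominus>\<^bsub>T\<^esub> a \<odot>\<^bsub>T\<^esub> e (x, y))"
    and "\<And>a x y. a \<in> carrier R \<Longrightarrow> x \<in> carrier M \<Longrightarrow> y \<in> carrier N \<Longrightarrow>
      P (e (x, a \<odot>\<^bsub>N\<^esub> y) \<ominus>\<^bsub>T\<^esub> a \<odot>\<^bsub>T\<^esub> e (x, y))"
  shows "P r"
  using assms(1) unfolding tensor_relations_def Let_def
  by (elim UnE CollectE exE conjE) (simp_all only: assms(2-5))

lemma tensor_relations_smult:
  assumes "a \<in> carrier R" "x \<in> carrier M" "y \<in> carrier N"
  shows "e (a \<odot>\<^bsub>M\<^esub> x, y) \<ominus>\<^bsub>T\<^esub> a \<odot>\<^bsub>T\<^esub> e (x, y) \<in> W"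
    and "e (x, a \<odot>\<^bsub>N\<^esub> y) \<ominus>\<^bsub>T\<^esub> a \<odot>\<^bsub>T\<^esub> e (x, y) \<in> W"
proof -
  interpret T: Module.module R T by (rule T_is_module)
  note sup = subsetD[OF T.submodule_span_superset]
  show "e (a \<odot>\<^bsub>M\<^esub> x, y) \<ominus>\<^bsub>T\<^esub> a \<odot>\<^bsub>T\<^esub> e (x, y) \<in> W"
    by (rule sup) (use assms in \<open>auto simp: tensor_relations_def Let_def\<close>)
  show "e (x, a \<odot>\<^bsub>N\<^esub> y) \<ominus>\<^bsub>T\<^esub> a \<odot>\<^bsub>T\<^esub> e (x, y) \<in> W"
    by (rule sup) (use assms in \<open>auto simp: tensor_relations_def Let_def\<close>)
qed

lemma tensor_relations_closed: "tensor_relations R M N \<subseteq> carrier T"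
proof
  interpret T: Module.module R T by (rule T_is_module)
  fix r assume "r \<in> tensor_relations R M N"
  then show "r \<in> carrier T"
    by (rule tensor_relations_cases) (auto intro!: e_closed)
qed

lemma submodule_tensor_relations: "submodule W R T"
proof -
  interpret T: Module.module R T by (rule T_is_module)
  show ?thesis by (rule T.submodule_span_is_submodule[OF tensor_relations_closed])
qed

lemma Supp_tensor_product:
  "p \<in> Supp R (tensor_product R M N) \<longleftrightarrow>
    primeideal p R \<and> (\<exists>x\<in>carrier T. \<forall>s\<in>carrier R - p. s \<odot>\<^bsub>T\<^esub> x \<notin> W)"
proof -
  interpret T: Module.module R T by (rule T_is_module)
  show ?thesis unfolding tensor_product_def Let_def
    by (rule T.Supp_quotient_module[OF submodule_tensor_relations])
qed

lemma tensor_annihilated: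
  assumes s: "s \<in> carrier R"
    and ann: "(\<forall>m\<in>carrier M. s \<odot>\<^bsub>M\<^esub> m = \<zero>\<^bsub>M\<^esub>) \<or> (\<forall>n\<in>carrier N. s \<odot>\<^bsub>N\<^esub> n = \<zero>\<^bsub>N\<^esub>)"
    and f: "f \<in> carrier T"
  shows "s \<odot>\<^bsub>T\<^esub> f \<in> W"
proof -
  interpret T: Module.module R T by (rule T_is_module)
  note W = submodule_tensor_relations
  have gen: "s \<odot>\<^bsub>T\<^esub> e (m, n) \<in> W" if m: "m \<in> carrier M" and n: "n \<in> carrier N" for m n
  proof -
    note E = e_closed[OF m n]
    note c = T.mem_submodule_cong[OF W]
    have 0: "\<zero> \<odot>\<^bsub>T\<^esub> e (m, n) \<in> W" using T.submodule_zero[OF W] E by simp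
    from ann show ?thesis
    proof
      assume "\<forall>m\<in>carrier M. s \<odot>\<^bsub>M\<^esub> m = \<zero>\<^bsub>M\<^esub>"
      \<comment> \<open>The tensor of 0 and \<open>n\<close> is written with \<open>0 m\<close> in
        place of 0, so that the scalar relation applies to it as well as to
        \<open>s m\<close>.\<close>
      then have "e (\<zero> \<odot>\<^bsub>M\<^esub> m, n) = e (s \<odot>\<^bsub>M\<^esub> m, n)" using m by simp
      moreover have "e (\<zero> \<odot>\<^bsub>M\<^esub> m, n) \<in> W"
        using c[OF tensor_relations_smult(1)[OF M.R.zero_closed m n]] 0 e_closed[OF _ n] E m by simp
      ultimately show ?thesis
        using c[OF tensor_relations_smult(1)[OF s m n] e_closed[OF _ n] T.smult_closed[OF s E]] s m by simp
    next
      assume "\<forall>n\<in>carrier N. s \<odot>\<^bsub>N\<^esub> n = \<zero>\<^bsub>N\<^esub>"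
      then have "e (m, \<zero> \<odot>\<^bsub>N\<^esub> n) = e (m, s \<odot>\<^bsub>N\<^esub> n)" using n by simp
      moreover have "e (m, \<zero> \<odot>\<^bsub>N\<^esub> n) \<in> W"
        using c[OF tensor_relations_smult(2)[OF M.R.zero_closed m n]] 0 e_closed[OF m] E n by simp
      ultimately show ?thesis
        using c[OF tensor_relations_smult(2)[OF s m n] e_closed[OF m] T.smult_closed[OF s E]] s n by simp
    qed
  qed
  show ?thesis
    using cr f
  proof (induction f rule: free_module_induct)
    case zero
    then show ?case using T.submodule_zero[OF W] s by simp
  next
    case (add a b f)
    then obtain m n where b: "b = (m, n)" "m \<in> carrier M" "n \<in> carrier N" by auto
    note E = e_closed[OF b(2,3)]
    have "s \<odot>\<^bsub>T\<^esub> (a \<odot>\<^bsub>T\<^esub> e b) = a \<odot>\<^bsub>T\<^esub> (s \<odot>\<^bsub>T\<^esub> e b)"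
      using s add(1) E b(1) by (simp flip: T.smult_assoc1 add: M.R.m_comm)
    then have "s \<odot>\<^bsub>T\<^esub> (a \<odot>\<^bsub>T\<^esub> e b) \<in> W" using T.submoduleE(4)[OF W add(1) gen[OF b(2,3)]] b(1) by simp
    then show ?case
      using T.submoduleE(5)[OF W _ add(4)] s add(1,3) E b(1) by (simp add: T.smult_r_distr)
  qed
qed

end

context noetherian_pair begin

lemma tensor_functional:
  assumes M: "saturation R M p {\<zero>\<^bsub>M\<^esub>} \<noteq> carrier M" and N: "saturation R N p {\<zero>\<^bsub>N\<^esub>} \<noteq> carrier N"
  shows "\<exists>x\<in>carrier T. \<forall>s\<in>carrier R - p. s \<odot>\<^bsub>T\<^esub> x \<notin> W"
proof -
  interpret T: Module.module R T by (rule T_is_module)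
  interpret RM: Module.module R "ring_as_module R" by (rule M.R.ring_as_module_is_module)
  obtain c m where c: "linear_mod R M (ring_as_module R) p c" and m: "m \<in> carrier M" "c m \<notin> p"
    using M.residue_functional_exists[OF p M.submodule_zero_set M] by metis
  obtain c' n where c': "linear_mod R N (ring_as_module R) p c'" and n: "n \<in> carrier N" "c' n \<notin> p"
    using N.residue_functional_exists[OF p N.submodule_zero_set N] by metis
  note cD = linear_modD[OF c, simplified] and cD' = linear_modD[OF c', simplified]
  note P = M.R.primeideal_submodule[OF p] and mi = M.R.ring_as_module_minus
  define b where "b = (\<lambda>(x, y). c x \<otimes> c' y)"
  define \<Phi> where "\<Phi> = linear_extension R (ring_as_module R) b"
  have b: "b \<in> carrier M \<times> carrier N \<rightarrow> carrier (ring_as_module R)"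
    using cD(1) cD'(1) by (auto simp: b_def)
  have lin: "linear_map R T (ring_as_module R) \<Phi>"
    unfolding \<Phi>_def by (rule RM.linear_map_linear_extension[OF b])
  have \<Phi>e: "\<Phi> (e (x, y)) = c x \<otimes> c' y" if "x \<in> carrier M" "y \<in> carrier N" for x y
    using RM.linear_extension_unit[OF _ b, of "(x, y)"] that by (simp add: \<Phi>_def b_def)
  note L = linear_mapD[OF lin, simplified] and Ld = RM.linear_map_diff[OF T.module_axioms lin]
  have Lm: "\<Phi> (f \<ominus>\<^bsub>T\<^esub> g) = \<Phi> f \<ominus> \<Phi> g" if "f \<in> carrier T" "g \<in> carrier T" for f g
    using Ld[OF that] L(1) that by (simp add: mi)
  \<comment> \<open>\<open>\<Phi>\<close> is linear into \<open>R\<close>, but its values on the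
    relations are only in \<open>p\<close>; the preimage of \<open>p\<close> is a submodule and
    therefore contains all of \<open>W\<close>.\<close>
  let ?V = "{x \<in> carrier T. \<Phi> x \<in> p}"
  have V: "submodule ?V R T" by (rule RM.linear_map_vimage_submodule[OF T.module_axioms lin P])
  have "tensor_relations R M N \<subseteq> ?V"
  proof
    fix r assume r: "r \<in> tensor_relations R M N"
    have "\<Phi> r \<in> p"
      using r
    proof (rule tensor_relations_cases)
      fix x x' y assume x: "x \<in> carrier M" "x' \<in> carrier M" and y: "y \<in> carrier N"
      have "\<Phi> (e (x \<oplus>\<^bsub>M\<^esub> x', y) \<ominus>\<^bsub>T\<^esub> (e (x, y) \<oplus>\<^bsub>T\<^esub> e (x', y))) = c (x \<oplus>\<^bsub>M\<^esub> x') \<otimes> c' y \<ominus> (c x \<otimes> c' y \<oplus> c x' \<otimes> c' y)"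
        using x y cD(1) cD'(1) by (simp add: Lm L(2) e_closed \<Phi>e)
      also have "\<dots> = (c (x \<oplus>\<^bsub>M\<^esub> x') \<ominus> (c x \<oplus> c x')) \<otimes> c' y"
        using x y cD(1) cD'(1) by (simp add: a_minus_def M.R.l_distr M.R.l_minus M.R.minus_add)
      finally have "\<Phi> (e (x \<oplus>\<^bsub>M\<^esub> x', y) \<ominus>\<^bsub>T\<^esub> (e (x, y) \<oplus>\<^bsub>T\<^esub> e (x', y))) = (c (x \<oplus>\<^bsub>M\<^esub> x') \<ominus> (c x \<oplus> c x')) \<otimes> c' y" .
      then show "\<Phi> (e (x \<oplus>\<^bsub>M\<^esub> x', y) \<ominus>\<^bsub>T\<^esub> (e (x, y) \<oplus>\<^bsub>T\<^esub> e (x', y))) \<in> p"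
        using cD(2)[OF x] cD(1) x pf(4)[OF _ cD'(1)[OF y]] by (simp add: mi)
    next
      fix x y y' assume x: "x \<in> carrier M" and y: "y \<in> carrier N" "y' \<in> carrier N"
      have "\<Phi> (e (x, y \<oplus>\<^bsub>N\<^esub> y') \<ominus>\<^bsub>T\<^esub> (e (x, y) \<oplus>\<^bsub>T\<^esub> e (x, y'))) = c x \<otimes> c' (y \<oplus>\<^bsub>N\<^esub> y') \<ominus> (c x \<otimes> c' y \<oplus> c x \<otimes> c' y')"
        using x y cD(1) cD'(1) by (simp add: Lm L(2) e_closed \<Phi>e)
      also have "\<dots> = c x \<otimes> (c' (y \<oplus>\<^bsub>N\<^esub> y') \<ominus> (c' y \<oplus> c' y'))"
        using x y cD(1) cD'(1) by (simp add: a_minus_def M.R.r_distr M.R.r_minus M.R.minus_add)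
      finally have "\<Phi> (e (x, y \<oplus>\<^bsub>N\<^esub> y') \<ominus>\<^bsub>T\<^esub> (e (x, y) \<oplus>\<^bsub>T\<^esub> e (x, y'))) = c x \<otimes> (c' (y \<oplus>\<^bsub>N\<^esub> y') \<ominus> (c' y \<oplus> c' y'))" .
      then show "\<Phi> (e (x, y \<oplus>\<^bsub>N\<^esub> y') \<ominus>\<^bsub>T\<^esub> (e (x, y) \<oplus>\<^bsub>T\<^esub> e (x, y'))) \<in> p"
        using cD'(2)[OF y] cD'(1) y pf(5)[OF _ cD(1)[OF x]] by (simp add: mi)
    next
      fix a x y assume a: "a \<in> carrier R" and x: "x \<in> carrier M" and y: "y \<in> carrier N"
      have "\<Phi> (e (a \<odot>\<^bsub>M\<^esub> x, y) \<ominus>\<^bsub>T\<^esub> a \<odot>\<^bsub>T\<^esub> e (x, y)) = c (a \<odot>\<^bsub>M\<^esub> x) \<otimes> c' y \<ominus> a \<otimes> (c x \<otimes> c' y)"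
        using a x y cD(1) cD'(1) by (simp add: Lm L(3) e_closed \<Phi>e)
      also have "\<dots> = (c (a \<odot>\<^bsub>M\<^esub> x) \<ominus> a \<otimes> c x) \<otimes> c' y"
        using a x y cD(1) cD'(1) by (simp add: a_minus_def M.R.l_distr M.R.l_minus M.R.m_assoc)
      finally have "\<Phi> (e (a \<odot>\<^bsub>M\<^esub> x, y) \<ominus>\<^bsub>T\<^esub> a \<odot>\<^bsub>T\<^esub> e (x, y)) = (c (a \<odot>\<^bsub>M\<^esub> x) \<ominus> a \<otimes> c x) \<otimes> c' y" .
      then show "\<Phi> (e (a \<odot>\<^bsub>M\<^esub> x, y) \<ominus>\<^bsub>T\<^esub> a \<odot>\<^bsub>T\<^esub> e (x, y)) \<in> p"
        using cD(3)[OF a x] cD(1) a x pf(4)[OF _ cD'(1)[OF y]] by (simp add: mi)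
      have "\<Phi> (e (x, a \<odot>\<^bsub>N\<^esub> y) \<ominus>\<^bsub>T\<^esub> a \<odot>\<^bsub>T\<^esub> e (x, y)) = c x \<otimes> c' (a \<odot>\<^bsub>N\<^esub> y) \<ominus> a \<otimes> (c x \<otimes> c' y)"
        using a x y cD(1) cD'(1) by (simp add: Lm L(3) e_closed \<Phi>e)
      also have "\<dots> = c x \<otimes> (c' (a \<odot>\<^bsub>N\<^esub> y) \<ominus> a \<otimes> c' y)"
        using a x y cD(1) cD'(1) by (simp add: a_minus_def M.R.r_distr M.R.r_minus M.R.m_lcomm)
      finally have "\<Phi> (e (x, a \<odot>\<^bsub>N\<^esub> y) \<ominus>\<^bsub>T\<^esub> a \<odot>\<^bsub>T\<^esub> e (x, y)) = c x \<otimes> (c' (a \<odot>\<^bsub>N\<^esub> y) \<ominus> a \<otimes> c' y)" .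
      then show "\<Phi> (e (x, a \<odot>\<^bsub>N\<^esub> y) \<ominus>\<^bsub>T\<^esub> a \<odot>\<^bsub>T\<^esub> e (x, y)) \<in> p"
        using cD'(3)[OF a y] cD'(1) a y pf(5)[OF _ cD(1)[OF x]] by (simp add: mi)
    qed
    then show "r \<in> ?V" using r tensor_relations_closed by blast
  qed
  then have WV: "W \<subseteq> ?V" by (rule T.submodule_span_minimal[OF V])
  have "s \<odot>\<^bsub>T\<^esub> e (m, n) \<notin> W" if s: "s \<in> carrier R - p" for s
  proof
    assume "s \<odot>\<^bsub>T\<^esub> e (m, n) \<in> W"
    then have "\<Phi> (s \<odot>\<^bsub>T\<^esub> e (m, n)) \<in> p" using WV by blast
    then have "s \<otimes> (c m \<otimes> c' n) \<in> p" using s m n e_closed by (simp add: L(3) \<Phi>e)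
    then show False using pf(8) s m n cD(1)[OF m(1)] cD'(1)[OF n(1)] by (metis DiffD1 DiffD2 M.R.m_closed)
  qed
  then show ?thesis using e_closed[OF m(1) n(1)] by blast
qed

text \<open>If \<open>M\<close> or \<open>N\<close> vanishes at \<open>p\<close>, then
  \<open>saturation_uniform\<close> for the zero submodule yields one \<open>s\<close> outside
  \<open>p\<close> that kills the whole module, as \<open>tensor_annihilated\<close>
  requires.\<close>

lemma Supp_tensor_product_iff: "p \<in> Supp R (tensor_product R M N) \<longleftrightarrow> p \<in> Supp R M \<and> p \<in> Supp R N"
proof
  assume "p \<in> Supp R (tensor_product R M N)"
  then obtain x where x: "x \<in> carrier T" "\<And>s. s \<in> carrier R - p \<Longrightarrow> s \<odot>\<^bsub>T\<^esub> x \<notin> W"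
    by (auto simp: Supp_tensor_product)
  have "saturation R M p {\<zero>\<^bsub>M\<^esub>} \<noteq> carrier M"
    using M.saturation_uniform[OF p M.submodule_zero_set] x tensor_annihilated by (metis DiffD1 singletonD)
  moreover have "saturation R N p {\<zero>\<^bsub>N\<^esub>} \<noteq> carrier N"
    using N.saturation_uniform[OF p N.submodule_zero_set] x tensor_annihilated by (metis DiffD1 singletonD)
  ultimately show "p \<in> Supp R M \<and> p \<in> Supp R N" by (simp add: M.Supp_saturation[OF p] N.Supp_saturation[OF p])
next
  assume "p \<in> Supp R M \<and> p \<in> Supp R N"
  then show "p \<in> Supp R (tensor_product R M N)"
    using tensor_functional p by (simp add: Supp_tensor_product M.Supp_saturation[OF p] N.Supp_saturation[OF p])
qed

section \<open>Supports of Ext\<close>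

lemma Supp_Ext_subset:
  assumes "p \<in> Supp R (Ext R M N i)" shows "p \<in> Supp R M \<and> p \<in> Supp R N"
proof -
  have nz: "ext_nonzero_at R M N p {\<zero>\<^bsub>N\<^esub>} i" using assms by (simp add: Supp_Ext)
  have "saturation R M p {\<zero>\<^bsub>M\<^esub>} \<noteq> carrier M"
    using M.saturation_uniform[OF p M.submodule_zero_set] Ext_annihilated_left nz by (metis singletonD)
  moreover have "saturation R N p {\<zero>\<^bsub>N\<^esub>} \<noteq> carrier N"
    using N.saturation_uniform[OF p N.submodule_zero_set] Ext_annihilated_right nz by (metis singletonD)
  ultimately show ?thesis by (simp add: M.Supp_saturation[OF p] N.Supp_saturation[OF p])
qed

lemma Supp_Ext_exists:
  assumes "p \<in> Supp R M" "p \<in> Supp R N"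
  shows "\<exists>i. enat i \<le> module_dim R N \<and> p \<in> Supp R (Ext R M N i)"
proof -
  obtain i q where E: "ext_nonzero_at R M N p {\<zero>\<^bsub>N\<^esub>} i"
    and q: "\<And>j. j \<le> i \<Longrightarrow> primeideal (q j) R" "\<And>j. j \<le> i \<Longrightarrow> saturation R N (q j) {\<zero>\<^bsub>N\<^esub>} \<noteq> carrier N"
    and chain: "\<forall>j<i. q j \<subset> q (Suc j)"
    using ext_nonzero_at_exists[OF N.submodule_zero_set] assms
    unfolding M.Supp_saturation[OF p] N.Supp_saturation[OF p] by blast
  have "\<forall>j\<le>i. q j \<in> Supp R N" using q N.Supp_saturation by blast
  \<comment> \<open>The chain \<open>q\<close> of length \<open>i\<close> is one of those whose
    lengths enter the supremum, so the bound holds whether or not the supremum is finite.\<close>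
  with chain have "enat i \<le> module_dim R N"
    unfolding module_dim_def by (intro Sup_upper) blast
  moreover have "p \<in> Supp R (Ext R M N i)" using E p by (simp add: Supp_Ext)
  ultimately show ?thesis by blast
qed

end

lemma Supp_primeideal: "p \<in> Supp R M \<Longrightarrow> primeideal p R"
  by (simp add: Supp_def)

lemma Supp_Ext_Un:
  assumes M: "noetherian_module R M" and N: "noetherian_module R N"
  shows "(\<Union>i. Supp R (Ext R M N i)) = Supp R M \<inter> Supp R N"
    and "(\<Union>i\<in>{i. enat i \<le> module_dim R N}. Supp R (Ext R M N i)) = Supp R M \<inter> Supp R N"
    and "Supp R (tensor_product R M N) = Supp R M \<inter> Supp R N"
proof -
  have pair: "noetherian_pair R M N p" if "primeideal p R" for p
    using M N that by (simp add: noetherian_pair_def noetherian_pair_axioms_def)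
  have sub: "p \<in> Supp R M \<inter> Supp R N" if "p \<in> Supp R (Ext R M N i)" for p i
    using noetherian_pair.Supp_Ext_subset[OF pair[OF Supp_primeideal[OF that]] that] by blast
  have ex: "\<exists>i. enat i \<le> module_dim R N \<and> p \<in> Supp R (Ext R M N i)" if "p \<in> Supp R M \<inter> Supp R N" for p
    using noetherian_pair.Supp_Ext_exists[OF pair] Supp_primeideal that by blast
  show "(\<Union>i. Supp R (Ext R M N i)) = Supp R M \<inter> Supp R N" using sub ex by blast
  show "(\<Union>i\<in>{i. enat i \<le> module_dim R N}. Supp R (Ext R M N i)) = Supp R M \<inter> Supp R N" using sub ex by blast
  show "Supp R (tensor_product R M N) = Supp R M \<inter> Supp R N"
  proof (rule Set.set_eqI)
    fix p
    show "p \<in> Supp R (tensor_product R M N) \<longleftrightarrow> p \<in> Supp R M \<inter> Supp R N"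
    proof (cases "primeideal p R")
      case True
      then show ?thesis using noetherian_pair.Supp_tensor_product_iff[OF pair] by simp
    next
      case False
      then show ?thesis by (metis IntD1 Supp_primeideal)
    qed
  qed
qed

section \<open>The homological support, with \<open>R\<close> in place of \<open>N\<close>\<close>

lemma (in cring) ring_as_module_finitely_generated: "finitely_generated R (ring_as_module R)"
proof -
  interpret RM: Module.module R "ring_as_module R" by (rule ring_as_module_is_module)
  have "carrier R \<subseteq> submodule_span R (ring_as_module R) {\<one>}"
  proof
    fix a assume a: "a \<in> carrier R"
    have "a \<odot>\<^bsub>ring_as_module R\<^esub> \<one> \<in> submodule_span R (ring_as_module R) {\<one>}"
      using RM.submodule_span_superset[of "{\<one>}"] a
      by (intro RM.submoduleE(4) RM.submodule_span_is_submodule) auto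
    then show "a \<in> submodule_span R (ring_as_module R) {\<one>}" using a by simp
  qed
  moreover have "submodule_span R (ring_as_module R) {\<one>} \<subseteq> carrier R"
    using RM.submodule_span_minimal[OF RM.carrier_is_submodule, of "{\<one>}"] by simp
  ultimately show ?thesis unfolding finitely_generated_def by (intro exI[of _ "{\<one>}"]) auto
qed

text \<open>The unit survives at every prime: an \<open>s\<close> that kills it is zero and hence
  lies in the prime.\<close>

lemma (in cring) Supp_ring_as_module: "Supp R (ring_as_module R) = {p. primeideal p R}"
proof -
  interpret RM: Module.module R "ring_as_module R" by (rule ring_as_module_is_module)
  show ?thesis using primeideal_facts(6) by (auto simp: RM.Supp_iff intro!: bexI[of _ \<one>])
qed

theorem proposition2p7:
  fixes R :: "('a, 'r) ring_scheme"
    and M :: "('a, 'm, 'x) module_scheme"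
    and N :: "('a, 'n, 'y) module_scheme"
  assumes "noetherian_ring R" and "local_ring R"
    and "module R M" and "finitely_generated R M" and "carrier M \<noteq> {\<zero>\<^bsub>M\<^esub>}"
    and "module R N" and "finitely_generated R N" and "carrier N \<noteq> {\<zero>\<^bsub>N\<^esub>}"
  shows "Supp R (tensor_product R M N) = (\<Union>i. Supp R (Ext R M N i))
    \<and> (\<Union>i. Supp R (Ext R M N i)) = (\<Union>i\<in>{i. enat i \<le> module_dim R N}. Supp R (Ext R M N i))
    \<and> (\<Union>i. Supp R (Ext R M (ring_as_module R) i)) = Supp R M"
proof -
  interpret M: Module.module R M by fact
  have M: "noetherian_module R M" and N: "noetherian_module R N"
    and R: "noetherian_module R (ring_as_module R)"
    using assms M.R.ring_as_module_is_module M.R.ring_as_module_finitely_generated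
    by (simp_all add: noetherian_module_def noetherian_module_axioms_def)
  have "Supp R M \<inter> Supp R (ring_as_module R) = Supp R M"
    using Supp_primeideal by (auto simp: M.R.Supp_ring_as_module)
  then show ?thesis using Supp_Ext_Un[OF M N] Supp_Ext_Un(1)[OF M R] by simp
qed

end
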